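(* Let $S>0$ and $\alpha\in(0,\pi)$. For real-valued $q\in L^2[-S,S]$, a real $2\times2$ matrix $M$ with $\det M=1$ and $\beta\in(0,\pi]$, consider the problem $-y''+qy=\lambda y$ on $[-S,S]$ with transfer condition $(y(0^+),y'(0^+))^T=M(y(0^-),y'(0^-))^T$ and boundary conditions $y(-S)\cos\alpha-y'(-S)\sin\alpha=0$, $y(S)\cos\beta-y'(S)\sin\beta=0$. Let $\lambda_0<\lambda_1<\lambda_2<\dots$ be its eigenvalues and $(a_n)_{n\ge0}$ the corresponding norming constants. Then the eigenvalues $(\lambda_n)$ together with the norming constants $(a_n)$ uniquely determine the Titchmarsh-Weyl $m$-function $m_{\alpha,\beta}$. That is: if $(q,M,\beta)$ and $(\tilde q,\tilde M,\tilde\beta)$ are two such triples, with the same $S$ and $\alpha$, for which $\lambda_n=\tilde\lambda_n$ and $a_n=\tilde a_n$ for all $n\ge0$, then $m_{\alpha,\beta}=\tilde m_{\alpha,\tilde\beta}$ as meromorphic functions on $\mathbb{C}$.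
   Context: A solution of $-y''+qy=\lambda y$ on $[-S,S]$ with the transfer condition is a function such that $y,y'$ are absolutely continuous on each of $[-S,0)$ and $(0,S]$ (with one-sided limits at $0$), satisfying the differential equation a.e. and $(y(0^+),y'(0^+))^T=M(y(0^-),y'(0^-))^T$. Let $w_\alpha(x,\lambda)$ be the solution (obeying the transfer condition) with $w_\alpha(-S,\lambda)=\sin\alpha$, $w_\alpha'(-S,\lambda)=\cos\alpha$. The norming constant associated with the eigenvalue $\lambda_n$ is $a_n=\int_{-S}^{S}w_\alpha(x,\lambda_n)^2\,dx$. Let $v_\beta(x,\lambda)$ be the solution (obeying the transfer condition) with $v_\beta(S,\lambda)=\sin\beta$, $v_\beta'(S,\lambda)=\cos\beta$. Put $$\Delta_{\alpha,\beta}(\lambda)=v_\beta'(-S,\lambda)\sin\alpha-v_\beta(-S,\lambda)\cos\alpha ,$$ an entire function whose zeros are the eigenvalues of the boundary value problem. The Titchmarsh-Weyl $m$-function is $$m_{\alpha,\beta}(\lambda)=\frac{v_\beta(-S,\lambda)\sin\alpha+v_\beta'(-S,\lambda)\cos\alpha}{\Delta_{\alpha,\beta}(\lambda)} .$$ Tildes denote the corresponding objects for $(\tilde q,\tilde M,\tilde\beta)$. *)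

theory Defs
  imports "HOL-Complex_Analysis.Complex_Analysis"
begin

text \<open>
  Absolute continuity of functions in the epsilon-delta sense. The finite set \<open>D\<close> collects the
  endpoints of non-overlapping closed intervals contained in \<open>I\<close>. On a bounded interval that is
  not closed, this implies uniform continuity and hence the existence of the one-sided limits at
  the missing endpoints.
\<close>

definition abs_cont_on :: "real set \<Rightarrow> (real \<Rightarrow> 'a::metric_space) \<Rightarrow> bool" where
  "abs_cont_on I f \<longleftrightarrow>
     (\<forall>\<epsilon>>0. \<exists>\<delta>>0. \<forall>D :: (real \<times> real) set.
        finite D \<and> (\<forall>(a, b)\<in>D. a \<le> b \<and> {a..b} \<subseteq> I) \<and>
        disjoint_family_on (\<lambda>(a, b). {a<..<b}) D \<and>
        (\<Sum>(a, b)\<in>D. b - a) < \<delta>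
        \<longrightarrow> (\<Sum>(a, b)\<in>D. dist (f a) (f b)) < \<epsilon>)"

definition square_integrable_on :: "(real \<Rightarrow> real) \<Rightarrow> real set \<Rightarrow> bool" where
  "square_integrable_on q A \<longleftrightarrow>
     set_borel_measurable lebesgue A q \<and> set_integrable lebesgue A (\<lambda>x. (q x)\<^sup>2)"

text \<open>
  The derivative \<open>y'\<close> on \<open>[-S,0) \<union> (0,S]\<close>, one-sided at the endpoints \<open>-S\<close> and \<open>S\<close>.
\<close>

definition dX :: "real \<Rightarrow> (real \<Rightarrow> complex) \<Rightarrow> real \<Rightarrow> complex" where
  "dX S y x = vector_derivative y (at x within {-S..S} - {0})"

text \<open>
  The transfer condition \<open>(y(0+), y'(0+)) = M (y(0-), y'(0-))\<close>.
\<close>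

definition transfer_condition :: "real \<Rightarrow> real^2^2 \<Rightarrow> (real \<Rightarrow> complex) \<Rightarrow> bool" where
  "transfer_condition S M y \<longleftrightarrow>
     (\<exists>l r :: complex^2.
        (y \<longlongrightarrow> l $ 1) (at_left 0) \<and> (dX S y \<longlongrightarrow> l $ 2) (at_left 0) \<and>
        (y \<longlongrightarrow> r $ 1) (at_right 0) \<and> (dX S y \<longlongrightarrow> r $ 2) (at_right 0) \<and>
        r = map_matrix complex_of_real M *v l)"

text \<open>
  Solutions of \<open>-y'' + q y = z y\<close> on \<open>[-S,S]\<close> obeying the transfer condition. Their values at
  \<open>0\<close> and outside \<open>[-S,S]\<close> are unconstrained.
\<close>

definition is_solution ::
    "real \<Rightarrow> (real \<Rightarrow> real) \<Rightarrow> real^2^2 \<Rightarrow> complex \<Rightarrow> (real \<Rightarrow> complex) \<Rightarrow> bool" where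
  "is_solution S q M z y \<longleftrightarrow>
     y differentiable_on ({-S..S} - {0}) \<and>
     abs_cont_on {-S..<0} y \<and> abs_cont_on {0<..S} y \<and>
     abs_cont_on {-S..<0} (dX S y) \<and> abs_cont_on {0<..S} (dX S y) \<and>
     (AE x in lebesgue. x \<in> {-S..S} \<longrightarrow>
        (\<exists>y2. (dX S y has_vector_derivative y2) (at x) \<and>
              - y2 + complex_of_real (q x) * y x = z * y x)) \<and>
     transfer_condition S M y"

text \<open>
  The following two solutions are determined on \<open>[-S,S]\<close> except for the value at \<open>0\<close>, on which
  nothing below depends.
\<close>

definition w_sol ::
    "real \<Rightarrow> (real \<Rightarrow> real) \<Rightarrow> real^2^2 \<Rightarrow> real \<Rightarrow> complex \<Rightarrow> real \<Rightarrow> complex" where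
  "w_sol S q M \<alpha> z =
     (SOME y. is_solution S q M z y \<and>
        y (-S) = complex_of_real (sin \<alpha>) \<and> dX S y (-S) = complex_of_real (cos \<alpha>))"

definition v_sol ::
    "real \<Rightarrow> (real \<Rightarrow> real) \<Rightarrow> real^2^2 \<Rightarrow> real \<Rightarrow> complex \<Rightarrow> real \<Rightarrow> complex" where
  "v_sol S q M \<beta> z =
     (SOME y. is_solution S q M z y \<and>
        y S = complex_of_real (sin \<beta>) \<and> dX S y S = complex_of_real (cos \<beta>))"

definition eigenvalues ::
    "real \<Rightarrow> real \<Rightarrow> (real \<Rightarrow> real) \<Rightarrow> real^2^2 \<Rightarrow> real \<Rightarrow> complex set" where
  "eigenvalues S \<alpha> q M \<beta> =
     {z. \<exists>y. is_solution S q M z y \<and> (\<exists>x\<in>{-S..S} - {0}. y x \<noteq> 0) \<and>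
          y (-S) * complex_of_real (cos \<alpha>) - dX S y (-S) * complex_of_real (sin \<alpha>) = 0 \<and>
          y S * complex_of_real (cos \<beta>) - dX S y S * complex_of_real (sin \<beta>) = 0}"

text \<open>
  \<open>lam 0 < lam 1 < \<dots>\<close> is the list of all eigenvalues, which are real for the problems considered.
\<close>

definition eigenvalue_sequence ::
    "real \<Rightarrow> real \<Rightarrow> (real \<Rightarrow> real) \<Rightarrow> real^2^2 \<Rightarrow> real \<Rightarrow> (nat \<Rightarrow> real) \<Rightarrow> bool" where
  "eigenvalue_sequence S \<alpha> q M \<beta> lam \<longleftrightarrow>
     strict_mono lam \<and> range (\<lambda>n. complex_of_real (lam n)) = eigenvalues S \<alpha> q M \<beta>"

text \<open>
  As \<open>w_sol\<close> is complex-valued, so is the norming constant; it is real for real \<open>z\<close>.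
\<close>

definition norming_constant ::
    "real \<Rightarrow> real \<Rightarrow> (real \<Rightarrow> real) \<Rightarrow> real^2^2 \<Rightarrow> real \<Rightarrow> complex" where
  "norming_constant S \<alpha> q M z =
     (LINT x:{-S..S}|lebesgue. (w_sol S q M \<alpha> (complex_of_real z) x)\<^sup>2)"

definition Delta ::
    "real \<Rightarrow> real \<Rightarrow> (real \<Rightarrow> real) \<Rightarrow> real^2^2 \<Rightarrow> real \<Rightarrow> complex \<Rightarrow> complex" where
  "Delta S \<alpha> q M \<beta> z =
     dX S (v_sol S q M \<beta> z) (-S) * complex_of_real (sin \<alpha>)
     - v_sol S q M \<beta> z (-S) * complex_of_real (cos \<alpha>)"

text \<open>
  The Titchmarsh-Weyl function. At the zeros of \<open>Delta\<close>, where it has its poles, it takes the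
  value \<open>0\<close> by the convention for division by zero.
\<close>

definition tw_m ::
    "real \<Rightarrow> real \<Rightarrow> (real \<Rightarrow> real) \<Rightarrow> real^2^2 \<Rightarrow> real \<Rightarrow> complex \<Rightarrow> complex" where
  "tw_m S \<alpha> q M \<beta> z =
     (v_sol S q M \<beta> z (-S) * complex_of_real (sin \<alpha>)
      + dX S (v_sol S q M \<beta> z) (-S) * complex_of_real (cos \<alpha>)) / Delta S \<alpha> q M \<beta> z"

end

theory Submission
  imports Defs
begin

text \<open>
  Write \<open>\<Delta>\<close> for \<open>Delta\<close> and let \<open>v\<close> and \<open>w\<close> be the solutions normalised at \<open>S\<close> and \<open>-S\<close>. At an eigenvalue
  \<open>\<lambda>\<^sub>n\<close> one has \<open>v = k w\<close> with \<open>k\<close> the numerator of the \<open>m\<close>-function, and Lagrange's identity gives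
  \<open>\<Delta>'(\<lambda>\<^sub>n) = k a\<^sub>n\<close>; so the poles of \<open>m\<close> are simple with residue \<open>1 / a\<^sub>n\<close>, and the difference \<open>F\<close> of the two
  \<open>m\<close>-functions is entire.

  Asymptotics of solutions are not needed to see that \<open>F = 0\<close>. Off the real axis let \<open>u = v / \<Delta>\<close>, so that
  \<open>u(-S) = sin \<alpha> (m - cot \<alpha>)\<close>. Green's identity gives \<open>\<bar>Im z\<bar> \<integral>|u|\<^sup>2 \<le> |u(-S)| / sin \<alpha>\<close>, and testing the
  equation against a function supported on \<open>[-S, -S + |z|\<^sup>-\<^sup>1\<^sup>/\<^sup>2]\<close> bounds \<open>|u(-S)|\<close> by the \<open>L\<^sup>2\<close> norm of \<open>u\<close>. Together,
  \<open>|m - cot \<alpha>| \<bar>Im z\<bar> \<le> C |z|\<^sup>1\<^sup>/\<^sup>2\<close>, and the maximum principle applied to \<open>F(z) (z\<^sup>2 - R\<^sup>2)\<close> on \<open>|z| \<le> R\<close>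
  with \<open>R \<rightarrow> \<infinity>\<close> yields \<open>F = 0\<close>.
\<close>

section \<open>Absolutely continuous functions and indefinite integrals\<close>

text \<open>As \<open>q\<close> is only square integrable, the derivative of a solution is itself
  differentiable merely almost everywhere. Solutions are therefore treated as pairs of integral
  equations, which rests on both directions between absolute continuity and integration. The
  spectral facts flow from a single identity, Lagrange's for two solutions at parameters
  \<open>z\<close> and \<open>\<zeta>\<close>, valid across 0 because \<open>M\<close> preserves
  Wronskians. Equal parameters carry boundary data from one end to the other, a moving parameter
  gives holomorphy of \<open>Delta\<close>, and a conjugate pair gives Green's identity. The
  constant cot \<alpha> depends on \<alpha> alone and cancels between the two problems. The test
  function lives left of 0, so \<open>M\<close> and \<beta> influence the growth bound only through
  Green's identity, where they leave no trace in the constant. The estimate degenerates on the real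
  axis, where the poles lie, so Liouville's theorem cannot be applied to it directly; with the
  multiplier, any growth exponent below 1 would do, and 1/2 comes from balancing the length of the
  test interval.\<close>

definition nonoverlapping :: "real set \<Rightarrow> (real \<times> real) set \<Rightarrow> bool" where
  "nonoverlapping I D \<longleftrightarrow> finite D \<and> (\<forall>(a, b)\<in>D. a \<le> b \<and> {a..b} \<subseteq> I) \<and>
     disjoint_family_on (\<lambda>(a, b). {a<..<b}) D"

lemma nonoverlappingI:
  assumes "disjoint_family_on (\<lambda>(a, b). {a<..<b}) D"
    and "\<And>u v. (u, v) \<in> D \<Longrightarrow> u \<le> v \<and> {u..v} \<subseteq> I" and "finite D"
  shows "nonoverlapping I D"
  unfolding nonoverlapping_def using assms by fast

lemma nonoverlappingD:
  assumes "nonoverlapping I D"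
  shows "finite D" "(a, b) \<in> D \<Longrightarrow> a \<le> b" "(a, b) \<in> D \<Longrightarrow> {a..b} \<subseteq> I"
    "(a, b) \<in> D \<Longrightarrow> a \<in> I" "(a, b) \<in> D \<Longrightarrow> b \<in> I"
    "disjoint_family_on (\<lambda>(a, b). {a<..<b}) D"
  using assms unfolding nonoverlapping_def by fastforce+

lemma nonoverlapping_mono: "nonoverlapping I D \<Longrightarrow> I \<subseteq> J \<Longrightarrow> nonoverlapping J D"
  unfolding nonoverlapping_def by fast

lemma abs_cont_on_iff:
  "abs_cont_on I f \<longleftrightarrow> (\<forall>e>0. \<exists>d>0. \<forall>D. nonoverlapping I D \<longrightarrow>
     (\<Sum>(a, b)\<in>D. b - a) < d \<longrightarrow> (\<Sum>(a, b)\<in>D. dist (f a) (f b)) < e)"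
  by (simp only: abs_cont_on_def nonoverlapping_def imp_conjL)

lemma abs_cont_onE:
  assumes "abs_cont_on I f" and "0 < e"
  obtains d where "0 < d" and "\<And>D. nonoverlapping I D \<Longrightarrow> (\<Sum>(a, b)\<in>D. b - a) < d \<Longrightarrow>
    (\<Sum>(a, b)\<in>D. dist (f a) (f b)) < e"
  using assms unfolding abs_cont_on_iff by blast

lemma abs_cont_onI:
  assumes "\<And>e. 0 < e \<Longrightarrow> \<exists>d>0. \<forall>D. nonoverlapping I D \<longrightarrow> (\<Sum>(a, b)\<in>D. b - a) < d \<longrightarrow>
    (\<Sum>(a, b)\<in>D. dist (f a) (f b)) < e"
  shows "abs_cont_on I f"
  using assms unfolding abs_cont_on_iff by blast

lemma sum_disjoint_intervals_le_measure:
  fixes D :: "(real \<times> real) set"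
  assumes "finite D" and "disjoint_family_on (\<lambda>(a, b). {a<..<b}) D"
    and le: "\<And>a b. (a, b) \<in> D \<Longrightarrow> a \<le> b"
    and sub: "\<And>a b. (a, b) \<in> D \<Longrightarrow> {a<..<b} \<subseteq> U" and "U \<in> lmeasurable"
  shows "(\<Sum>(a, b)\<in>D. b - a) \<le> measure lebesgue U"
proof -
  have "(\<Sum>(a, b)\<in>D. b - a) = (\<Sum>x\<in>D. measure lebesgue ((\<lambda>(a, b). {a<..<b}) x))"
    using le by (intro sum.cong) auto
  also have "\<dots> = measure lebesgue (\<Union>x\<in>D. (\<lambda>(a, b). {a<..<b}) x)"
    using assms(1,2) by (intro measure_finite_Union[symmetric]) (auto simp: emeasure_lborel_Ioo[OF le])
  also have "\<dots> \<le> measure lebesgue U"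
    using sub \<open>U \<in> lmeasurable\<close> \<open>finite D\<close>
    by (intro measure_mono_fmeasurable sets.finite_UN) auto
  finally show ?thesis .
qed

lemma negligible_open_cover:
  fixes N :: "real set"
  assumes "negligible N" "e > 0"
  obtains U where "open U" "N \<subseteq> U" "U \<in> lmeasurable" "measure lebesgue U < e"
proof -
  have N: "N \<in> null_sets lebesgue"
    using assms(1) by (simp add: negligible_iff_null_sets)
  obtain U where U: "open U" "N \<subseteq> U" "U - N \<in> lmeasurable" "emeasure lebesgue (U - N) < ennreal e"
    using sets_lebesgue_outer_open[of N e] N assms(2) by auto
  have Us: "U \<in> sets lebesgue"
    using U(1) by simp
  have eq: "emeasure lebesgue (U - N) = emeasure lebesgue U"
    using N Us by (rule emeasure_Diff_null_set)
  then have m: "U \<in> lmeasurable"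
    using U(3) Us by (auto simp: fmeasurable_def)
  have "measure lebesgue U < e"
    using U(4) m assms(2) unfolding eq by (simp add: emeasure_eq_measure2 ennreal_less_iff)
  with U m that show thesis by blast
qed

text \<open>Absolute continuity pays for an arbitrary null set \<open>N\<close> of bad points. With
  the integrand set to 0 on \<open>N\<close>, tagged intervals fall into two kinds: tags outside
  \<open>N\<close> obey the usual straddle estimate, while the gauge forces intervals tagged in
  \<open>N\<close> into an open set of measure below the \<open>\<delta>\<close> of absolute
  continuity, so that the increments of \<open>f\<close> over them add up to little.\<close>

theorem fundamental_theorem_of_calculus_abs_cont:
  fixes f :: "real \<Rightarrow> 'a::banach"
  assumes "a \<le> b" and ac: "abs_cont_on {a..b} f" and "negligible N"
    and vecd: "\<And>x. x \<in> {a..b} - N \<Longrightarrow> (f has_vector_derivative g x) (at x within {a..b})"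
  shows "(g has_integral (f b - f a)) {a..b}"
proof -
  define h where "h x = (if x \<in> N then 0 else g x)" for x
  have "(h has_integral (f b - f a)) {a..b}"
    unfolding has_integral_real
  proof safe
    fix e :: real
    assume "e > 0"
    \<comment> \<open>The straddle errors sum to at most \<open>c * (b - a)\<close>, which is below
      \<open>e / 2\<close>; the summand 1 avoids division by zero when \<open>a = b\<close>.\<close>
    define c where "c = e / (2 * (b - a + 1))"
    have "c > 0" using \<open>e > 0\<close> \<open>a \<le> b\<close> by (simp add: c_def)
    have "e / 2 > 0" using \<open>e > 0\<close> by simp
    obtain \<delta> where "\<delta> > 0" and \<delta>: "\<And>D. nonoverlapping {a..b} D \<Longrightarrow> (\<Sum>(u, v)\<in>D. v - u) < \<delta> \<Longrightarrow>
        (\<Sum>(u, v)\<in>D. dist (f u) (f v)) < e / 2"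
      using abs_cont_onE[OF ac \<open>e / 2 > 0\<close>] by blast
    obtain U where U: "open U" "N \<subseteq> U" "U \<in> lmeasurable" "measure lebesgue U < \<delta>"
      using negligible_open_cover[OF \<open>negligible N\<close> \<open>\<delta> > 0\<close>] .
    have "\<exists>d>0. (x \<in> N \<longrightarrow> ball x d \<subseteq> U) \<and> (x \<in> {a..b} - N \<longrightarrow>
       (\<forall>y\<in>{a..b}. norm (y-x) < d \<longrightarrow> norm (f y - f x - (y-x) *\<^sub>R g x) \<le> c * norm (y-x)))" for x
    proof (cases "x \<in> N")
      case True
      then show ?thesis using U(1,2) by (metis DiffD2 openE subsetD)
    next
      case False
      then show ?thesis
        using vecd[unfolded has_vector_derivative_def has_derivative_within_alt, of x] \<open>c > 0\<close>
        by (metis zero_less_one)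
    qed
    then obtain d where d: "\<And>x. 0 < d x" "\<And>x. x \<in> N \<Longrightarrow> ball x (d x) \<subseteq> U"
       "\<And>x y. \<lbrakk>x \<in> {a..b}; x \<notin> N; y \<in> {a..b}; norm (y-x) < d x\<rbrakk>
            \<Longrightarrow> norm (f y - f x - (y-x) *\<^sub>R g x) \<le> c * norm (y-x)"
      by (metis DiffI)
    show "\<exists>\<gamma>. gauge \<gamma> \<and> (\<forall>\<D>. \<D> tagged_division_of {a..b} \<and> \<gamma> fine \<D> \<longrightarrow>
          norm ((\<Sum>(x, k)\<in>\<D>. measure lborel k *\<^sub>R h x) - (f b - f a)) < e)"
    proof (rule exI, safe)
      show "gauge (\<lambda>x. ball x (d x))"
        using d(1) gauge_ball_dependent by blast
    next
      fix p
      assume ptag: "p tagged_division_of {a..b}" and finep: "(\<lambda>x. ball x (d x)) fine p"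
      have finp: "finite p" using ptag by blast
      have ba: "b - a = (\<Sum>(x,K)\<in>p. Sup K - Inf K)" "f b - f a = (\<Sum>(x,K)\<in>p. f(Sup K) - f(Inf K))"
        using additive_tagged_division_1[where f= "\<lambda>x. x"] additive_tagged_division_1[where f= f]
              \<open>a \<le> b\<close> ptag by auto
      have K: "\<exists>u v. K = {u..v} \<and> u \<le> v \<and> Inf K = u \<and> Sup K = v \<and> x \<in> K \<and> K \<subseteq> {a..b} \<and> K \<subseteq> ball x (d x)"
        if xK: "(x, K) \<in> p" for x K
      proof -
        obtain u v where uv: "K = cbox u v" "x \<in> K" "K \<subseteq> {a..b}"
          using tagged_division_ofD(2-4)[OF ptag xK] by metis
        then have "u \<le> v" by auto
        then show ?thesis
          using uv finep xK by (intro exI[of _ u] exI[of _ v]) (auto simp: fine_def)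
      qed
      define pg where "pg = {(x, K). (x, K) \<in> p \<and> x \<notin> N}"
      \<comment> \<open>Degenerate intervals tagged in \<open>N\<close> contribute 0. Without them
        the map to endpoint pairs is injective, since two distinct members of the division cannot
        share a nonempty interior.\<close>
      define pb where "pb = {(x, K). (x, K) \<in> p \<and> x \<in> N \<and> Inf K < Sup K}"
      let ?t = "\<lambda>(x, K). (measure lborel K *\<^sub>R h x) - (f (Sup K) - f (Inf K))"
      have fin: "finite pg" "finite pb"
        using finp by (auto simp: pg_def pb_def intro: finite_subset[of _ p])
      have "norm (\<Sum>z\<in>pg. ?t z) \<le> (\<Sum>n\<in>pg. c * (case n of (x, k) \<Rightarrow> Sup k - Inf k))"
      proof (rule sum_norm_le, safe)
        fix x K
        assume "(x, K) \<in> pg"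
        then have xK: "(x, K) \<in> p" and "x \<notin> N" by (auto simp: pg_def)
        obtain u v where k: "K = {u..v}" "u \<le> v" "Inf K = u" "Sup K = v" "x \<in> K" "K \<subseteq> {a..b}" "K \<subseteq> ball x (d x)"
          using K[OF xK] by blast
        have "norm ((v - u) *\<^sub>R g x - (f v - f u)) = norm (f u - f x - (u - x) *\<^sub>R g x - (f v - f x - (v - x) *\<^sub>R g x))"
          by (auto simp: algebra_simps)
        also have "\<dots> \<le> norm (f u - f x - (u - x) *\<^sub>R g x) + norm (f v - f x - (v - x) *\<^sub>R g x)"
          by (rule norm_triangle_ineq4)
        also have "\<dots> \<le> c * norm (u - x) + c * norm (v - x)"
        proof -
          have "u \<in> K" "v \<in> K" using k(1,2) by simp_all
          then have "u \<in> ball x (d x)" "v \<in> ball x (d x)" using k(7) by blast+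
          then show ?thesis
            using k \<open>x \<notin> N\<close> by (intro add_mono d(3)) (auto simp: dist_real_def)
        qed
        also have "\<dots> = c * (Sup K - Inf K)"
          using k by (auto simp: field_simps)
        finally show "norm (measure lborel K *\<^sub>R h x - (f (Sup K) - f (Inf K))) \<le> c * (Sup K - Inf K)"
          using k \<open>x \<notin> N\<close> by (simp add: h_def)
      qed
      also have "\<dots> \<le> (\<Sum>n\<in>p. c * (case n of (x, k) \<Rightarrow> Sup k - Inf k))"
        using finp K \<open>c > 0\<close> by (intro sum_mono2) (force simp: pg_def)+
      also have "\<dots> = c * (b - a)"
        by (simp add: ba sum_distrib_left)
      also have "\<dots> < e / 2"
        using \<open>e > 0\<close> \<open>a \<le> b\<close> by (simp add: c_def field_simps)
      finally have good: "norm (\<Sum>z\<in>pg. ?t z) < e / 2" .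
      define D where "D = (\<lambda>(x, K). (Inf K, Sup K)) ` pb"
      have inter: "interior K1 \<inter> interior K2 = {}"
        if "(x1, K1) \<in> p" "(x2, K2) \<in> p" "(x1, K1) \<noteq> (x2, K2)" for x1 x2 K1 K2
        using ptag that by (rule tagged_division_ofD(5))
      have int: "interior K = {Inf K<..<Sup K}" if "(x, K) \<in> p" for x K
        using K[OF that] by (metis interior_atLeastAtMost_real)
      have inj: "inj_on (\<lambda>(x, K). (Inf K, Sup K)) pb"
      proof (rule inj_onI, clarify)
        fix x1 K1 x2 K2 :: "real set" and y1 y2 :: real
        assume 1: "(y1, K1) \<in> pb" "(y2, K2) \<in> pb" "Inf K1 = Inf K2" "Sup K1 = Sup K2"
        then have 2: "(y1, K1) \<in> p" "(y2, K2) \<in> p" by (auto simp: pb_def)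
        show "y1 = y2 \<and> K1 = K2"
        proof (rule ccontr)
          assume "\<not> ?thesis"
          then have "interior K1 \<inter> interior K2 = {}" using inter[OF 2] by auto
          then have "{Inf K1<..<Sup K1} = {}"
            using int[OF 2(1)] int[OF 2(2)] 1 by simp
          then show False using 1(1) by (auto simp: pb_def)
        qed
      qed
      have "(\<Sum>(u, v)\<in>D. dist (f u) (f v)) < e / 2"
      proof (rule \<delta>)
        have "disjoint_family_on (\<lambda>(u, v). {u<..<v}) D"
          unfolding disjoint_family_on_def
        proof (intro ballI impI)
          fix i j assume ij: "i \<in> D" "j \<in> D" "i \<noteq> j"
          then obtain y1 K1 y2 K2 where 1: "(y1, K1) \<in> p" "(y2, K2) \<in> p"
              and 2: "i = (Inf K1, Sup K1)" "j = (Inf K2, Sup K2)"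
            by (auto simp: D_def pb_def)
          with ij have "(y1, K1) \<noteq> (y2, K2)" by auto
          from inter[OF 1 this] int[OF 1(1)] int[OF 1(2)]
          show "(\<lambda>(u, v). {u<..<v}) i \<inter> (\<lambda>(u, v). {u<..<v}) j = {}"
            by (simp add: 2)
        qed
        moreover have "u \<le> v \<and> {u..v} \<subseteq> {a..b}" if "(u, v) \<in> D" for u v
        proof -
          from that obtain y K1 where 1: "(y, K1) \<in> p" "u = Inf K1" "v = Sup K1"
            by (auto simp: D_def pb_def)
          with K[OF 1(1)] show ?thesis by auto
        qed
        moreover have "finite D" using fin by (simp add: D_def)
        ultimately show no: "nonoverlapping {a..b} D"
          by (intro nonoverlappingI)
        have "(\<Sum>(u, v)\<in>D. v - u) \<le> measure lebesgue U"
        proof (rule sum_disjoint_intervals_le_measure[OF _ nonoverlappingD(6)[OF no] _ _ U(3)])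
          fix u v assume "(u, v) \<in> D"
          then obtain y K1 where "(y, K1) \<in> p" "y \<in> N" "u = Inf K1" "v = Sup K1"
            by (auto simp: D_def pb_def)
          with K[OF this(1)] d(2)[of y] show "u \<le> v" "{u<..<v} \<subseteq> U" by fastforce+
        qed (use fin in \<open>simp add: D_def\<close>)
        then show "(\<Sum>(u, v)\<in>D. v - u) < \<delta>" using U(4) by simp
      qed
      also have "(\<Sum>(u, v)\<in>D. dist (f u) (f v)) = (\<Sum>z\<in>pb. norm (?t z))"
        unfolding D_def sum.reindex[OF inj]
        by (intro sum.cong) (auto simp: pb_def h_def dist_norm norm_minus_commute)
      finally have bad: "(\<Sum>z\<in>pb. norm (?t z)) < e / 2" .
      have "(\<Sum>z\<in>p. ?t z) = (\<Sum>z\<in>pg \<union> pb. ?t z)"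
      proof (rule sum.mono_neutral_right[OF finp])
        show "\<forall>i\<in>p - (pg \<union> pb). ?t i = 0"
        proof (rule ballI)
          fix z assume z: "z \<in> p - (pg \<union> pb)"
          obtain x k where xk: "z = (x, k)" by force
          with z have "(x, k) \<in> p" "(x, k) \<notin> pg" "(x, k) \<notin> pb" by auto
          with K[OF this(1)] show "?t z = 0"
            by (auto simp: pg_def pb_def h_def xk)
        qed
      qed (auto simp: pg_def pb_def)
      also have "\<dots> = (\<Sum>z\<in>pg. ?t z) + (\<Sum>z\<in>pb. ?t z)"
        using fin by (intro sum.union_disjoint) (auto simp: pg_def pb_def)
      also have "norm \<dots> \<le> norm (\<Sum>z\<in>pg. ?t z) + (\<Sum>z\<in>pb. norm (?t z))"
        by (rule norm_triangle_mono[OF order_refl norm_sum])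
      finally have "norm (\<Sum>z\<in>p. ?t z) < e"
        using good bad by linarith
      then show "norm ((\<Sum>(x, k)\<in>p. measure lborel k *\<^sub>R h x) - (f b - f a)) < e"
        by (simp add: ba split_def sum_subtractf)
    qed
  qed
  then show ?thesis
    by (rule has_integral_spike[OF \<open>negligible N\<close>, rotated]) (auto simp: h_def)
qed

lemma abs_cont_on_subset: "abs_cont_on J f \<Longrightarrow> I \<subseteq> J \<Longrightarrow> abs_cont_on I f"
  unfolding abs_cont_on_iff by (meson nonoverlapping_mono)

lemma abs_cont_on_cong:
  assumes "abs_cont_on I f" and eq: "\<And>x. x \<in> I \<Longrightarrow> f x = g x"
  shows "abs_cont_on I g"
proof (rule abs_cont_onI)
  fix e :: real
  assume "e > 0"
  obtain d where d: "0 < d" "\<And>D. nonoverlapping I D \<Longrightarrow> (\<Sum>(u, v)\<in>D. v - u) < d \<Longrightarrow>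
    (\<Sum>(u, v)\<in>D. dist (f u) (f v)) < e"
    using abs_cont_onE[OF assms(1) \<open>e > 0\<close>] by blast
  show "\<exists>d>0. \<forall>D. nonoverlapping I D \<longrightarrow> (\<Sum>(u, v)\<in>D. v - u) < d \<longrightarrow>
    (\<Sum>(u, v)\<in>D. dist (g u) (g v)) < e"
  proof (intro exI[of _ d] conjI allI impI d(1))
    fix D :: "(real \<times> real) set"
    assume D: "nonoverlapping I D" "(\<Sum>(u, v)\<in>D. v - u) < d"
    have "(\<Sum>(u, v)\<in>D. dist (g u) (g v)) = (\<Sum>(u, v)\<in>D. dist (f u) (f v))"
      using nonoverlappingD[OF D(1)] eq by (intro sum.cong) auto
    also have "\<dots> < e" using d(2) D by blast
    finally show "(\<Sum>(u, v)\<in>D. dist (g u) (g v)) < e" .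
  qed
qed

lemma abs_cont_on_imp_uniformly_continuous_on:
  assumes "abs_cont_on I f" and I: "\<And>x y. x \<in> I \<Longrightarrow> y \<in> I \<Longrightarrow> {x..y} \<subseteq> I"
  shows "uniformly_continuous_on I f"
  unfolding uniformly_continuous_on_def
proof (intro allI impI)
  fix e :: real
  assume "e > 0"
  obtain d where d: "0 < d" "\<And>D. nonoverlapping I D \<Longrightarrow> (\<Sum>(u, v)\<in>D. v - u) < d \<Longrightarrow>
    (\<Sum>(u, v)\<in>D. dist (f u) (f v)) < e"
    using abs_cont_onE[OF assms(1) \<open>e > 0\<close>] by blast
  have *: "dist (f x) (f y) < e" if "x \<in> I" "y \<in> I" "x \<le> y" "dist x y < d" for x y
    using d(2)[of "{(x, y)}"] that I by (auto simp: nonoverlapping_def disjoint_family_on_def dist_real_def)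
  show "\<exists>d>0. \<forall>x\<in>I. \<forall>x'\<in>I. dist x' x < d \<longrightarrow> dist (f x') (f x) < e"
    using * d(1) by (metis dist_commute linear)
qed

lemma abs_cont_on_mult:
  fixes f g :: "real \<Rightarrow> 'a::real_normed_algebra"
  assumes "abs_cont_on I f" "abs_cont_on I g" and bd: "bounded (f ` I)" "bounded (g ` I)"
  shows "abs_cont_on I (\<lambda>x. f x * g x)"
proof (rule abs_cont_onI)
  fix e :: real
  assume "e > 0"
  obtain B1 B2 where "\<forall>x\<in>I. norm (f x) \<le> B1" "\<forall>x\<in>I. norm (g x) \<le> B2"
    using bd by (auto simp: bounded_iff)
  then obtain B where B: "B > 0" "\<And>x. x \<in> I \<Longrightarrow> norm (f x) \<le> B" "\<And>x. x \<in> I \<Longrightarrow> norm (g x) \<le> B"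
    using that[of "max 1 (max B1 B2)"] by fastforce
  have e': "e / (2 * B) > 0" using \<open>e > 0\<close> B(1) by simp
  obtain d1 where d1: "0 < d1" "\<And>D. nonoverlapping I D \<Longrightarrow> (\<Sum>(u, v)\<in>D. v - u) < d1 \<Longrightarrow>
    (\<Sum>(u, v)\<in>D. dist (f u) (f v)) < e / (2 * B)"
    using abs_cont_onE[OF assms(1) e'] by blast
  obtain d2 where d2: "0 < d2" "\<And>D. nonoverlapping I D \<Longrightarrow> (\<Sum>(u, v)\<in>D. v - u) < d2 \<Longrightarrow>
    (\<Sum>(u, v)\<in>D. dist (g u) (g v)) < e / (2 * B)"
    using abs_cont_onE[OF assms(2) e'] by blast
  show "\<exists>d>0. \<forall>D. nonoverlapping I D \<longrightarrow> (\<Sum>(u, v)\<in>D. v - u) < d \<longrightarrow>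
    (\<Sum>(u, v)\<in>D. dist (f u * g u) (f v * g v)) < e"
  proof (intro exI[of _ "min d1 d2"] conjI allI impI)
    fix D :: "(real \<times> real) set"
    assume D: "nonoverlapping I D" "(\<Sum>(u, v)\<in>D. v - u) < min d1 d2"
    have "dist (f u * g u) (f v * g v) \<le> B * dist (f u) (f v) + B * dist (g u) (g v)"
      if "(u, v) \<in> D" for u v
    proof -
      from nonoverlappingD[OF D(1)] that have uv: "u \<in> I" "v \<in> I" by auto
      have "dist (f u * g u) (f v * g v) = norm ((f u - f v) * g u + f v * (g u - g v))"
        by (simp add: dist_norm algebra_simps)
      also have "\<dots> \<le> norm (f u - f v) * norm (g u) + norm (f v) * norm (g u - g v)"
        by (intro norm_triangle_mono norm_mult_ineq)
      also have "\<dots> \<le> norm (f u - f v) * B + B * norm (g u - g v)"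
        using B uv by (intro add_mono mult_mono) auto
      finally show ?thesis by (simp add: dist_norm mult.commute)
    qed
    then have "(\<Sum>(u, v)\<in>D. dist (f u * g u) (f v * g v)) \<le>
        (\<Sum>(u, v)\<in>D. B * dist (f u) (f v) + B * dist (g u) (g v))"
      by (intro sum_mono) auto
    also have "\<dots> = B * (\<Sum>(u, v)\<in>D. dist (f u) (f v)) + B * (\<Sum>(u, v)\<in>D. dist (g u) (g v))"
      by (simp add: sum.distrib split_def sum_distrib_left)
    also have "\<dots> < B * (e / (2 * B)) + B * (e / (2 * B))"
      using B(1) D by (intro add_strict_mono mult_strict_left_mono d1 d2) auto
    also have "\<dots> = e" using B(1) by simp
    finally show "(\<Sum>(u, v)\<in>D. dist (f u * g u) (f v * g v)) < e" .
  qed (use d1 d2 in auto)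
qed

lemma abs_cont_on_diff:
  fixes f g :: "real \<Rightarrow> 'a::real_normed_vector"
  assumes "abs_cont_on I f" "abs_cont_on I g"
  shows "abs_cont_on I (\<lambda>x. f x - g x)"
proof (rule abs_cont_onI)
  fix e :: real
  assume "e > 0"
  then have e': "e / 2 > 0" by simp
  obtain d1 where d1: "0 < d1" "\<And>D. nonoverlapping I D \<Longrightarrow> (\<Sum>(u, v)\<in>D. v - u) < d1 \<Longrightarrow>
    (\<Sum>(u, v)\<in>D. dist (f u) (f v)) < e / 2"
    using abs_cont_onE[OF assms(1) e'] by blast
  obtain d2 where d2: "0 < d2" "\<And>D. nonoverlapping I D \<Longrightarrow> (\<Sum>(u, v)\<in>D. v - u) < d2 \<Longrightarrow>
    (\<Sum>(u, v)\<in>D. dist (g u) (g v)) < e / 2"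
    using abs_cont_onE[OF assms(2) e'] by blast
  show "\<exists>d>0. \<forall>D. nonoverlapping I D \<longrightarrow> (\<Sum>(u, v)\<in>D. v - u) < d \<longrightarrow>
    (\<Sum>(u, v)\<in>D. dist (f u - g u) (f v - g v)) < e"
  proof (intro exI[of _ "min d1 d2"] conjI allI impI)
    fix D :: "(real \<times> real) set"
    assume D: "nonoverlapping I D" "(\<Sum>(u, v)\<in>D. v - u) < min d1 d2"
    have "(\<Sum>(u, v)\<in>D. dist (f u - g u) (f v - g v)) \<le> (\<Sum>(u, v)\<in>D. dist (f u) (f v) + dist (g u) (g v))"
      by (intro sum_mono) (auto simp: dist_norm intro: order_trans[OF _ norm_triangle_ineq4] simp: algebra_simps)
    also have "\<dots> = (\<Sum>(u, v)\<in>D. dist (f u) (f v)) + (\<Sum>(u, v)\<in>D. dist (g u) (g v))"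
      by (simp add: sum.distrib split_def)
    also have "\<dots> < e / 2 + e / 2"
      using D by (intro add_strict_mono d1 d2) auto
    finally show "(\<Sum>(u, v)\<in>D. dist (f u - g u) (f v - g v)) < e" by simp
  qed (use d1 d2 in auto)
qed

text \<open>The excess of \<open>k\<close> over the height \<open>n\<close> tends to 0 in mean by
  dominated convergence. The split into a small and a bounded part gives both the absolute
  continuity of integrals and the weight in \<open>exponential_weight\<close>.\<close>

lemma absolutely_integrable_truncation:
  fixes k :: "'a::euclidean_space \<Rightarrow> real"
  assumes k: "k absolutely_integrable_on S" and S: "S \<in> lmeasurable" and "0 < e"
  obtains h n where "h absolutely_integrable_on S" "integral S h < e" "0 \<le> n"
    "\<And>x. 0 \<le> h x" "\<And>x. k x \<le> h x + n"
proof -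
  define h where "h = (\<lambda>n x. max (k x - real n) 0)"
  have c: "(\<lambda>x. c) absolutely_integrable_on S" for c :: real
    using S by (simp add: absolutely_integrable_on_const)
  have ah: "h n absolutely_integrable_on S" for n
    unfolding h_def by (intro absolutely_integrable_max_1 set_integral_diff k c)
  have "(\<lambda>n. integral S (h n)) \<longlonglongrightarrow> integral S (\<lambda>x. 0)"
  proof (rule dominated_convergence(2))
    show "h n integrable_on S" for n
      using ah set_lebesgue_integral_eq_integral(1) by blast
    show "(\<lambda>x. norm (k x)) integrable_on S"
      using k by (simp add: absolutely_integrable_on_def)
    show "norm (h n x) \<le> norm (k x)" for n x
      by (auto simp: h_def)
    show "(\<lambda>n. h n x) \<longlonglongrightarrow> 0" if "x \<in> S" for x
    proof (rule tendsto_eventually)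
      have "\<forall>\<^sub>F n in sequentially. k x \<le> real n"
        using filterlim_real_sequentially by (auto simp: filterlim_at_top)
      then show "\<forall>\<^sub>F n in sequentially. h n x = 0"
        by eventually_elim (auto simp: h_def)
    qed
  qed
  then have "\<forall>\<^sub>F n in sequentially. integral S (h n) < e"
    using \<open>0 < e\<close> by (intro order_tendstoD(2)) auto
  then obtain n where "integral S (h n) < e"
    by (auto simp: eventually_sequentially)
  with ah[of n] that[of "h n" "real n"] show thesis
    by (auto simp: h_def)
qed

lemma sum_integral_disjoint_le:
  fixes h :: "real \<Rightarrow> real"
  assumes "finite D" and disj: "disjoint_family_on (\<lambda>(a, b). {a<..<b}) D"
    and sub: "\<And>u v. (u, v) \<in> D \<Longrightarrow> {u..v} \<subseteq> {a..b}"
    and h: "h integrable_on {a..b}" and pos: "\<And>x. 0 \<le> h x"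
  shows "(\<Sum>(u, v)\<in>D. integral {u..v} h) \<le> integral {a..b} h"
proof -
  \<comment> \<open>Open intervals have the same integrals as closed ones but are pairwise disjoint,
    so at most one summand is nonzero at any point.\<close>
  let ?g = "\<lambda>d x. if x \<in> (\<lambda>(u, v). {u<..<v}) d then h x else 0"
  have I: "(?g d has_integral integral {fst d..snd d} h) {a..b}" if "d \<in> D" for d
  proof -
    obtain u v where d: "d = (u, v)" by force
    have "(h has_integral integral {u..v} h) {u..v}"
      using that sub[of u v] h by (simp add: d integrable_on_subinterval integrable_integral)
    then have "(h has_integral integral {u..v} h) {u<..<v}"
      by (simp add: has_integral_Icc_iff_Ioo)
    then have "((\<lambda>x. if x \<in> {u<..<v} then h x else 0) has_integral integral {u..v} h) {a..b}"
      using sub[of u v] that d by (subst has_integral_restrict) force+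
    then show ?thesis by (simp add: d)
  qed
  have "((\<lambda>x. \<Sum>d\<in>D. ?g d x) has_integral (\<Sum>d\<in>D. integral {fst d..snd d} h)) {a..b}"
    by (rule has_integral_sum[OF \<open>finite D\<close> I])
  moreover have "(\<Sum>d\<in>D. ?g d x) \<le> h x" for x
  proof (cases "\<exists>d\<in>D. x \<in> (\<lambda>(u, v). {u<..<v}) d")
    case True
    then obtain d where d: "d \<in> D" "x \<in> (\<lambda>(u, v). {u<..<v}) d" by blast
    have "(\<Sum>d\<in>D. ?g d x) = (\<Sum>d\<in>{d}. ?g d x)"
    proof (rule sum.mono_neutral_right[OF assms(1)])
      show "\<forall>i\<in>D - {d}. ?g i x = 0"
        using d disj unfolding disjoint_family_on_def by (intro ballI if_not_P) blast
    qed (use d in auto)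
    then show ?thesis using d(2) by simp
  next
    case False
    then have "(\<Sum>d\<in>D. ?g d x) = 0" by (intro sum.neutral ballI if_not_P) blast
    then show ?thesis using pos by simp
  qed
  ultimately have "(\<Sum>d\<in>D. integral {fst d..snd d} h) \<le> integral {a..b} h"
    by (rule has_integral_le[OF _ integrable_integral[OF h]])
  then show ?thesis by (simp add: split_def)
qed

section \<open>Indefinite integrals and their derivatives\<close>

text \<open>The integral form of \<open>F' = f\<close>. It makes sense for merely integrable
  \<open>f\<close>, is blind to null sets, and passes to subintervals at once because it speaks
  about all of them.\<close>

definition is_primitive :: "real \<Rightarrow> real \<Rightarrow> (real \<Rightarrow> 'a::banach) \<Rightarrow> (real \<Rightarrow> 'a) \<Rightarrow> bool" where
  "is_primitive a b F f \<longleftrightarrow> (\<forall>u v. a \<le> u \<longrightarrow> u \<le> v \<longrightarrow> v \<le> b \<longrightarrow> (f has_integral F v - F u) {u..v})"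

lemma is_primitiveD: "is_primitive a b F f \<Longrightarrow> a \<le> u \<Longrightarrow> u \<le> v \<Longrightarrow> v \<le> b \<Longrightarrow> (f has_integral F v - F u) {u..v}"
  by (simp add: is_primitive_def)

lemma is_primitive_abs_cont_on:
  fixes f :: "real \<Rightarrow> 'a::euclidean_space"
  assumes F: "is_primitive a b F f" and f: "f absolutely_integrable_on {a..b}"
  shows "abs_cont_on {a..b} F"
proof (rule abs_cont_onI)
  fix e :: real
  assume "e > 0"
  then have e': "e / 2 > 0" by simp
  have "(\<lambda>x. norm (f x)) absolutely_integrable_on {a..b}"
    using absolutely_integrable_norm[OF f] by (simp add: o_def)
  then obtain h n where h: "h absolutely_integrable_on {a..b}" "integral {a..b} h < e / 2" "0 \<le> n"
    "\<And>x. 0 \<le> h x" "\<And>x. norm (f x) \<le> h x + n"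
    by (rule absolutely_integrable_truncation[OF _ _ e']) auto
  have hi: "h integrable_on {a..b}"
    using h(1) set_lebesgue_integral_eq_integral(1) by blast
  show "\<exists>d>0. \<forall>D. nonoverlapping {a..b} D \<longrightarrow> (\<Sum>(u, v)\<in>D. v - u) < d \<longrightarrow>
    (\<Sum>(u, v)\<in>D. dist (F u) (F v)) < e"
  \<comment> \<open>The bounded part contributes at most \<open>n\<close> times the total length,
    hence at most \<open>e / 2\<close>; \<open>n + 1\<close> keeps the quotient defined for
    \<open>n = 0\<close>.\<close>
  proof (intro exI[of _ "e / (2 * (n + 1))"] conjI allI impI)
    show "0 < e / (2 * (n + 1))" using \<open>e > 0\<close> h(3) by simp
    fix D :: "(real \<times> real) set"
    assume D: "nonoverlapping {a..b} D" "(\<Sum>(u, v)\<in>D. v - u) < e / (2 * (n + 1))"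
    have "dist (F u) (F v) \<le> integral {u..v} h + n * (v - u)" if "(u, v) \<in> D" for u v
    proof -
      from nonoverlappingD[OF D(1)] that have uv: "u \<le> v" "{u..v} \<subseteq> {a..b}" by auto
      have 1: "(f has_integral F v - F u) {u..v}"
        using uv by (intro is_primitiveD[OF F]) auto
      have "h integrable_on {u..v}"
        using hi uv(2) by (rule integrable_on_subinterval)
      then have "((\<lambda>x. h x + n) has_integral (integral {u..v} h + (v - u) *\<^sub>R n)) {u..v}"
        using has_integral_const_real[of n u v] uv by (intro has_integral_add) (auto simp: integrable_integral)
      then have "norm (F v - F u) \<le> integral {u..v} h + (v - u) *\<^sub>R n"
        using 1 h(5) integral_norm_bound_integral[of f "{u..v}" "\<lambda>x. h x + n"]
        by (simp add: has_integral_integrable_integral)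
      then show ?thesis by (simp add: dist_norm norm_minus_commute mult.commute)
    qed
    then have "(\<Sum>(u, v)\<in>D. dist (F u) (F v)) \<le> (\<Sum>(u, v)\<in>D. integral {u..v} h + n * (v - u))"
      by (intro sum_mono) auto
    also have "\<dots> = (\<Sum>(u, v)\<in>D. integral {u..v} h) + n * (\<Sum>(u, v)\<in>D. v - u)"
      by (simp add: sum.distrib split_def sum_distrib_left)
    also have "(\<Sum>(u, v)\<in>D. integral {u..v} h) \<le> integral {a..b} h"
      using nonoverlappingD[OF D(1)] hi h(4) by (intro sum_integral_disjoint_le) auto
    also have "n * (\<Sum>(u, v)\<in>D. v - u) \<le> n * (e / (2 * (n + 1)))"
      using h(3) D by (intro mult_left_mono) auto
    also have "\<dots> \<le> e / 2" using h(3) \<open>e > 0\<close> by (simp add: field_simps)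
    finally show "(\<Sum>(u, v)\<in>D. dist (F u) (F v)) < e" using h(2) by simp
  qed
qed

text \<open>Each point of the set is an endpoint of arbitrarily short intervals whose Henstock error
  exceeds \<open>e\<close> times their length. Vitali's theorem picks countably many disjoint ones
  that cover almost all of the set; Henstock's lemma, with tolerance \<open>\<epsilon> * e\<close>,
  bounds the sum of the errors and so the total length by \<open>\<epsilon>\<close>.\<close>

lemma negligible_not_differentiable_primitive:
  fixes f :: "real \<Rightarrow> 'a::euclidean_space"
  assumes F: "is_primitive a b F f" and f: "f integrable_on {a..b}" and "0 < e"
  shows "negligible {x\<in>{a<..<b}. \<forall>d>0. \<exists>y\<in>{a..b}. y \<noteq> x \<and> \<bar>y - x\<bar> < d \<and>
           e * \<bar>y - x\<bar> < norm (F y - F x - (y - x) *\<^sub>R f x)}" (is "negligible ?E")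
  unfolding negligible_outer_le
proof (intro allI impI)
  fix \<epsilon> :: real
  assume "\<epsilon> > 0"
  with \<open>0 < e\<close> have "\<epsilon> * e > 0" by simp
  from Henstock_lemma[OF f[folded box_real] this] obtain \<gamma> where \<gamma>: "gauge \<gamma>"
    "\<And>p. p tagged_partial_division_of {a..b} \<Longrightarrow> \<gamma> fine p \<Longrightarrow>
       (\<Sum>(x,k)\<in>p. norm (measure lborel k *\<^sub>R f x - integral k f)) < \<epsilon> * e"
    unfolding box_real by blast
  define K where "K = {(x, y). x \<in> ?E \<and> y \<in> {a..b} \<and> y \<noteq> x \<and> {min x y..max x y} \<subseteq> \<gamma> x \<and>
     e * \<bar>y - x\<bar> < norm (F y - F x - (y - x) *\<^sub>R f x)}"
  \<comment> \<open>Centre and radius present the interval between \<open>x\<close> and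
    \<open>y\<close> as a ball, the shape the covering theorem handles. As \<open>x\<close> lies in
    it, \<open>x\<close> can serve as its tag.\<close>
  define c :: "real \<times> real \<Rightarrow> real" where "c = (\<lambda>(x, y). (x + y) / 2)"
  define r :: "real \<times> real \<Rightarrow> real" where "r = (\<lambda>(x, y). \<bar>y - x\<bar> / 2)"
  have cb: "cball (c (x, y)) (r (x, y)) = {min x y..max x y}" for x y
    by (auto simp: c_def r_def cball_eq_atLeastAtMost abs_if min_def max_def field_simps)
  have "\<exists>i. i \<in> K \<and> x \<in> cball (c i) (r i) \<and> r i < d" if x: "x \<in> ?E" and "0 < d" for x d
  proof -
    obtain d' where d': "d' > 0" "ball x d' \<subseteq> \<gamma> x"
      using \<gamma>(1) by (meson gauge_def open_contains_ball)
    have "min d d' > 0" using d' \<open>0 < d\<close> by simp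
    with x obtain y where y: "y \<in> {a..b}" "y \<noteq> x" "\<bar>y - x\<bar> < min d d'"
        "e * \<bar>y - x\<bar> < norm (F y - F x - (y - x) *\<^sub>R f x)" by blast
    have "{min x y..max x y} \<subseteq> ball x d'"
      using y(3) by (auto simp: dist_real_def)
    then have "(x, y) \<in> K" using x y d' by (auto simp: K_def)
    moreover have "x \<in> cball (c (x, y)) (r (x, y))"
      unfolding cb by simp
    moreover have "r (x, y) < d"
      using y(3) \<open>0 < d\<close> by (simp add: r_def)
    ultimately show ?thesis by blast
  qed
  then obtain C where C: "countable C" "C \<subseteq> K"
     "pairwise (\<lambda>i j. disjnt (cball (c i) (r i)) (cball (c j) (r j))) C"
     "negligible (?E - (\<Union>i\<in>C. cball (c i) (r i)))"
    using Vitali_covering_theorem_cballs[of K r ?E c] by (force simp: K_def r_def)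
  let ?B = "\<lambda>i. cball (c i) (r i)"
  have bound: "measure lebesgue (\<Union>i\<in>I. ?B i) \<le> \<epsilon>" if I: "I \<subseteq> C" "finite I" for I
  proof -
    have inj: "inj_on (\<lambda>i. (fst i, ?B i)) I"
    proof (rule inj_onI, rule ccontr)
      fix i j assume ij: "i \<in> I" "j \<in> I" "(fst i, ?B i) = (fst j, ?B j)" "i \<noteq> j"
      then have "disjnt (?B i) (?B j)" using C(3) I unfolding pairwise_def by blast
      moreover have "?B i \<noteq> {}" by (cases i) (simp add: cb)
      ultimately show False using ij by (auto simp: disjnt_def)
    qed
    let ?p = "(\<lambda>i. (fst i, ?B i)) ` I"
    have IK: "fst i \<in> ?E \<and> fst i \<in> {a..b} \<and> snd i \<in> {a..b} \<and> ?B i = {min (fst i) (snd i)..max (fst i) (snd i)} \<and>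
       ?B i \<subseteq> \<gamma> (fst i) \<and> e * \<bar>snd i - fst i\<bar> < norm (F (snd i) - F (fst i) - (snd i - fst i) *\<^sub>R f (fst i))"
      if "i \<in> I" for i
    proof -
      obtain x y where i: "i = (x, y)" by force
      have "(x, y) \<in> K" using that I C(2) i by auto
      then show ?thesis by (simp add: i cb) (auto simp: K_def)
    qed
    have p: "?p tagged_partial_division_of {a..b}"
      unfolding tagged_partial_division_of_def
    proof (intro conjI allI impI)
      show "finite ?p" using I by simp
      fix x k assume "(x, k) \<in> ?p"
      then obtain i where i: "i \<in> I" "x = fst i" "k = ?B i" by auto
      show "x \<in> k" "k \<subseteq> {a..b}" "\<exists>a b. k = cbox a b"
        using IK[OF i(1)] i by (auto simp flip: box_real)
    next
      fix x1 K1 x2 K2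
      assume "(x1, K1) \<in> ?p \<and> (x2, K2) \<in> ?p \<and> (x1, K1) \<noteq> (x2, K2)"
      then obtain i j where "i \<in> I" "j \<in> I" "i \<noteq> j" "K1 = ?B i" "K2 = ?B j" by auto
      then have "disjnt K1 K2" using C(3) I unfolding pairwise_def by blast
      then show "interior K1 \<inter> interior K2 = {}"
        using interior_subset by (force simp: disjnt_def)
    qed
    have "\<gamma> fine ?p" using IK by (auto simp: fine_def)
    have "measure lebesgue (\<Union>i\<in>I. ?B i) \<le> (\<Sum>i\<in>I. measure lebesgue (?B i))"
      using I by (intro measure_UNION_le) auto
    also have "\<dots> \<le> (\<Sum>i\<in>I. norm (measure lborel (?B i) *\<^sub>R f (fst i) - integral (?B i) f) / e)"
    proof (rule sum_mono)
      fix i assume i: "i \<in> I"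
      obtain x y where xy: "i = (x, y)" by force
      note IK = IK[OF i, unfolded xy fst_conv snd_conv cb]
      have "(f has_integral F (max x y) - F (min x y)) {min x y..max x y}"
        using IK by (intro is_primitiveD[OF F]) auto
      then have "integral (?B i) f = F (max x y) - F (min x y)"
        by (simp add: xy cb integral_unique)
      then have "norm (measure lborel (?B i) *\<^sub>R f (fst i) - integral (?B i) f) =
         norm (F y - F x - (y - x) *\<^sub>R f x)"
      proof (cases "x \<le> y")
        case True
        then have "measure lborel (?B i) *\<^sub>R f (fst i) - integral (?B i) f = (y - x) *\<^sub>R f x - (F y - F x)"
          using \<open>integral (?B i) f = _\<close> by (simp only: xy cb) simp
        then show ?thesis by (simp only: norm_minus_commute)
      next
        case False
        then have "measure lborel (?B i) *\<^sub>R f (fst i) - integral (?B i) f = (x - y) *\<^sub>R f x - (F x - F y)"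
          using \<open>integral (?B i) f = _\<close> by (simp only: xy cb) simp
        also have "\<dots> = F y - F x - (y - x) *\<^sub>R f x" by (simp add: algebra_simps)
        finally show ?thesis by simp
      qed
      moreover have "measure lebesgue (?B i) = \<bar>y - x\<bar>"
        by (simp add: xy cb abs_if min_def max_def)
      ultimately show "measure lebesgue (?B i) \<le> norm (measure lborel (?B i) *\<^sub>R f (fst i) - integral (?B i) f) / e"
        using IK \<open>0 < e\<close> by (simp add: field_simps)
    qed
    also have "\<dots> = (\<Sum>(x,k)\<in>?p. norm (measure lborel k *\<^sub>R f x - integral k f)) / e"
      by (simp add: sum.reindex[OF inj] sum_divide_distrib)
    also have "\<dots> \<le> \<epsilon>"
      using \<gamma>(2)[OF p \<open>\<gamma> fine ?p\<close>] \<open>0 < e\<close> by (simp add: field_simps)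
    finally show ?thesis .
  qed
  let ?T = "\<Union>i\<in>C. ?B i"
  have T: "?T \<in> lmeasurable" "measure lebesgue ?T \<le> \<epsilon>"
    by (rule fmeasurable_UN_bound[OF C(1) _ bound] measure_UN_bound[OF C(1) _ bound]; simp)+
  have ET: "?E - ?T \<in> null_sets lebesgue"
    using C(4) by (simp add: negligible_iff_null_sets)
  show "\<exists>T. ?E \<subseteq> T \<and> T \<in> lmeasurable \<and> measure lebesgue T \<le> \<epsilon>"
  proof (intro exI[of _ "?T \<union> (?E - ?T)"] conjI)
    show "?T \<union> (?E - ?T) \<in> lmeasurable"
      using T ET by (intro fmeasurable.Un) (auto intro: negligible_imp_measurable simp: negligible_iff_null_sets)
    show "measure lebesgue (?T \<union> (?E - ?T)) \<le> \<epsilon>"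
      using T ET measure_Un_null_set[of ?T lebesgue "?E - ?T"] by (simp add: fmeasurableD)
  qed blast
qed

text \<open>Lebesgue's differentiation theorem on the line: where the derivative fails to be
  \<open>f x\<close>, the difference quotient misses \<open>f x\<close> by more than some
  \<open>1 / (n + 1)\<close> at arbitrarily small scales, so the exceptional set is a countable
  union of null sets.\<close>

theorem is_primitive_has_vector_derivative:
  fixes f :: "real \<Rightarrow> 'a::euclidean_space"
  assumes F: "is_primitive a b F f" and f: "f integrable_on {a..b}"
  obtains N where "negligible N" "\<And>x. x \<in> {a<..<b} - N \<Longrightarrow> (F has_vector_derivative f x) (at x)"
proof
  let ?E = "\<lambda>e. {x\<in>{a<..<b}. \<forall>d>0. \<exists>y\<in>{a..b}. y \<noteq> x \<and> \<bar>y - x\<bar> < d \<and>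
           e * \<bar>y - x\<bar> < norm (F y - F x - (y - x) *\<^sub>R f x)}"
  let ?N = "\<Union>n. ?E (1 / real (Suc n))"
  show "negligible ?N"
    by (intro negligible_Union_nat negligible_not_differentiable_primitive[OF F f]) simp
  show "(F has_vector_derivative f x) (at x)" if x: "x \<in> {a<..<b} - ?N" for x
    unfolding has_vector_derivative_def has_derivative_at_alt
  proof (intro conjI allI impI)
    fix e :: real
    assume "0 < e"
    then obtain n where n: "1 / real (Suc n) < e"
      using nat_approx_posE by blast
    from x have "x \<notin> ?E (1 / real (Suc n))" by blast
    then obtain d where d: "d > 0" "\<And>y. y \<in> {a..b} \<Longrightarrow> y \<noteq> x \<Longrightarrow> \<bar>y - x\<bar> < d \<Longrightarrow>
        norm (F y - F x - (y - x) *\<^sub>R f x) \<le> 1 / real (Suc n) * \<bar>y - x\<bar>"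
    proof -
      have "\<not> (\<forall>d>0. \<exists>y\<in>{a..b}. y \<noteq> x \<and> \<bar>y - x\<bar> < d \<and>
           1 / real (Suc n) * \<bar>y - x\<bar> < norm (F y - F x - (y - x) *\<^sub>R f x))"
        using \<open>x \<notin> ?E (1 / real (Suc n))\<close> x by blast
      with that show thesis by (meson not_less)
    qed
    show "\<exists>d>0. \<forall>y. norm (y - x) < d \<longrightarrow> norm (F y - F x - (y - x) *\<^sub>R f x) \<le> e * norm (y - x)"
    proof (intro exI[of _ "min d (min (x - a) (b - x))"] conjI allI impI)
      show "0 < min d (min (x - a) (b - x))" using x d by auto
      fix y assume y: "norm (y - x) < min d (min (x - a) (b - x))"
      show "norm (F y - F x - (y - x) *\<^sub>R f x) \<le> e * norm (y - x)"
      proof (cases "y = x")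
        case False
        then have "norm (F y - F x - (y - x) *\<^sub>R f x) \<le> 1 / real (Suc n) * \<bar>y - x\<bar>"
          using y by (intro d) (auto simp: abs_if split: if_splits)
        also have "\<dots> \<le> e * \<bar>y - x\<bar>"
          using n by (intro mult_right_mono) auto
        finally show ?thesis by simp
      qed simp
    qed
  qed (rule bounded_linear_scaleR_left)
qed

lemma is_primitive_continuous_on:
  assumes "is_primitive a b F f"
  shows "continuous_on {a..b} F"
proof (cases "a \<le> b")
  case True
  then have "f integrable_on {a..b}"
    using is_primitiveD[OF assms, of a b] by (auto simp: has_integral_integrable)
  then have "continuous_on {a..b} (\<lambda>x. F a + integral {a..x} f)"
    by (intro continuous_intros indefinite_integral_continuous_1)
  moreover have "F a + integral {a..x} f = F x" if "x \<in> {a..b}" for x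
    using is_primitiveD[OF assms, of a x] that by (simp add: integral_unique)
  ultimately show ?thesis by (rule continuous_on_eq)
qed auto

lemma is_primitive_subinterval:
  "is_primitive a b F f \<Longrightarrow> a \<le> c \<Longrightarrow> d \<le> b \<Longrightarrow> is_primitive c d F f"
  by (auto simp: is_primitive_def)

lemma is_primitiveI_right:
  assumes "\<And>x. x \<in> {a..b} \<Longrightarrow> (f has_integral F b - F x) {x..b}"
  shows "is_primitive a b F f"
  unfolding is_primitive_def
proof (intro allI impI)
  fix u v assume uv: "a \<le> u" "u \<le> v" "v \<le> b"
  have 1: "(f has_integral F b - F u) {u..b}" "(f has_integral F b - F v) {v..b}"
    using uv by (auto intro: assms)
  have "f integrable_on {u..v}"
    using 1(1) uv by (auto intro: integrable_on_subinterval[OF has_integral_integrable])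
  then obtain I where I: "(f has_integral I) {u..v}" by blast
  from has_integral_combine[OF uv(2,3) I 1(2)] 1(1) have "I + (F b - F v) = F b - F u"
    by (rule has_integral_unique)
  then have "I = F v - F u" by (simp add: algebra_simps)
  with I show "(f has_integral F v - F u) {u..v}" by simp
qed

lemma is_primitiveI_left:
  assumes "\<And>x. x \<in> {a..b} \<Longrightarrow> (f has_integral F x - F a) {a..x}"
  shows "is_primitive a b F f"
  unfolding is_primitive_def
proof (intro allI impI)
  fix u v assume uv: "a \<le> u" "u \<le> v" "v \<le> b"
  have 1: "(f has_integral F v - F a) {a..v}" "(f has_integral F u - F a) {a..u}"
    using uv by (auto intro: assms)
  have "f integrable_on {u..v}"
    using 1(1) uv by (auto intro: integrable_on_subinterval[OF has_integral_integrable])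
  then obtain I where I: "(f has_integral I) {u..v}" by blast
  from has_integral_combine[OF uv(1,2) 1(2) I] 1(1) have "F u - F a + I = F v - F a"
    by (rule has_integral_unique)
  then have "I = F v - F u" by (simp add: algebra_simps)
  with I show "(f has_integral F v - F u) {u..v}" by simp
qed

lemma is_primitive_scale:
  fixes c :: "'a::{banach,real_normed_algebra}"
  assumes "is_primitive a b F f"
  shows "is_primitive a b (\<lambda>x. c * F x) (\<lambda>x. c * f x)"
  using is_primitiveD[OF assms] unfolding is_primitive_def
  by (auto simp flip: right_diff_distrib intro: has_integral_mult_right)

lemma is_primitive_add:
  assumes "is_primitive a b F f" "is_primitive a b G g"
  shows "is_primitive a b (\<lambda>x. F x + G x) (\<lambda>x. f x + g x)"
  using is_primitiveD[OF assms(1)] is_primitiveD[OF assms(2)] unfolding is_primitive_def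
  by (auto simp: add_diff_add intro: has_integral_add)

lemma is_primitive_diff:
  assumes "is_primitive a b F f" "is_primitive a b G g"
  shows "is_primitive a b (\<lambda>x. F x - G x) (\<lambda>x. f x - g x)"
proof -
  have eq: "F v - G v - (F u - G u) = (F v - F u) - (G v - G u)" for u v by simp
  show ?thesis
    using is_primitiveD[OF assms(1)] is_primitiveD[OF assms(2)] unfolding is_primitive_def eq
    by (auto intro: has_integral_diff)
qed

lemma is_primitive_cnj:
  assumes "is_primitive a b F f"
  shows "is_primitive a b (\<lambda>x. cnj (F x)) (\<lambda>x. cnj (f x))"
  using is_primitiveD[OF assms] has_integral_linear[OF _ bounded_linear_cnj]
  unfolding is_primitive_def o_def by (metis complex_cnj_diff)

lemma is_primitiveI_derivative:
  fixes f :: "real \<Rightarrow> 'a::banach"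
  assumes "\<And>x. x \<in> {a..b} \<Longrightarrow> (F has_vector_derivative f x) (at x within {a..b})"
  shows "is_primitive a b F f"
  unfolding is_primitive_def
proof (intro allI impI)
  fix u v assume uv: "a \<le> u" "u \<le> v" "v \<le> b"
  show "(f has_integral F v - F u) {u..v}"
    using uv by (intro fundamental_theorem_of_calculus has_vector_derivative_within_subset[OF assms]) auto
qed

lemma is_primitive_has_vector_derivative_if_continuous:
  fixes f :: "real \<Rightarrow> 'a::banach"
  assumes F: "is_primitive a b F f" and f: "continuous_on {a..b} f" and x: "x \<in> {a..b}"
  shows "(F has_vector_derivative f x) (at x within {a..b})"
proof -
  have "((\<lambda>u. F a + integral {a..u} f) has_vector_derivative 0 + f x) (at x within {a..b})"
    by (intro has_vector_derivative_add integral_has_vector_derivative[OF f x] has_vector_derivative_const)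
  then have *: "((\<lambda>u. F a + integral {a..u} f) has_vector_derivative f x) (at x within {a..b})"
    by simp
  show ?thesis
  proof (rule has_vector_derivative_transform[OF x _ *])
    show "F u = F a + integral {a..u} f" if "u \<in> {a..b}" for u
      using is_primitiveD[OF F, of a u] that by (simp add: integral_unique)
  qed
qed

text \<open>The integrand is the derivative of the Wronskian \<open>p * Y - y * P\<close>, the
  products \<open>p * P\<close> cancelling. Since \<open>p\<close> and \<open>P\<close> have
  derivatives only almost everywhere, the fundamental theorem for absolutely continuous functions is
  required.\<close>

lemma Lagrange_identity:
  fixes y p r Y P R :: "real \<Rightarrow> complex"
  assumes "a \<le> b" and y: "is_primitive a b y p" and p: "is_primitive a b p r"
    and Y: "is_primitive a b Y P" and P: "is_primitive a b P R"
    and r: "r absolutely_integrable_on {a..b}" and R: "R absolutely_integrable_on {a..b}"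
  shows "((\<lambda>x. r x * Y x - y x * R x) has_integral
           (p b * Y b - y b * P b) - (p a * Y a - y a * P a)) {a..b}"
proof -
  have ri: "r integrable_on {a..b}" and Ri: "R integrable_on {a..b}"
    using r R set_lebesgue_integral_eq_integral(1) by blast+
  obtain N1 where N1: "negligible N1" "\<And>x. x \<in> {a<..<b} - N1 \<Longrightarrow> (p has_vector_derivative r x) (at x)"
    using is_primitive_has_vector_derivative[OF p ri] by blast
  obtain N2 where N2: "negligible N2" "\<And>x. x \<in> {a<..<b} - N2 \<Longrightarrow> (P has_vector_derivative R x) (at x)"
    using is_primitive_has_vector_derivative[OF P Ri] by blast
  have c: "continuous_on {a..b} p" "continuous_on {a..b} P" "continuous_on {a..b} y" "continuous_on {a..b} Y"
    using y p Y P by (auto intro: is_primitive_continuous_on)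
  then have bd: "bounded (p ` {a..b})" "bounded (P ` {a..b})" "bounded (y ` {a..b})" "bounded (Y ` {a..b})"
    by (auto intro: compact_imp_bounded compact_continuous_image)
  have "abs_cont_on {a..b} (\<lambda>x. p x * Y x - y x * P x)"
    using c bd assms
    by (intro abs_cont_on_diff abs_cont_on_mult) 
      (auto intro: is_primitive_abs_cont_on absolutely_integrable_continuous_real)
  note ac = this
  have "((\<lambda>x. p x * Y x - y x * P x) has_vector_derivative (r x * Y x - y x * R x)) (at x within {a..b})"
    if x: "x \<in> {a..b} - (N1 \<union> N2 \<union> {a, b})" for x
  proof -
    have "(p has_vector_derivative r x) (at x within {a..b})" "(P has_vector_derivative R x) (at x within {a..b})"
      using x by (auto intro!: has_vector_derivative_at_within N1 N2)
    moreover have "(y has_vector_derivative p x) (at x within {a..b})" "(Y has_vector_derivative P x) (at x within {a..b})"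
      using x c y Y by (auto intro: is_primitive_has_vector_derivative_if_continuous)
    ultimately have "((\<lambda>x. p x * Y x - y x * P x) has_vector_derivative
        (p x * P x + r x * Y x) - (y x * R x + p x * P x)) (at x within {a..b})"
      by (intro has_vector_derivative_diff has_vector_derivative_mult)
    then show ?thesis by simp
  qed
  moreover have "negligible (N1 \<union> N2 \<union> {a, b})"
    using N1 N2 by (intro negligible_Un) auto
  ultimately show ?thesis
    by (intro fundamental_theorem_of_calculus_abs_cont[OF \<open>a \<le> b\<close> ac])
qed

section \<open>Linear systems with integrable coefficients\<close>

lemma absolutely_integrable_continuous_mult:
  fixes f g :: "real \<Rightarrow> 'a::{euclidean_space,real_normed_algebra}"
  assumes "continuous_on {a..b} g" "f absolutely_integrable_on {a..b}"
  shows "(\<lambda>x. g x * f x) absolutely_integrable_on {a..b}"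
proof (rule absolutely_integrable_bounded_measurable_product[of "(*)" g "{a..b}" f])
  show "bilinear ((*) :: 'a \<Rightarrow> 'a \<Rightarrow> 'a)"
    by (simp add: bilinear_conv_bounded_bilinear bounded_bilinear_mult)
  show "g \<in> borel_measurable (lebesgue_on {a..b})"
    using assms(1) by (intro continuous_imp_measurable_on_sets_lebesgue) auto
  show "bounded (g ` {a..b})"
    using assms(1) by (intro compact_imp_bounded compact_continuous_image) auto
qed (use assms in auto)

text \<open>Bielecki's weight: relative to it, integrating against a nonnegative
  \<open>\<kappa>\<close> from \<open>x\<close> to \<open>b\<close> has norm at most 1/2. An
  unbounded \<open>\<kappa>\<close> is split into a part of mass below 1/4, for which it is enough
  that the weight decreases, and a part bounded by \<open>n\<close>, for which \<open>n / L\<close>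
  is at most 1/4.\<close>

lemma exponential_weight:
  fixes \<kappa> :: "real \<Rightarrow> real"
  assumes "\<kappa> absolutely_integrable_on {a..b}"
  obtains L where "\<And>x. x \<in> {a..b} \<Longrightarrow>
    integral {x..b} (\<lambda>t. \<kappa> t * exp (L * (b - t))) \<le> exp (L * (b - x)) / 2"
proof -
  obtain h n where h: "h absolutely_integrable_on {a..b}" "integral {a..b} h < 1/4" "0 \<le> n"
    "\<And>x. 0 \<le> h x" "\<And>x. \<kappa> x \<le> h x + n"
    using absolutely_integrable_truncation[OF assms, of "1/4"] by auto
  \<comment> \<open>The summand 1 keeps \<open>L\<close> positive when \<open>n = 0\<close>.\<close>
  define L where "L = 4 * n + 1"
  have "L > 0" using h(3) by (simp add: L_def)
  have hi: "h integrable_on {a..b}"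
    using h(1) set_lebesgue_integral_eq_integral(1) by blast
  show thesis
  proof (rule that[of L])
    fix x assume x: "x \<in> {a..b}"
    let ?e = "\<lambda>t. exp (L * (b - t))"
    have sub: "f absolutely_integrable_on {x..b}" if "f absolutely_integrable_on {a..b}" for f :: "real \<Rightarrow> real"
      by (rule absolutely_integrable_on_subinterval[OF that]) (use x in auto)
    have i: "(\<lambda>t. ?e t * f t) integrable_on {x..b}" if "f absolutely_integrable_on {a..b}" for f :: "real \<Rightarrow> real"
      using sub[OF that]
      by (intro set_lebesgue_integral_eq_integral(1) absolutely_integrable_continuous_mult continuous_intros)
    have ih: "h integrable_on {x..b}"
      using hi by (rule integrable_on_subinterval) (use x in auto)
    have e: "(?e has_integral ?e x / L - 1 / L) {x..b}"
    proof -
      have "(?e has_integral - ?e b / L - (- ?e x / L)) {x..b}"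
        using x \<open>L > 0\<close>
        by (intro fundamental_theorem_of_calculus)
          (auto intro!: derivative_eq_intros simp flip: has_real_derivative_iff_has_vector_derivative)
      then show ?thesis by simp
    qed
    have "((\<lambda>t. ?e x * h t + n * ?e t) has_integral ?e x * integral {x..b} h + n * (?e x / L - 1 / L)) {x..b}"
      by (intro has_integral_add has_integral_mult_right e integrable_integral ih)
    moreover have "\<kappa> t * ?e t \<le> ?e x * h t + n * ?e t" if "t \<in> {x..b}" for t
    proof -
      have "\<kappa> t * ?e t \<le> (h t + n) * ?e t" using h(5) by (intro mult_right_mono) auto
      moreover have "?e t * h t \<le> ?e x * h t" using that \<open>L > 0\<close> h(4) by (intro mult_right_mono) auto
      ultimately show ?thesis by (simp add: algebra_simps)
    qed
    moreover have "((\<lambda>t. \<kappa> t * ?e t) has_integral integral {x..b} (\<lambda>t. \<kappa> t * ?e t)) {x..b}"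
      using i[OF assms] by (simp add: mult.commute integrable_integral)
    ultimately have "integral {x..b} (\<lambda>t. \<kappa> t * ?e t) \<le> ?e x * integral {x..b} h + n * (?e x / L - 1 / L)"
      by (rule has_integral_le[rotated]) 
    also have "integral {x..b} h \<le> integral {a..b} h"
      using x hi ih h(4) by (intro integral_subset_le) auto
    also have "\<dots> \<le> 1/4" using h(2) by simp
    also have "n * (?e x / L - 1 / L) \<le> n * (?e x / L)"
      using h(3) \<open>L > 0\<close> by (intro mult_left_mono) auto
    also have "\<dots> = (n / L) * ?e x" by simp
    also have "n / L \<le> 1/4" using h(3) \<open>L > 0\<close> by (simp add: L_def field_simps)
    finally show "integral {x..b} (\<lambda>t. \<kappa> t * ?e t) \<le> ?e x / 2" by simp
  qed
qed

text \<open>Where \<open>E\<close> divided by the exponential weight attains a positive maximum, the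
  integral term accounts for at most half of it, and the other half is bounded through
  \<open>A\<close>. The constant depends only on \<open>\<kappa>\<close> and the interval, which
  makes later estimates uniform over families of solutions.\<close>

lemma Gronwall_L1:
  fixes \<kappa> :: "real \<Rightarrow> real"
  assumes \<kappa>: "\<kappa> absolutely_integrable_on {a..b}" and pos: "\<And>t. 0 \<le> \<kappa> t"
  obtains C where "0 \<le> C" and "\<And>E A x. continuous_on {a..b} E \<Longrightarrow> 0 \<le> A \<Longrightarrow>
    (\<And>x. x \<in> {a..b} \<Longrightarrow> E x \<le> A + integral {x..b} (\<lambda>t. \<kappa> t * E t)) \<Longrightarrow> x \<in> {a..b} \<Longrightarrow> E x \<le> C * A"
proof -
  obtain L' where L': "\<And>x. x \<in> {a..b} \<Longrightarrow>
    integral {x..b} (\<lambda>t. \<kappa> t * exp (L' * (b - t))) \<le> exp (L' * (b - x)) / 2"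
    using exponential_weight[OF \<kappa>] by blast
  define L where "L = L'"
  note L = L'[folded L_def]
  let ?e = "\<lambda>t. exp (L * (b - t))"
  show thesis
  \<comment> \<open>The 2 comes from the absorption; one exponential bounds the weight on the
    interval, the other its reciprocal.\<close>
  proof (rule that[of "2 * exp (\<bar>L\<bar> * \<bar>b - a\<bar>) * exp (\<bar>L\<bar> * \<bar>b - a\<bar>)"])
    fix E :: "real \<Rightarrow> real" and A x
    assume E: "continuous_on {a..b} E" and "0 \<le> A" and
      le: "\<And>x. x \<in> {a..b} \<Longrightarrow> E x \<le> A + integral {x..b} (\<lambda>t. \<kappa> t * E t)" and x: "x \<in> {a..b}"
    let ?B = "exp (\<bar>L\<bar> * \<bar>b - a\<bar>)"
    have eB: "?e t \<le> ?B" "1 / ?e t \<le> ?B" if "t \<in> {a..b}" for t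
    proof -
      have "\<bar>L * (b - t)\<bar> \<le> \<bar>L\<bar> * \<bar>b - a\<bar>"
        using that by (simp add: abs_mult mult_left_mono)
      then show "?e t \<le> ?B" by simp
      have "1 / ?e t = exp (- (L * (b - t)))" by (metis exp_minus inverse_eq_divide)
      also have "\<dots> \<le> ?B" using \<open>\<bar>L * (b - t)\<bar> \<le> \<bar>L\<bar> * \<bar>b - a\<bar>\<close> by simp
      finally show "1 / ?e t \<le> ?B" .
    qed
    have "continuous_on {a..b} (\<lambda>x. E x / ?e x)"
      using E by (intro continuous_intros) auto
    then obtain x0 where x0: "x0 \<in> {a..b}" "\<And>t. t \<in> {a..b} \<Longrightarrow> E t / ?e t \<le> E x0 / ?e x0"
      using continuous_attains_sup[of "{a..b}" "\<lambda>x. E x / ?e x"] x by fastforce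
    define m where "m = E x0 / ?e x0"
    have m: "E t \<le> m * ?e t" if "t \<in> {a..b}" for t
      using x0(2)[OF that] by (simp add: m_def divide_le_eq)
    have "m \<le> 2 * A * ?B"
    proof (cases "m \<le> 0")
      case True
      then show ?thesis using \<open>0 \<le> A\<close> by (meson exp_ge_zero mult_nonneg_nonneg order_trans zero_le_numeral)
    next
      case False
      have i: "(\<lambda>t. g t * \<kappa> t) integrable_on {x0..b}" if "continuous_on {a..b} g" for g :: "real \<Rightarrow> real"
      proof -
        have "(\<lambda>t. g t * \<kappa> t) absolutely_integrable_on {a..b}"
          by (rule absolutely_integrable_continuous_mult[OF that \<kappa>])
        then have "(\<lambda>t. g t * \<kappa> t) integrable_on {a..b}"
          using set_lebesgue_integral_eq_integral(1) by blast
        then show ?thesis by (rule integrable_on_subinterval) (use x0 in auto)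
      qed
      have "integral {x0..b} (\<lambda>t. \<kappa> t * E t) \<le> integral {x0..b} (\<lambda>t. m * (\<kappa> t * ?e t))"
      proof (rule integral_le)
        show "(\<lambda>t. \<kappa> t * E t) integrable_on {x0..b}"
          using i[OF E] by (simp add: mult.commute)
        have "(\<lambda>t. \<kappa> t * ?e t) integrable_on {x0..b}"
          using i[of ?e] by (simp add: mult.commute continuous_intros)
        then show "(\<lambda>t. m * (\<kappa> t * ?e t)) integrable_on {x0..b}"
          by (rule integrable_on_mult_right)
        show "\<kappa> t * E t \<le> m * (\<kappa> t * ?e t)" if "t \<in> {x0..b}" for t
          using mult_left_mono[OF m[of t] pos[of t]] that x0 by (simp add: mult_ac)
      qed
      also have "\<dots> = m * integral {x0..b} (\<lambda>t. \<kappa> t * ?e t)" by simp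
      also have "\<dots> \<le> m * (?e x0 / 2)"
        using False L[OF x0(1)] by (intro mult_left_mono) auto
      finally have "E x0 \<le> A + m * (?e x0 / 2)" using le[OF x0(1)] by simp
      moreover have "E x0 = m * ?e x0" by (simp add: m_def)
      ultimately have "m * ?e x0 \<le> 2 * A" by simp
      then have "m \<le> 2 * A * (1 / ?e x0)" by (simp add: field_simps)
      also have "\<dots> \<le> 2 * A * ?B"
        using eB(2)[OF x0(1)] \<open>0 \<le> A\<close> by (intro mult_left_mono) auto
      finally show ?thesis .
    qed
    have "E x \<le> m * ?e x" by (rule m[OF x])
    also have "\<dots> \<le> (2 * A * ?B) * ?e x"
      using \<open>m \<le> 2 * A * ?B\<close> by (intro mult_right_mono) auto
    also have "\<dots> \<le> (2 * A * ?B) * ?B"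
      using eB(1)[OF x] \<open>0 \<le> A\<close> by (intro mult_left_mono) auto
    finally show "E x \<le> 2 * ?B * ?B * A" by (simp add: mult_ac)
  qed simp
qed

lemma has_integral_Pair:
  assumes "(f has_integral i) S" "(g has_integral j) S"
  shows "((\<lambda>x. (f x, g x)) has_integral (i, j)) S"
proof -
  have "((\<lambda>x. (f x, 0)) has_integral (i, 0)) S" "((\<lambda>x. (0, g x)) has_integral (0, j)) S"
    using has_integral_linear[OF assms(1) bounded_linear_Pair[OF bounded_linear_ident bounded_linear_zero]]
      has_integral_linear[OF assms(2) bounded_linear_Pair[OF bounded_linear_zero bounded_linear_ident]]
    by (simp_all add: o_def)
  from has_integral_add[OF this] show ?thesis by simp
qed

lemma integrable_Pair:
  assumes "f integrable_on S" "g integrable_on S"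
  shows "(\<lambda>x. (f x, g x)) integrable_on S"
  by (rule has_integral_integrable[OF has_integral_Pair[OF assms[THEN integrable_integral]]])

text \<open>Banach's fixed point theorem for the integral equation solved backwards from
  \<open>b\<close>. In the weighted norm the operator contracts on the whole interval at once, so no
  local solutions have to be glued.\<close>

lemma linear_system_exists:
  fixes c :: "real \<Rightarrow> complex"
  assumes "a \<le> b" and c: "c absolutely_integrable_on {a..b}"
  obtains y p where "is_primitive a b y p" "is_primitive a b p (\<lambda>x. c x * y x)" "y b = y1" "p b = p1"
proof -
  have "(\<lambda>t. 1 + norm (c t)) absolutely_integrable_on {a..b}"
    using absolutely_integrable_norm[OF c]
    by (intro set_integral_add) (auto simp: o_def absolutely_integrable_on_const)
  then obtain L where L: "\<And>x. x \<in> {a..b} \<Longrightarrow>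
    integral {x..b} (\<lambda>t. (1 + norm (c t)) * exp (L * (b - t))) \<le> exp (L * (b - x)) / 2"
    and ki: "(\<lambda>t. 1 + norm (c t)) absolutely_integrable_on {a..b}"
    using exponential_weight by blast
  define e where "e t = exp (L * (b - t))" for t
  have epos: "e t > 0" for t by (simp add: e_def)
  have e0: "e t \<noteq> 0" for t by (simp add: e_def)
  have ec: "continuous_on A e" for A
    unfolding e_def by (intro continuous_intros)
  \<comment> \<open>Clamping to \<open>[a,b]\<close>: bounded continuous functions live on the whole
    line, so the operator continues its values by constants.\<close>
  define pr where "pr x = max a (min b x)" for x
  have pr: "pr x \<in> {a..b}" for x using \<open>a \<le> b\<close> by (simp add: pr_def)
  have prc: "continuous_on A pr" for A
    unfolding pr_def by (intro continuous_intros)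
  have prx: "pr x = x" if "x \<in> {a..b}" for x using that by (simp add: pr_def)
  \<comment> \<open>The unknown is \<open>u = Y / e\<close> with \<open>Y\<close> the vector of
    \<open>y\<close> and \<open>p\<close>, so that the plain supremum norm of \<open>u\<close> is
    the weighted norm of \<open>Y\<close>. In these terms \<open>G u\<close> is the right-hand side
    of the system for \<open>Y\<close>.\<close>
  define G where "G u t = (e t *\<^sub>R snd (u t), e t *\<^sub>R fst (u t) * c t)" for u :: "real \<Rightarrow> complex \<times> complex" and t
  have Gi: "G u integrable_on {a..b}" if u: "continuous_on {a..b} u" for u
  proof -
    have "(\<lambda>t. e t *\<^sub>R snd (u t)) integrable_on {a..b}"
      by (intro integrable_continuous_real continuous_intros ec u)
    moreover have "(\<lambda>t. e t *\<^sub>R fst (u t) * c t) absolutely_integrable_on {a..b}"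
      by (intro absolutely_integrable_continuous_mult c continuous_intros ec u)
    then have "(\<lambda>t. e t *\<^sub>R fst (u t) * c t) integrable_on {a..b}"
      using set_lebesgue_integral_eq_integral(1) by blast
    ultimately show ?thesis
      unfolding G_def by (rule integrable_Pair)
  qed
  define T where "T u x = (1 / e (pr x)) *\<^sub>R ((y1, p1) - integral {pr x..b} (G u))" for u x
  have Tb: "T u \<in> bcontfun" if u: "continuous_on {a..b} u" for u
  proof -
    let ?g = "\<lambda>x. (1 / e x) *\<^sub>R ((y1, p1) - integral {x..b} (G u))"
    have g: "continuous_on {a..b} ?g"
      using e0 by (intro continuous_intros ec indefinite_integral_continuous_1' Gi u) auto
    have eq: "T u = ?g \<circ> pr" by (auto simp: T_def)
    have "continuous_on UNIV (T u)"
      unfolding eq using pr by (intro continuous_on_compose prc continuous_on_subset[OF g]) auto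
    moreover have "bounded (?g ` {a..b})"
      using g by (intro compact_imp_bounded compact_continuous_image) auto
    then have "bounded (range (T u))"
      by (rule bounded_subset) (use pr in \<open>auto simp: eq\<close>)
    ultimately show ?thesis by (simp add: bcontfun_def)
  qed
  define \<Phi> where "\<Phi> u = Bcontfun (T (apply_bcontfun u))" for u
  have \<Phi>: "apply_bcontfun (\<Phi> u) = T (apply_bcontfun u)" for u
    unfolding \<Phi>_def by (intro Bcontfun_inverse Tb) auto
  have "dist (\<Phi> u) (\<Phi> v) \<le> 1/2 * dist u v" for u v
  proof (rule dist_bound)
    fix x
    let ?u = "apply_bcontfun u" and ?v = "apply_bcontfun v"
    let ?k = "\<lambda>t. ((1 + norm (c t)) * e t) * dist u v"
    have sub: "f integrable_on {pr x..b}" if "f integrable_on {a..b}" for f :: "real \<Rightarrow> complex \<times> complex"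
      using that by (rule integrable_on_subinterval) (use pr in auto)
    have Giu: "G ?u integrable_on {pr x..b}" "G ?v integrable_on {pr x..b}"
      by (auto intro!: sub Gi)
    have kint: "(\<lambda>t. (1 + norm (c t)) * e t) integrable_on {pr x..b}"
    proof -
      have "(\<lambda>t. e t * (1 + norm (c t))) absolutely_integrable_on {a..b}"
        by (intro absolutely_integrable_continuous_mult ki ec)
      then have "(\<lambda>t. (1 + norm (c t)) * e t) integrable_on {a..b}"
        using set_lebesgue_integral_eq_integral(1) by (metis (no_types, lifting) ext mult.commute)
      then show ?thesis by (rule integrable_on_subinterval) (use pr in auto)
    qed
    have "norm (integral {pr x..b} (\<lambda>t. G ?u t - G ?v t)) \<le> integral {pr x..b} ?k"
    proof (rule integral_norm_bound_integral)
      show "(\<lambda>t. G ?u t - G ?v t) integrable_on {pr x..b}"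
        by (intro integrable_diff Giu)
      show "?k integrable_on {pr x..b}" by (rule integrable_on_mult_left[OF kint])
      fix t assume "t \<in> {pr x..b}"
      let ?d = "?u t - ?v t"
      have d: "norm (fst ?d) \<le> norm ?d" "norm (snd ?d) \<le> norm ?d"
        by (metis norm_fst_le prod.collapse) (metis norm_snd_le prod.collapse)
      have "G ?u t - G ?v t = e t *\<^sub>R (snd ?d, fst ?d * c t)"
        by (simp add: G_def algebra_simps)
      also have "norm \<dots> = e t * norm (snd ?d, fst ?d * c t)"
        using epos[of t] by (simp only: norm_scaleR abs_of_pos)
      also have "\<dots> \<le> e t * (norm (snd ?d) + norm (fst ?d) * norm (c t))"
        using epos[of t] by (intro mult_left_mono order_trans[OF norm_Pair_le]) (auto simp: norm_mult)
      also have "\<dots> \<le> e t * (norm ?d + norm ?d * norm (c t))"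
        using epos[of t] by (intro mult_left_mono add_mono mult_right_mono d) auto
      also have "\<dots> = ((1 + norm (c t)) * e t) * dist (?u t) (?v t)"
        by (simp add: dist_norm algebra_simps)
      also have "\<dots> \<le> ?k t"
        using epos[of t] by (intro mult_left_mono dist_bounded) auto
      finally show "norm (G ?u t - G ?v t) \<le> ?k t" .
    qed
    also have "\<dots> = integral {pr x..b} (\<lambda>t. (1 + norm (c t)) * e t) * dist u v"
      by (rule integral_mult_left)
    also have "\<dots> \<le> (e (pr x) / 2) * dist u v"
      using L[OF pr[of x]] by (intro mult_right_mono) (auto simp: e_def)
    finally have "norm (integral {pr x..b} (G ?u) - integral {pr x..b} (G ?v)) \<le> (e (pr x) / 2) * dist u v"
      by (simp add: integral_diff Giu)
    then have "(1 / e (pr x)) * norm (integral {pr x..b} (G ?u) - integral {pr x..b} (G ?v)) \<le>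
        (1 / e (pr x)) * ((e (pr x) / 2) * dist u v)"
      using epos[of "pr x"] by (intro mult_left_mono) auto
    moreover have "T ?u x - T ?v x = (1 / e (pr x)) *\<^sub>R (integral {pr x..b} (G ?v) - integral {pr x..b} (G ?u))"
      by (simp add: T_def flip: scaleR_diff_right)
    ultimately show "dist (\<Phi> u x) (\<Phi> v x) \<le> 1/2 * dist u v"
      using epos[of "pr x"] by (simp add: \<Phi> dist_norm norm_minus_commute)
  qed
  then obtain u where u: "\<Phi> u = u"
    using banach_fix_type[of "1/2" \<Phi>] by auto
  let ?u = "apply_bcontfun u"
  define Y where "Y t = e t *\<^sub>R ?u t" for t
  have Gu: "G ?u = (\<lambda>t. (snd (Y t), c t * fst (Y t)))"
    by (rule ext) (simp add: G_def Y_def mult.commute)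
  have Yint: "(G ?u has_integral (y1, p1) - Y x) {x..b}" if x: "x \<in> {a..b}" for x
  proof -
    have "?u x = T ?u x" by (metis u \<Phi>)
    then have "Y x = (y1, p1) - integral {x..b} (G ?u)"
      using x epos[of x] by (simp add: Y_def T_def prx)
    moreover have "G ?u integrable_on {x..b}"
      using Gi[of ?u] by (rule integrable_on_subinterval) (use x in auto)
    ultimately show ?thesis by (simp add: integrable_integral)
  qed
  have "(y1, p1) - Y b = 0"
    using \<open>a \<le> b\<close> by (intro has_integral_unique[OF Yint has_integral_null_real]) auto
  then have "Y b = (y1, p1)" by simp
  then have Yb: "fst (Y b) = y1" "snd (Y b) = p1" by auto
  show thesis
  proof (rule that[of "\<lambda>t. fst (Y t)" "\<lambda>t. snd (Y t)"])
    show "is_primitive a b (\<lambda>t. fst (Y t)) (\<lambda>t. snd (Y t))"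
      using has_integral_linear[OF Yint bounded_linear_fst]
      by (intro is_primitiveI_right) (simp add: o_def Gu Yb)
    show "is_primitive a b (\<lambda>t. snd (Y t)) (\<lambda>t. c t * fst (Y t))"
      using has_integral_linear[OF Yint bounded_linear_snd]
      by (intro is_primitiveI_right) (simp add: o_def Gu Yb)
  qed (use Yb in auto)
qed

text \<open>Gronwall for \<open>cmod (y x) + cmod (p x)\<close>. The inhomogeneity
  \<open>\<epsilon>\<close> accommodates the difference of two solutions at distinct spectral
  parameters, which solves a common system only up to such an error.\<close>

lemma linear_system_bound:
  fixes \<kappa> :: "real \<Rightarrow> real"
  assumes \<kappa>: "\<kappa> absolutely_integrable_on {a..b}" and pos: "\<And>t. 0 \<le> \<kappa> t"
  obtains C where "0 \<le> C" and "\<And>y p r \<epsilon> x. is_primitive a b y p \<Longrightarrow> is_primitive a b p r \<Longrightarrow>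
    (\<And>t. t \<in> {a..b} \<Longrightarrow> cmod (r t) \<le> \<kappa> t * cmod (y t) + \<epsilon>) \<Longrightarrow> 0 \<le> \<epsilon> \<Longrightarrow> x \<in> {a..b} \<Longrightarrow>
    cmod (y x) + cmod (p x) \<le> C * (cmod (y b) + cmod (p b) + \<epsilon>)"
proof -
  have ki: "(\<lambda>t. 1 + \<kappa> t) absolutely_integrable_on {a..b}"
    using \<kappa> by (intro set_integral_add) (auto simp: absolutely_integrable_on_const)
  have "0 \<le> 1 + \<kappa> t" for t using pos[of t] by simp
  from Gronwall_L1[OF ki this] obtain C where C: "0 \<le> C" "\<And>E A x. continuous_on {a..b} E \<Longrightarrow> 0 \<le> A \<Longrightarrow>
    (\<And>x. x \<in> {a..b} \<Longrightarrow> E x \<le> A + integral {x..b} (\<lambda>t. (1 + \<kappa> t) * E t)) \<Longrightarrow> x \<in> {a..b} \<Longrightarrow> E x \<le> C * A"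
    by blast
  let ?C = "C * (1 + \<bar>b - a\<bar>)"
  show thesis
  proof (rule that[of ?C])
    fix y p r \<epsilon> x
    assume y: "is_primitive a b y p" and p: "is_primitive a b p r"
      and r: "\<And>t. t \<in> {a..b} \<Longrightarrow> cmod (r t) \<le> \<kappa> t * cmod (y t) + \<epsilon>" and "0 \<le> \<epsilon>" and x: "x \<in> {a..b}"
    note c = is_primitive_continuous_on[OF y] is_primitive_continuous_on[OF p]
    let ?E = "\<lambda>t. cmod (y t) + cmod (p t)"
    let ?A = "cmod (y b) + cmod (p b) + \<epsilon> * \<bar>b - a\<bar>"
    have Ec: "continuous_on {a..b} ?E" by (intro continuous_intros c)
    have "?E x \<le> C * ?A"
    proof (rule C(2)[OF Ec _ _ x])
      show "0 \<le> ?A" using \<open>0 \<le> \<epsilon>\<close> by simp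
      fix s assume s: "s \<in> {a..b}"
      have "(\<lambda>t. ?E t * (1 + \<kappa> t)) absolutely_integrable_on {a..b}"
        by (intro absolutely_integrable_continuous_mult Ec ki)
      then have "(\<lambda>t. ?E t * (1 + \<kappa> t)) integrable_on {a..b}"
        using set_lebesgue_integral_eq_integral(1) by blast
      then have i: "(\<lambda>t. ?E t * (1 + \<kappa> t)) integrable_on {s..b}"
        by (rule integrable_on_subinterval) (use s in auto)
      have iy: "(p has_integral y b - y s) {s..b}" and ip: "(r has_integral p b - p s) {s..b}"
        using s by (auto intro!: is_primitiveD[OF y] is_primitiveD[OF p])
      have "norm (y b - y s) \<le> integral {s..b} (\<lambda>t. cmod (p t))"
      proof -
        have "(\<lambda>t. cmod (p t)) integrable_on {s..b}"
          using s by (intro integrable_continuous_real continuous_on_norm continuous_on_subset[OF c(2)]) auto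
        then have "norm (integral {s..b} p) \<le> integral {s..b} (\<lambda>t. cmod (p t))"
          using iy by (intro integral_norm_bound_integral) auto
        then show ?thesis using iy by (simp add: integral_unique)
      qed
      \<comment> \<open>Subtracting \<open>cmod (p t)\<close> reserves that share for the increment
        of \<open>y\<close>; the two bounds then add up to the single kernel
        \<open>1 + \<kappa> t\<close> applied to \<open>?E\<close>.\<close>
      moreover have "norm (p b - p s) \<le> integral {s..b} (\<lambda>t. ?E t * (1 + \<kappa> t) - cmod (p t) + \<epsilon>)"
      proof -
        have "(\<lambda>t. cmod (p t)) integrable_on {s..b}"
          using s by (intro integrable_continuous_real continuous_on_norm continuous_on_subset[OF c(2)]) auto
        then have "(\<lambda>t. ?E t * (1 + \<kappa> t) - cmod (p t) + \<epsilon>) integrable_on {s..b}"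
          using i by (intro integrable_add integrable_diff) auto
        moreover have "cmod (r t) \<le> ?E t * (1 + \<kappa> t) - cmod (p t) + \<epsilon>" if "t \<in> {s..b}" for t
        proof -
          have "cmod (r t) \<le> \<kappa> t * cmod (y t) + \<epsilon>" using r that s by auto
          also have "\<dots> \<le> ?E t * (1 + \<kappa> t) - cmod (p t) + \<epsilon>"
            using mult_nonneg_nonneg[OF pos[of t], of "cmod (p t)"] by (simp add: algebra_simps)
          finally show ?thesis .
        qed
        ultimately have "norm (integral {s..b} r) \<le> integral {s..b} (\<lambda>t. ?E t * (1 + \<kappa> t) - cmod (p t) + \<epsilon>)"
          using ip by (intro integral_norm_bound_integral) auto
        then show ?thesis using ip by (simp add: integral_unique)
      qed
      moreover have "integral {s..b} (\<lambda>t. ?E t * (1 + \<kappa> t) - cmod (p t) + \<epsilon>) =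
         integral {s..b} (\<lambda>t. ?E t * (1 + \<kappa> t)) - integral {s..b} (\<lambda>t. cmod (p t)) + \<epsilon> * (b - s)"
      proof -
        have ipp: "(\<lambda>t. cmod (p t)) integrable_on {s..b}"
          using s by (intro integrable_continuous_real continuous_on_norm continuous_on_subset[OF c(2)]) auto
        have "((\<lambda>t. ?E t * (1 + \<kappa> t) - cmod (p t) + \<epsilon>) has_integral
           integral {s..b} (\<lambda>t. ?E t * (1 + \<kappa> t)) - integral {s..b} (\<lambda>t. cmod (p t)) + (b - s) *\<^sub>R \<epsilon>) {s..b}"
          using s has_integral_const_real[of \<epsilon> s b]
          by (intro has_integral_add has_integral_diff integrable_integral i ipp) auto
        then show ?thesis by (simp add: integral_unique mult.commute)
      qed
      moreover have "\<epsilon> * (b - s) \<le> \<epsilon> * \<bar>b - a\<bar>"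
        using s \<open>0 \<le> \<epsilon>\<close> by (intro mult_left_mono) auto
      moreover have "cmod (y s) \<le> cmod (y b) + cmod (y b - y s)" "cmod (p s) \<le> cmod (p b) + cmod (p b - p s)"
        by (metis norm_minus_commute norm_triangle_sub)+
      ultimately have "?E s \<le> ?A + integral {s..b} (\<lambda>t. ?E t * (1 + \<kappa> t))"
        by linarith
      then show "?E s \<le> ?A + integral {s..b} (\<lambda>t. (1 + \<kappa> t) * ?E t)"
        by (simp add: mult.commute)
    qed
    also have "\<dots> \<le> C * ((cmod (y b) + cmod (p b) + \<epsilon>) * (1 + \<bar>b - a\<bar>))"
      using \<open>0 \<le> C\<close> \<open>0 \<le> \<epsilon>\<close> by (intro mult_left_mono) (auto simp: algebra_simps)
    finally show "?E x \<le> ?C * (cmod (y b) + cmod (p b) + \<epsilon>)"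
      by (simp add: mult_ac)
  qed (use \<open>0 \<le> C\<close> in auto)
qed

section \<open>Solutions with a transfer condition\<close>

lemma square_integrable_on_imp_integrable:
  assumes "square_integrable_on q {a..b}"
  shows "(\<lambda>x. (q x)\<^sup>2) integrable_on {a..b}" and "q absolutely_integrable_on {a..b}"
proof -
  show sq: "(\<lambda>x. (q x)\<^sup>2) integrable_on {a..b}"
    using assms set_lebesgue_integral_eq_integral(1) unfolding square_integrable_on_def by blast
  show "q absolutely_integrable_on {a..b}"
  proof (rule measurable_bounded_by_integrable_imp_absolutely_integrable)
    show "q \<in> borel_measurable (lebesgue_on {a..b})"
      using assms unfolding square_integrable_on_def set_borel_measurable_def
      by (subst borel_measurable_restrict_space_iff) auto
    show "(\<lambda>x. 1 + (q x)\<^sup>2) integrable_on {a..b}"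
      by (intro integrable_add sq) auto
    show "norm (q x) \<le> 1 + (q x)\<^sup>2" for x
      using zero_le_power2[of "\<bar>q x\<bar> - 1"] abs_ge_zero[of "q x"]
      unfolding power2_diff by (simp add: real_norm_def)
  qed auto
qed

lemma lmeasurable_Icc: "{a..b} \<in> lmeasurable" for a b :: real
  using lmeasurable_cbox[of a b] by simp

section \<open>Passage between solutions and integral equations\<close>

text \<open>\<open>F\<close> minus the indefinite integral is continuous, and constant on a dense
  subset. This carries the integral equations from a half-open interval to the one-sided limit at
  the transfer point.\<close>

lemma is_primitive_extend_right:
  fixes f :: "real \<Rightarrow> 'a::banach"
  assumes "a < c" "continuous_on {a..c} F" "f integrable_on {a..c}"
    and F: "\<And>x. x \<in> {a..<c} \<Longrightarrow> (f has_integral F x - F a) {a..x}"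
  shows "is_primitive a c F f"
proof (rule is_primitiveI_left)
  fix x assume x: "x \<in> {a..c}"
  have "continuous_on (closure {a..<c}) (\<lambda>x. F x - F a - integral {a..x} f)"
    using assms by (simp, intro continuous_intros indefinite_integral_continuous_1)
  moreover have "F x - F a - integral {a..x} f = 0" if "x \<in> {a..<c}" for x
    using F[OF that] by (simp add: integral_unique)
  moreover have "x \<in> closure {a..<c}" using x \<open>a < c\<close> by simp
  ultimately have "F x - F a - integral {a..x} f = 0"
    by (rule continuous_constant_on_closure)
  moreover have "f integrable_on {a..x}"
    using assms(3) by (rule integrable_on_subinterval) (use x in auto)
  ultimately show "(f has_integral F x - F a) {a..x}"
    by (metis eq_iff_diff_eq_0 integrable_integral)
qed

lemma is_primitive_extend_left:
  fixes f :: "real \<Rightarrow> 'a::banach"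
  assumes "c < b" "continuous_on {c..b} F" "f integrable_on {c..b}"
    and F: "\<And>x. x \<in> {c<..b} \<Longrightarrow> (f has_integral F b - F x) {x..b}"
  shows "is_primitive c b F f"
proof (rule is_primitiveI_right)
  fix x assume x: "x \<in> {c..b}"
  have "continuous_on (closure {c<..b}) (\<lambda>x. F b - F x - integral {x..b} f)"
    using assms by (simp, intro continuous_intros indefinite_integral_continuous_1')
  moreover have "F b - F x - integral {x..b} f = 0" if "x \<in> {c<..b}" for x
    using F[OF that] by (simp add: integral_unique)
  moreover have "x \<in> closure {c<..b}" using x \<open>c < b\<close> by simp
  ultimately have "F b - F x - integral {x..b} f = 0"
    by (rule continuous_constant_on_closure)
  moreover have "f integrable_on {x..b}"
    using assms(3) by (rule integrable_on_subinterval) (use x in auto)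
  ultimately show "(f has_integral F b - F x) {x..b}"
    by (metis eq_iff_diff_eq_0 integrable_integral)
qed

lemma continuous_on_extend_right:
  fixes f :: "real \<Rightarrow> 'a::topological_space"
  assumes "a < c" "continuous_on {a..<c} f" "(f \<longlongrightarrow> l) (at_left c)"
  shows "continuous_on {a..c} (f(c := l))"
  unfolding continuous_on_def
proof
  fix x assume x: "x \<in> {a..c}"
  show "((f(c := l)) \<longlongrightarrow> (f(c := l)) x) (at x within {a..c})"
  proof (cases "x = c")
    case True
    have "(f \<longlongrightarrow> l) (at c within {a..c})"
      using assms(1,3) by (simp add: at_within_Icc_at_left)
    moreover have "\<forall>\<^sub>F y in at c within A. f y = (f(c := l)) y" for A
      by (simp add: eventually_at_filter)
    ultimately show ?thesis
      unfolding True fun_upd_same by (rule Lim_transform_eventually)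
  next
    case False
    then have "x < c" using x by simp
    then have "(f \<longlongrightarrow> f x) (at x within {a..<c})"
      using assms(2) x by (auto simp: continuous_on_def)
    moreover have "at x within {a..<c} = at x within {a..c}"
      using \<open>x < c\<close> by (intro at_within_nhd[of x "{..<c}"]) auto
    ultimately have "(f \<longlongrightarrow> f x) (at x within {a..c})" by simp
    moreover have "\<forall>\<^sub>F y in at x within {a..c}. f y = (f(c := l)) y"
    proof -
      have "\<forall>\<^sub>F y in at x. y \<in> {..<c}"
        using \<open>x < c\<close> by (intro eventually_at_in_open') auto
      then have "\<forall>\<^sub>F y in at x within {a..c}. y \<in> {..<c}"
        by (rule filter_leD[OF at_le[OF subset_UNIV]])
      then show ?thesis by (rule eventually_mono) auto
    qed
    ultimately have "((f(c := l)) \<longlongrightarrow> f x) (at x within {a..c})"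
      by (rule Lim_transform_eventually)
    then show ?thesis using False by simp
  qed
qed

lemma continuous_on_extend_left:
  fixes f :: "real \<Rightarrow> 'a::topological_space"
  assumes "c < b" "continuous_on {c<..b} f" "(f \<longlongrightarrow> l) (at_right c)"
  shows "continuous_on {c..b} (f(c := l))"
  unfolding continuous_on_def
proof
  fix x assume x: "x \<in> {c..b}"
  show "((f(c := l)) \<longlongrightarrow> (f(c := l)) x) (at x within {c..b})"
  proof (cases "x = c")
    case True
    have "(f \<longlongrightarrow> l) (at c within {c..b})"
      using assms(1,3) by (simp add: at_within_Icc_at_right)
    moreover have "\<forall>\<^sub>F y in at c within A. f y = (f(c := l)) y" for A
      by (simp add: eventually_at_filter)
    ultimately show ?thesis
      unfolding True fun_upd_same by (rule Lim_transform_eventually)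
  next
    case False
    then have "c < x" using x by simp
    then have "(f \<longlongrightarrow> f x) (at x within {c<..b})"
      using assms(2) x by (auto simp: continuous_on_def)
    moreover have "at x within {c<..b} = at x within {c..b}"
      using \<open>c < x\<close> by (intro at_within_nhd[of x "{c<..}"]) auto
    ultimately have "(f \<longlongrightarrow> f x) (at x within {c..b})" by simp
    moreover have "\<forall>\<^sub>F y in at x within {c..b}. f y = (f(c := l)) y"
    proof -
      have "\<forall>\<^sub>F y in at x. y \<in> {c<..}"
        using \<open>c < x\<close> by (intro eventually_at_in_open') auto
      then have "\<forall>\<^sub>F y in at x within {c..b}. y \<in> {c<..}"
        by (rule filter_leD[OF at_le[OF subset_UNIV]])
      then show ?thesis by (rule eventually_mono) auto
    qed
    ultimately have "((f(c := l)) \<longlongrightarrow> f x) (at x within {c..b})"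
      by (rule Lim_transform_eventually)
    then show ?thesis using False by simp
  qed
qed

definition sl_pair :: "real \<Rightarrow> real \<Rightarrow> (real \<Rightarrow> real) \<Rightarrow> complex \<Rightarrow> (real \<Rightarrow> complex) \<Rightarrow> (real \<Rightarrow> complex) \<Rightarrow> bool" where
  "sl_pair a b q z y p \<longleftrightarrow> is_primitive a b y p \<and>
     is_primitive a b p (\<lambda>x. (complex_of_real (q x) - z) * y x)"

text \<open>
  In both definitions \<open>p\<close> plays the role of \<open>y'\<close>. The pieces on \<open>[-S,0]\<close> and \<open>[0,S]\<close> carry the
  one-sided limits at \<open>0\<close> as values, so \<open>y 0\<close> and \<open>p 0\<close> stay unconstrained.
\<close>

definition sl_solution ::
    "real \<Rightarrow> (real \<Rightarrow> real) \<Rightarrow> real^2^2 \<Rightarrow> complex \<Rightarrow> (real \<Rightarrow> complex) \<Rightarrow> (real \<Rightarrow> complex) \<Rightarrow> bool" where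
  "sl_solution S q M z y p \<longleftrightarrow> (\<exists>yl pl yr pr.
     sl_pair (-S) 0 q z yl pl \<and> sl_pair 0 S q z yr pr \<and>
     yr 0 = complex_of_real (M$1$1) * yl 0 + complex_of_real (M$1$2) * pl 0 \<and>
     pr 0 = complex_of_real (M$2$1) * yl 0 + complex_of_real (M$2$2) * pl 0 \<and>
     (\<forall>x\<in>{-S..<0}. y x = yl x \<and> p x = pl x) \<and> (\<forall>x\<in>{0<..S}. y x = yr x \<and> p x = pr x))"

lemma absolutely_integrable_potential_mult:
  fixes q :: "real \<Rightarrow> real"
  assumes "q absolutely_integrable_on {a..b}" "continuous_on {a..b} y"
  shows "(\<lambda>x. (complex_of_real (q x) - z) * y x) absolutely_integrable_on {a..b}"
proof -
  have "(\<lambda>x. complex_of_real (q x)) absolutely_integrable_on {a..b}"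
    using absolutely_integrable_linear[OF assms(1) bounded_linear_of_real] by (simp add: o_def)
  then have "(\<lambda>x. complex_of_real (q x) - z) absolutely_integrable_on {a..b}"
    by (intro set_integral_diff(1) absolutely_integrable_on_const) (simp_all add: lmeasurable_Icc)
  from absolutely_integrable_continuous_mult[OF assms(2) this] show ?thesis
    by (simp add: mult.commute)
qed

lemma integrable_potential_mult:
  fixes q :: "real \<Rightarrow> real"
  assumes "q absolutely_integrable_on {a..b}" "continuous_on {a..b} y"
  shows "(\<lambda>x. (complex_of_real (q x) - z) * y x) integrable_on {a..b}"
  using absolutely_integrable_potential_mult[OF assms] set_lebesgue_integral_eq_integral(1) by blast

text \<open>\<open>y\<close> is differentiable at every point off 0, so the ordinary fundamental
  theorem handles it; \<open>dX S y\<close> is differentiable only almost everywhere, and its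
  absolute continuity is what permits integration. Continuity then extends both equations to
  0.\<close>

lemma is_solution_imp_sl_solution:
  assumes "S > 0" and q: "q absolutely_integrable_on {-S..S}" and sol: "is_solution S q M z y"
  shows "sl_solution S q M z y (dX S y)"
proof -
  let ?p = "dX S y"
  from sol have diff: "y differentiable_on ({-S..S} - {0})"
    and acy: "abs_cont_on {-S..<0} y" "abs_cont_on {0<..S} y"
    and acp: "abs_cont_on {-S..<0} ?p" "abs_cont_on {0<..S} ?p"
    and ae: "AE x in lebesgue. x \<in> {-S..S} \<longrightarrow>
        (\<exists>y2. (?p has_vector_derivative y2) (at x) \<and> - y2 + complex_of_real (q x) * y x = z * y x)"
    and tc: "transfer_condition S M y"
    by (auto simp: is_solution_def)
  from tc obtain l r :: "complex^2" where lr: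
      "(y \<longlongrightarrow> l $ 1) (at_left 0)" "(?p \<longlongrightarrow> l $ 2) (at_left 0)"
      "(y \<longlongrightarrow> r $ 1) (at_right 0)" "(?p \<longlongrightarrow> r $ 2) (at_right 0)"
      "r = map_matrix complex_of_real M *v l"
    unfolding transfer_condition_def by blast
  \<comment> \<open>The arbitrary value at 0 is overwritten by the one-sided limit, which makes each
    piece continuous on its closed half.\<close>
  define yl where "yl = y(0 := l $ 1)"
  define pl where "pl = ?p(0 := l $ 2)"
  define yr where "yr = y(0 := r $ 1)"
  define pr where "pr = ?p(0 := r $ 2)"
  have uc: "uniformly_continuous_on {-S..<0} f" if "abs_cont_on {-S..<0} f" for f :: "real \<Rightarrow> complex"
    using that by (rule abs_cont_on_imp_uniformly_continuous_on) auto
  have uc': "uniformly_continuous_on {0<..S} f" if "abs_cont_on {0<..S} f" for f :: "real \<Rightarrow> complex"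
    using that by (rule abs_cont_on_imp_uniformly_continuous_on) auto
  have cl: "continuous_on {-S..0} yl" "continuous_on {-S..0} pl"
    unfolding yl_def pl_def
    by (intro continuous_on_extend_right uniformly_continuous_imp_continuous uc acy acp lr; use \<open>S > 0\<close> in simp)+
  have cr: "continuous_on {0..S} yr" "continuous_on {0..S} pr"
    unfolding yr_def pr_def
    by (intro continuous_on_extend_left uniformly_continuous_imp_continuous uc' acy acp lr; use \<open>S > 0\<close> in simp)+
  have dy: "(y has_vector_derivative ?p x) (at x within {-S..S} - {0})" if "x \<in> {-S..S} - {0}" for x
    using diff that unfolding differentiable_on_def dX_def by (simp flip: vector_derivative_works)
  from ae obtain N where N: "negligible N" and dp: "\<And>x. x \<in> {-S..S} - N \<Longrightarrow>
      (?p has_vector_derivative ((complex_of_real (q x) - z) * y x)) (at x)"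
  proof -
    obtain N where N: "N \<in> null_sets lebesgue" "{x. \<not> (x \<in> {-S..S} \<longrightarrow>
        (\<exists>y2. (?p has_vector_derivative y2) (at x) \<and> - y2 + complex_of_real (q x) * y x = z * y x))} \<subseteq> N"
      using ae unfolding eventually_ae_filter by auto
    have "(?p has_vector_derivative ((complex_of_real (q x) - z) * y x)) (at x)" if "x \<in> {-S..S} - N" for x
    proof -
      obtain y2 where "(?p has_vector_derivative y2) (at x)" "- y2 + complex_of_real (q x) * y x = z * y x"
        using N(2) \<open>x \<in> {-S..S} - N\<close> by blast
      moreover from this(2) have "y2 = (complex_of_real (q x) - z) * y x"
        by (simp add: algebra_simps)
      ultimately show ?thesis by simp
    qed
    with N(1) that show thesis by (simp add: negligible_iff_null_sets)
  qed
  have ql: "q absolutely_integrable_on {-S..0}" and qr: "q absolutely_integrable_on {0..S}"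
    using q \<open>S > 0\<close> by (auto intro: absolutely_integrable_on_subinterval)
  have L1: "is_primitive (-S) 0 yl pl"
  proof (rule is_primitive_extend_right)
    show "pl integrable_on {-S..0}" using cl by (intro integrable_continuous_real)
    fix x assume x: "x \<in> {-S..<0}"
    have "(?p has_integral y x - y (-S)) {-S..x}"
      using x by (intro fundamental_theorem_of_calculus has_vector_derivative_within_subset[OF dy]) auto
    then have "(pl has_integral y x - y (-S)) {-S..x}"
      by (rule has_integral_eq[rotated]) (use x in \<open>auto simp: pl_def\<close>)
    then show "(pl has_integral yl x - yl (-S)) {-S..x}"
      using x by (simp add: yl_def)
  qed (use cl \<open>S > 0\<close> in auto)
  have L2: "is_primitive (-S) 0 pl (\<lambda>x. (complex_of_real (q x) - z) * yl x)"
  proof (rule is_primitive_extend_right)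
    show "(\<lambda>x. (complex_of_real (q x) - z) * yl x) integrable_on {-S..0}"
      by (rule integrable_potential_mult[OF ql cl(1)])
    fix x assume x: "x \<in> {-S..<0}"
    have "((\<lambda>x. (complex_of_real (q x) - z) * y x) has_integral ?p x - ?p (-S)) {-S..x}"
      using x by (intro fundamental_theorem_of_calculus_abs_cont[OF _ _ N] has_vector_derivative_at_within[OF dp]
          abs_cont_on_subset[OF acp(1)]) auto
    then have "((\<lambda>x. (complex_of_real (q x) - z) * yl x) has_integral ?p x - ?p (-S)) {-S..x}"
      by (rule has_integral_eq[rotated]) (use x in \<open>auto simp: yl_def\<close>)
    then show "((\<lambda>x. (complex_of_real (q x) - z) * yl x) has_integral pl x - pl (-S)) {-S..x}"
      using x by (simp add: pl_def)
  qed (use cl \<open>S > 0\<close> in auto)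
  have R1: "is_primitive 0 S yr pr"
  proof (rule is_primitive_extend_left)
    show "pr integrable_on {0..S}" using cr by (intro integrable_continuous_real)
    fix x assume x: "x \<in> {0<..S}"
    have "(?p has_integral y S - y x) {x..S}"
      using x by (intro fundamental_theorem_of_calculus has_vector_derivative_within_subset[OF dy]) auto
    then have "(pr has_integral y S - y x) {x..S}"
      by (rule has_integral_eq[rotated]) (use x in \<open>auto simp: pr_def\<close>)
    then show "(pr has_integral yr S - yr x) {x..S}"
      using x by (simp add: yr_def)
  qed (use cr \<open>S > 0\<close> in auto)
  have R2: "is_primitive 0 S pr (\<lambda>x. (complex_of_real (q x) - z) * yr x)"
  proof (rule is_primitive_extend_left)
    show "(\<lambda>x. (complex_of_real (q x) - z) * yr x) integrable_on {0..S}"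
      by (rule integrable_potential_mult[OF qr cr(1)])
    fix x assume x: "x \<in> {0<..S}"
    have "((\<lambda>x. (complex_of_real (q x) - z) * y x) has_integral ?p S - ?p x) {x..S}"
      using x by (intro fundamental_theorem_of_calculus_abs_cont[OF _ _ N] has_vector_derivative_at_within[OF dp]
          abs_cont_on_subset[OF acp(2)]) auto
    then have "((\<lambda>x. (complex_of_real (q x) - z) * yr x) has_integral ?p S - ?p x) {x..S}"
      by (rule has_integral_eq[rotated]) (use x in \<open>auto simp: yr_def\<close>)
    then show "((\<lambda>x. (complex_of_real (q x) - z) * yr x) has_integral pr S - pr x) {x..S}"
      using x by (simp add: pr_def)
  qed (use cr \<open>S > 0\<close> in auto)
  have "yr 0 = complex_of_real (M$1$1) * yl 0 + complex_of_real (M$1$2) * pl 0"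
    "pr 0 = complex_of_real (M$2$1) * yl 0 + complex_of_real (M$2$2) * pl 0"
    by (simp_all add: yr_def pr_def yl_def pl_def lr(5) matrix_vector_mult_def map_matrix_def sum_2)
  then show ?thesis
    unfolding sl_solution_def sl_pair_def
    using L1 L2 R1 R2 by (intro exI[of _ yl] exI[of _ pl] exI[of _ yr] exI[of _ pr])
      (auto simp: yl_def pl_def yr_def pr_def)
qed

text \<open>\<open>p\<close> is continuous, so the first integral equation makes it the derivative
  of \<open>y\<close> everywhere off 0. The second has an integrand that is only integrable and
  becomes a pointwise equation almost everywhere, by Lebesgue differentiation.\<close>

lemma sl_solution_imp_is_solution:
  assumes "S > 0" and q: "q absolutely_integrable_on {-S..S}" and sol: "sl_solution S q M z y p"
  shows "is_solution S q M z y" and "x \<in> {-S..S} - {0} \<Longrightarrow> dX S y x = p x"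
proof -
  from sol obtain yl pl yr pr where L: "is_primitive (-S) 0 yl pl"
      "is_primitive (-S) 0 pl (\<lambda>x. (complex_of_real (q x) - z) * yl x)"
    and R: "is_primitive 0 S yr pr" "is_primitive 0 S pr (\<lambda>x. (complex_of_real (q x) - z) * yr x)"
    and t: "yr 0 = complex_of_real (M$1$1) * yl 0 + complex_of_real (M$1$2) * pl 0"
     "pr 0 = complex_of_real (M$2$1) * yl 0 + complex_of_real (M$2$2) * pl 0"
    and yl: "\<And>x. x \<in> {-S..<0} \<Longrightarrow> y x = yl x \<and> p x = pl x"
    and yr: "\<And>x. x \<in> {0<..S} \<Longrightarrow> y x = yr x \<and> p x = pr x"
    unfolding sl_solution_def sl_pair_def by blast
  note cl = is_primitive_continuous_on[OF L(1)] is_primitive_continuous_on[OF L(2)]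
  note cr = is_primitive_continuous_on[OF R(1)] is_primitive_continuous_on[OF R(2)]
  have ql: "q absolutely_integrable_on {-S..0}" and qr: "q absolutely_integrable_on {0..S}"
    using q \<open>S > 0\<close> by (auto intro: absolutely_integrable_on_subinterval)
  have atl: "at x within {-S..S} - {0} = at x within {-S..0}" if "x \<in> {-S..<0}" for x
    using that by (intro at_within_nhd[of x "{..<0}"]) auto
  have atr: "at x within {-S..S} - {0} = at x within {0..S}" if "x \<in> {0<..S}" for x
    using that by (intro at_within_nhd[of x "{0<..}"]) auto
  have split: "x \<in> {-S..<0} \<or> x \<in> {0<..S}" if "x \<in> {-S..S} - {0}" for x
    using that by auto
  have dy: "(y has_vector_derivative p x) (at x within {-S..S} - {0})" if "x \<in> {-S..S} - {0}" for x
    using split[OF that]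
  proof
    assume x: "x \<in> {-S..<0}"
    have "(yl has_vector_derivative pl x) (at x within {-S..0})"
      using x by (intro is_primitive_has_vector_derivative_if_continuous[OF L(1) cl(2)]) auto
    then have "(yl has_vector_derivative pl x) (at x within {-S..<0})"
      by (rule has_vector_derivative_within_subset) auto
    then have "(y has_vector_derivative pl x) (at x within {-S..<0})"
      by (rule has_vector_derivative_transform[OF x, rotated]) (use yl in auto)
    moreover have "at x within {-S..<0} = at x within {-S..S} - {0}"
      using x by (intro at_within_nhd[of x "{..<0}"]) auto
    ultimately show ?thesis using yl[OF x] by simp
  next
    assume x: "x \<in> {0<..S}"
    have "(yr has_vector_derivative pr x) (at x within {0..S})"
      using x by (intro is_primitive_has_vector_derivative_if_continuous[OF R(1) cr(2)]) auto
    then have "(yr has_vector_derivative pr x) (at x within {0<..S})"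
      by (rule has_vector_derivative_within_subset) auto
    then have "(y has_vector_derivative pr x) (at x within {0<..S})"
      by (rule has_vector_derivative_transform[OF x, rotated]) (use yr in auto)
    moreover have "at x within {0<..S} = at x within {-S..S} - {0}"
      using x by (intro at_within_nhd[of x "{0<..}"]) auto
    ultimately show ?thesis using yr[OF x] by simp
  qed
  \<comment> \<open>\<open>vector_derivative\<close> has a well-determined value only at limit
    points of the domain.\<close>
  have nb: "at x within {-S..S} - {0} \<noteq> bot" if "x \<in> {-S..S} - {0}" for x
    using split[OF that]
  proof
    assume x: "x \<in> {-S..<0}"
    then show ?thesis using \<open>S > 0\<close> unfolding atl[OF x] trivial_limit_within by auto
  next
    assume x: "x \<in> {0<..S}"
    then show ?thesis using \<open>S > 0\<close> unfolding atr[OF x] trivial_limit_within by auto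
  qed
  have dX: "dX S y x = p x" if "x \<in> {-S..S} - {0}" for x
    unfolding dX_def using nb[OF that] dy[OF that] by (rule vector_derivative_within)
  then show "x \<in> {-S..S} - {0} \<Longrightarrow> dX S y x = p x" .
  have dXl: "dX S y x = pl x" if "x \<in> {-S..<0}" for x using dX[of x] yl[OF that] that \<open>S > 0\<close> by auto
  have dXr: "dX S y x = pr x" if "x \<in> {0<..S}" for x using dX[of x] yr[OF that] that \<open>S > 0\<close> by auto
  have ac: "abs_cont_on {-S..<0} y" "abs_cont_on {0<..S} y"
       "abs_cont_on {-S..<0} (dX S y)" "abs_cont_on {0<..S} (dX S y)"
  proof -
    have "abs_cont_on {-S..0} yl" "abs_cont_on {0..S} yr"
      by (auto intro!: is_primitive_abs_cont_on[OF L(1)] is_primitive_abs_cont_on[OF R(1)]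
        absolutely_integrable_continuous_real cl cr)
    then have "abs_cont_on {-S..<0} yl" "abs_cont_on {0<..S} yr"
      by (auto elim!: abs_cont_on_subset)
    then show "abs_cont_on {-S..<0} y" "abs_cont_on {0<..S} y"
      by (auto elim!: abs_cont_on_cong simp: yl yr)
    have "abs_cont_on {-S..0} pl" "abs_cont_on {0..S} pr"
      by (auto intro!: is_primitive_abs_cont_on[OF L(2)] is_primitive_abs_cont_on[OF R(2)]
        absolutely_integrable_potential_mult cl cr ql qr)
    then have "abs_cont_on {-S..<0} pl" "abs_cont_on {0<..S} pr"
      by (auto elim!: abs_cont_on_subset)
    then show "abs_cont_on {-S..<0} (dX S y)" "abs_cont_on {0<..S} (dX S y)"
      by (auto elim!: abs_cont_on_cong simp: dXl dXr)
  qed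
  obtain N1 where N1: "negligible N1" "\<And>x. x \<in> {-S<..<0} - N1 \<Longrightarrow>
      (pl has_vector_derivative (complex_of_real (q x) - z) * yl x) (at x)"
    using is_primitive_has_vector_derivative[OF L(2) integrable_potential_mult[OF ql cl(1)]] by blast
  obtain N2 where N2: "negligible N2" "\<And>x. x \<in> {0<..<S} - N2 \<Longrightarrow>
      (pr has_vector_derivative (complex_of_real (q x) - z) * yr x) (at x)"
    using is_primitive_has_vector_derivative[OF R(2) integrable_potential_mult[OF qr cr(1)]] by blast
  \<comment> \<open>\<open>is_solution\<close> asks for a two-sided derivative of
    \<open>dX S y\<close>, so the two ends and 0 join the exceptional set.\<close>
  have dp: "(dX S y has_vector_derivative (complex_of_real (q x) - z) * y x) (at x)"
    if x: "x \<in> {-S..S}" "x \<notin> N1 \<union> N2 \<union> {-S, 0, S}" for x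
  proof (cases "x < 0")
    case True
    then have x': "x \<in> {-S<..<0}" using x by auto
    with N1 x have "(pl has_vector_derivative (complex_of_real (q x) - z) * yl x) (at x)" by auto
    then have "(dX S y has_vector_derivative (complex_of_real (q x) - z) * yl x) (at x)"
      by (rule has_vector_derivative_transform_within_open[OF _ _ x']) (auto simp: dXl)
    then show ?thesis using yl[of x] x' by simp
  next
    case False
    then have x': "x \<in> {0<..<S}" using x by auto
    with N2 x have "(pr has_vector_derivative (complex_of_real (q x) - z) * yr x) (at x)" by auto
    then have "(dX S y has_vector_derivative (complex_of_real (q x) - z) * yr x) (at x)"
      by (rule has_vector_derivative_transform_within_open[OF _ _ x']) (auto simp: dXr)
    then show ?thesis using yr[of x] x' by simp
  qed
  have "negligible (N1 \<union> N2 \<union> {-S, 0, S})"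
    using N1(1) N2(1) by (intro negligible_Un) auto
  then have "AE x in lebesgue. x \<notin> N1 \<union> N2 \<union> {-S, 0, S}"
    by (intro AE_not_in) (simp add: negligible_iff_null_sets)
  then have ae: "AE x in lebesgue. x \<in> {-S..S} \<longrightarrow>
        (\<exists>y2. (dX S y has_vector_derivative y2) (at x) \<and> - y2 + complex_of_real (q x) * y x = z * y x)"
  proof (rule eventually_mono, intro impI)
    fix x assume "x \<notin> N1 \<union> N2 \<union> {-S, 0, S}" "x \<in> {-S..S}"
    with dp[of x] show "\<exists>y2. (dX S y has_vector_derivative y2) (at x) \<and> - y2 + complex_of_real (q x) * y x = z * y x"
      by (intro exI[of _ "(complex_of_real (q x) - z) * y x"]) (auto simp: algebra_simps)
  qed
  have "transfer_condition S M y"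
  proof -
    have evl: "\<forall>\<^sub>F x in at_left 0. x \<in> {-S..<0}"
      using eventually_at_left_real[of "-S" 0] \<open>S > 0\<close> by (auto elim: eventually_mono)
    have evr: "\<forall>\<^sub>F x in at_right 0. x \<in> {0<..S}"
      using eventually_at_right_real[of 0 S] \<open>S > 0\<close> by (auto elim: eventually_mono)
    have "(yl \<longlongrightarrow> yl 0) (at_left 0)" "(pl \<longlongrightarrow> pl 0) (at_left 0)"
      using \<open>S > 0\<close> by (auto intro!: continuous_on_Icc_at_leftD cl)
    then have 1: "(y \<longlongrightarrow> yl 0) (at_left 0)" "(dX S y \<longlongrightarrow> pl 0) (at_left 0)"
      using evl by (auto elim!: Lim_transform_eventually eventually_mono simp: yl dXl)
    have "(yr \<longlongrightarrow> yr 0) (at_right 0)" "(pr \<longlongrightarrow> pr 0) (at_right 0)"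
      using \<open>S > 0\<close> by (auto intro!: continuous_on_Icc_at_rightD cr)
    then have 2: "(y \<longlongrightarrow> yr 0) (at_right 0)" "(dX S y \<longlongrightarrow> pr 0) (at_right 0)"
      using evr by (auto elim!: Lim_transform_eventually eventually_mono simp: yr dXr)
    show ?thesis
      unfolding transfer_condition_def
      using 1 2 t
      by (intro exI[of _ "vector [yl 0, pl 0]"] exI[of _ "vector [yr 0, pr 0]"])
        (auto simp: vec_eq_iff forall_2 matrix_vector_mult_def map_matrix_def sum_2)
  qed
  moreover have "y differentiable_on ({-S..S} - {0})"
    unfolding differentiable_on_def using dy
    by (meson differentiableI_vector)
  ultimately show "is_solution S q M z y"
    unfolding is_solution_def using ac ae by blast
qed

lemma sl_solution_bounded:
  assumes "sl_solution S q M z y p"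
  obtains B where "0 \<le> B" "\<And>x. x \<in> {-S..S} - {0} \<Longrightarrow> cmod (y x) \<le> B"
proof -
  from assms obtain yl pl yr pr where P: "sl_pair (-S) 0 q z yl pl" "sl_pair 0 S q z yr pr"
    and yl: "\<And>x. x \<in> {-S..<0} \<Longrightarrow> y x = yl x" and yr: "\<And>x. x \<in> {0<..S} \<Longrightarrow> y x = yr x"
    unfolding sl_solution_def by blast
  have "continuous_on {-S..0} yl" "continuous_on {0..S} yr"
    using P unfolding sl_pair_def by (blast intro: is_primitive_continuous_on)+
  then have "bounded (yl ` {-S..0})" "bounded (yr ` {0..S})"
    by (simp_all add: compact_imp_bounded compact_continuous_image)
  then obtain B1 B2 where B: "\<And>x. x \<in> {-S..0} \<Longrightarrow> cmod (yl x) \<le> B1" "\<And>x. x \<in> {0..S} \<Longrightarrow> cmod (yr x) \<le> B2"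
    unfolding bounded_iff by (metis imageI)
  show thesis
  proof (rule that[of "max 0 (max B1 B2)"])
    fix x assume "x \<in> {-S..S} - {0}"
    then show "cmod (y x) \<le> max 0 (max B1 B2)"
      using B(1)[of x] B(2)[of x] yl[of x] yr[of x] by (cases "x < 0") (simp_all add: le_max_iff_disj)
  qed simp
qed

lemma sl_solution_lincomb:
  assumes "sl_solution S q M z y p" "sl_solution S q M z Y P"
  shows "sl_solution S q M z (\<lambda>x. c * y x + d * Y x) (\<lambda>x. c * p x + d * P x)"
proof -
  from assms(1) obtain yl pl yr pr where 1: "sl_pair (-S) 0 q z yl pl" "sl_pair 0 S q z yr pr"
     "yr 0 = complex_of_real (M$1$1) * yl 0 + complex_of_real (M$1$2) * pl 0"
     "pr 0 = complex_of_real (M$2$1) * yl 0 + complex_of_real (M$2$2) * pl 0"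
     "\<forall>x\<in>{-S..<0}. y x = yl x \<and> p x = pl x" "\<forall>x\<in>{0<..S}. y x = yr x \<and> p x = pr x"
    unfolding sl_solution_def by blast
  from assms(2) obtain Yl Pl Yr Pr where 2: "sl_pair (-S) 0 q z Yl Pl" "sl_pair 0 S q z Yr Pr"
     "Yr 0 = complex_of_real (M$1$1) * Yl 0 + complex_of_real (M$1$2) * Pl 0"
     "Pr 0 = complex_of_real (M$2$1) * Yl 0 + complex_of_real (M$2$2) * Pl 0"
     "\<forall>x\<in>{-S..<0}. Y x = Yl x \<and> P x = Pl x" "\<forall>x\<in>{0<..S}. Y x = Yr x \<and> P x = Pr x"
    unfolding sl_solution_def by blast
  have lin: "sl_pair a b q z (\<lambda>x. c * f x + d * F x) (\<lambda>x. c * g x + d * G x)"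
    if "sl_pair a b q z f g" "sl_pair a b q z F G" for a b f g F G
  proof -
    have "is_primitive a b (\<lambda>x. c * g x + d * G x)
        (\<lambda>x. c * ((complex_of_real (q x) - z) * f x) + d * ((complex_of_real (q x) - z) * F x))"
      using that unfolding sl_pair_def by (intro is_primitive_add is_primitive_scale) auto
    moreover have "is_primitive a b (\<lambda>x. c * f x + d * F x) (\<lambda>x. c * g x + d * G x)"
      using that unfolding sl_pair_def by (intro is_primitive_add is_primitive_scale) auto
    ultimately show ?thesis
      unfolding sl_pair_def by (simp add: algebra_simps)
  qed
  show ?thesis
    unfolding sl_solution_def
    by (rule exI[of _ "\<lambda>x. c * yl x + d * Yl x"], rule exI[of _ "\<lambda>x. c * pl x + d * Pl x"],
        rule exI[of _ "\<lambda>x. c * yr x + d * Yr x"], rule exI[of _ "\<lambda>x. c * pr x + d * Pr x"],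
        intro conjI lin 1(1,2) 2(1,2))
      (simp_all only: 1(3,4) 2(3,4), simp_all add: 1(5,6) 2(5,6) algebra_simps)
qed

lemma sl_solution_zero: "sl_solution S q M z (\<lambda>_. 0) (\<lambda>_. 0)"
proof -
  have "is_primitive a b (\<lambda>_. 0 :: complex) (\<lambda>_. 0)" for a b
    by (simp add: is_primitive_def)
  then have "sl_pair a b q z (\<lambda>_. 0) (\<lambda>_. 0)" for a b
    by (simp add: sl_pair_def)
  then show ?thesis
    unfolding sl_solution_def by (intro exI[of _ "\<lambda>_. 0"]) simp
qed

text \<open>\<open>q\<close> and \<open>M\<close> are real. This supplies the partner in Green's
  identity and the realness of \<open>w_sol\<close> at real parameters.\<close>

lemma sl_solution_cnj:
  assumes "sl_solution S q M z y p"
  shows "sl_solution S q M (cnj z) (\<lambda>x. cnj (y x)) (\<lambda>x. cnj (p x))"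
proof -
  from assms obtain yl pl yr pr where 1: "sl_pair (-S) 0 q z yl pl" "sl_pair 0 S q z yr pr"
     "yr 0 = complex_of_real (M$1$1) * yl 0 + complex_of_real (M$1$2) * pl 0"
     "pr 0 = complex_of_real (M$2$1) * yl 0 + complex_of_real (M$2$2) * pl 0"
     "\<forall>x\<in>{-S..<0}. y x = yl x \<and> p x = pl x" "\<forall>x\<in>{0<..S}. y x = yr x \<and> p x = pr x"
    unfolding sl_solution_def by blast
  have "sl_pair a b q (cnj z) (\<lambda>x. cnj (f x)) (\<lambda>x. cnj (g x))"
    if "sl_pair a b q z f g" for a b f g
    using that[unfolded sl_pair_def, THEN conjunct1, THEN is_primitive_cnj]
      that[unfolded sl_pair_def, THEN conjunct2, THEN is_primitive_cnj]
    unfolding sl_pair_def by simp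
  note this[OF 1(1)] this[OF 1(2)]
  then show ?thesis
    unfolding sl_solution_def
    by (intro exI[of _ "\<lambda>x. cnj (yl x)"] exI[of _ "\<lambda>x. cnj (pl x)"]
        exI[of _ "\<lambda>x. cnj (yr x)"] exI[of _ "\<lambda>x. cnj (pr x)"] conjI)
      (simp_all add: 1(3-6))
qed

lemma sl_pair_exists:
  assumes "a \<le> b" "q absolutely_integrable_on {a..b}"
  obtains y p where "sl_pair a b q z y p" "y b = c" "p b = d"
proof -
  have "(\<lambda>x. complex_of_real (q x) - z) absolutely_integrable_on {a..b}"
    using absolutely_integrable_potential_mult[OF assms(2), of "\<lambda>_. 1" z] by simp
  from linear_system_exists[OF assms(1) this] obtain y p where
    "is_primitive a b y p" "is_primitive a b p (\<lambda>x. (complex_of_real (q x) - z) * y x)" "y b = c" "p b = d" .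
  with that[of y p] show thesis
    unfolding sl_pair_def by blast
qed

section \<open>Lagrange identity, existence and uniqueness across the transfer point\<close>

locale sl_problem =
  fixes S :: real and q :: "real \<Rightarrow> real" and M :: "real^2^2"
  assumes S_pos: "S > 0" and q_sq: "square_integrable_on q {-S..S}" and det_M: "det M = 1"
begin

lemma q_int: "q absolutely_integrable_on {-S..S}"
  using q_sq by (rule square_integrable_on_imp_integrable)

lemma q_int_left: "q absolutely_integrable_on {-S..0}"
  and q_int_right: "q absolutely_integrable_on {0..S}"
  using S_pos by (auto intro: absolutely_integrable_on_subinterval[OF q_int])

abbreviation "sol \<equiv> sl_solution S q M"

abbreviation "m11 \<equiv> complex_of_real (M$1$1)"
abbreviation "m12 \<equiv> complex_of_real (M$1$2)"
abbreviation "m21 \<equiv> complex_of_real (M$2$1)"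
abbreviation "m22 \<equiv> complex_of_real (M$2$2)"

abbreviation "n11 \<equiv> \<bar>M$1$1\<bar>"
abbreviation "n12 \<equiv> \<bar>M$1$2\<bar>"
abbreviation "n21 \<equiv> \<bar>M$2$1\<bar>"
abbreviation "n22 \<equiv> \<bar>M$2$2\<bar>"

lemma det_M_complex: "m11 * m22 - m12 * m21 = 1"
  using arg_cong[OF det_M[unfolded det_2], of complex_of_real] by simp

text \<open>The potential drops out of the Lagrange integrand, leaving the parameter difference
  times \<open>y x * Y x\<close>.\<close>

lemma sl_pair_Lagrange:
  assumes "a \<le> b" "q absolutely_integrable_on {a..b}" and y: "sl_pair a b q z y p" and Y: "sl_pair a b q \<zeta> Y P"
  obtains I where "((\<lambda>x. y x * Y x) has_integral I) {a..b}"
    "(p b * Y b - y b * P b) - (p a * Y a - y a * P a) = (\<zeta> - z) * I"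
proof -
  note P = y[unfolded sl_pair_def, THEN conjunct1] y[unfolded sl_pair_def, THEN conjunct2]
     Y[unfolded sl_pair_def, THEN conjunct1] Y[unfolded sl_pair_def, THEN conjunct2]
  note c = is_primitive_continuous_on[OF P(1)] is_primitive_continuous_on[OF P(3)]
  have "((\<lambda>x. ((complex_of_real (q x) - z) * y x) * Y x - y x * ((complex_of_real (q x) - \<zeta>) * Y x)) has_integral
           (p b * Y b - y b * P b) - (p a * Y a - y a * P a)) {a..b}"
    by (rule Lagrange_identity[OF assms(1) P absolutely_integrable_potential_mult absolutely_integrable_potential_mult])
      (use c assms in auto)
  moreover have "(\<lambda>x. ((complex_of_real (q x) - z) * y x) * Y x - y x * ((complex_of_real (q x) - \<zeta>) * Y x)) =
      (\<lambda>x. (\<zeta> - z) * (y x * Y x))"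
    by (auto simp: algebra_simps)
  moreover have "(\<lambda>x. y x * Y x) integrable_on {a..b}"
    by (intro integrable_continuous_real continuous_intros c)
  then obtain I where I: "((\<lambda>x. y x * Y x) has_integral I) {a..b}" by blast
  ultimately show thesis
    using has_integral_unique[OF _ has_integral_mult_right[OF I, of "\<zeta> - z"]] that[OF I] by metis
qed

text \<open>The transfer matrix preserves the Wronskian because its determinant is 1.\<close>

lemma sol_Lagrange:
  assumes y: "sol z y p" and Y: "sol \<zeta> Y P"
  obtains I where "((\<lambda>x. y x * Y x) has_integral I) {-S..S}"
    "(p S * Y S - y S * P S) - (p (-S) * Y (-S) - y (-S) * P (-S)) = (\<zeta> - z) * I"
proof -
  from y obtain yl pl yr pr where 1: "sl_pair (-S) 0 q z yl pl" "sl_pair 0 S q z yr pr"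
     "yr 0 = m11 * yl 0 + m12 * pl 0"
     "pr 0 = m21 * yl 0 + m22 * pl 0"
     "\<forall>x\<in>{-S..<0}. y x = yl x \<and> p x = pl x" "\<forall>x\<in>{0<..S}. y x = yr x \<and> p x = pr x"
    unfolding sl_solution_def by blast
  from Y obtain Yl Pl Yr Pr where 2: "sl_pair (-S) 0 q \<zeta> Yl Pl" "sl_pair 0 S q \<zeta> Yr Pr"
     "Yr 0 = m11 * Yl 0 + m12 * Pl 0"
     "Pr 0 = m21 * Yl 0 + m22 * Pl 0"
     "\<forall>x\<in>{-S..<0}. Y x = Yl x \<and> P x = Pl x" "\<forall>x\<in>{0<..S}. Y x = Yr x \<and> P x = Pr x"
    unfolding sl_solution_def by blast
  obtain I1 where I1: "((\<lambda>x. yl x * Yl x) has_integral I1) {-S..0}"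
    "(pl 0 * Yl 0 - yl 0 * Pl 0) - (pl (-S) * Yl (-S) - yl (-S) * Pl (-S)) = (\<zeta> - z) * I1"
    using sl_pair_Lagrange[OF _ q_int_left 1(1) 2(1)] S_pos by auto
  obtain I2 where I2: "((\<lambda>x. yr x * Yr x) has_integral I2) {0..S}"
    "(pr S * Yr S - yr S * Pr S) - (pr 0 * Yr 0 - yr 0 * Pr 0) = (\<zeta> - z) * I2"
    using sl_pair_Lagrange[OF _ q_int_right 1(2) 2(2)] S_pos by auto
  have "pr 0 * Yr 0 - yr 0 * Pr 0 = (m11 * m22 - m12 * m21) * (pl 0 * Yl 0 - yl 0 * Pl 0)"
    unfolding 1(3,4) 2(3,4) by algebra
  then have W0: "pr 0 * Yr 0 - yr 0 * Pr 0 = pl 0 * Yl 0 - yl 0 * Pl 0"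
    by (simp add: det_M_complex)
  \<comment> \<open>\<open>y 0\<close> and \<open>Y 0\<close> are unconstrained, but a single point
    does not affect the integral.\<close>
  have J1: "((\<lambda>x. y x * Y x) has_integral I1) {-S..0}"
    by (rule has_integral_spike[OF negligible_sing[of 0] _ I1(1)]) (use 1 2 in auto)
  have J2: "((\<lambda>x. y x * Y x) has_integral I2) {0..S}"
    by (rule has_integral_spike[OF negligible_sing[of 0] _ I2(1)]) (use 1 2 in auto)
  show thesis
  proof (rule that[of "I1 + I2"])
    show "((\<lambda>x. y x * Y x) has_integral I1 + I2) {-S..S}"
      using S_pos by (intro has_integral_combine[OF _ _ J1 J2]) auto
    have ends: "y S = yr S" "p S = pr S" "Y S = Yr S" "P S = Pr S"
       "y (-S) = yl (-S)" "p (-S) = pl (-S)" "Y (-S) = Yl (-S)" "P (-S) = Pl (-S)"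
      using 1 2 S_pos by auto
    show "(p S * Y S - y S * P S) - (p (-S) * Y (-S) - y (-S) * P (-S)) = (\<zeta> - z) * (I1 + I2)"
      unfolding ends distrib_left I1(2)[symmetric] I2(2)[symmetric] W0 by simp
  qed
qed

text \<open>The equation is solved from \<open>S\<close> down to 0, the data cross with the inverse
  of \<open>M\<close>, which is its adjugate by \<open>det M = 1\<close>, and serve as end data for
  the left half.\<close>

lemma sol_exists_right:
  obtains y p where "sol z y p" "y S = c" "p S = d"
proof -
  obtain yr pr where r: "sl_pair 0 S q z yr pr" "yr S = c" "pr S = d"
    using sl_pair_exists[OF less_imp_le[OF S_pos] q_int_right] .
  have "-S \<le> 0" using S_pos by simp
  obtain yl pl where l: "sl_pair (-S) 0 q z yl pl"
     "yl 0 = m22 * yr 0 - m12 * pr 0"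
     "pl 0 = m11 * pr 0 - m21 * yr 0"
    using sl_pair_exists[OF \<open>-S \<le> 0\<close> q_int_left] .
  have "m11 * yl 0 + m12 * pl 0 =
     (m11 * m22 - m12 * m21) * yr 0"
    unfolding l by algebra
  moreover have "m21 * yl 0 + m22 * pl 0 =
     (m11 * m22 - m12 * m21) * pr 0"
    unfolding l by algebra
  ultimately have t: "yr 0 = m11 * yl 0 + m12 * pl 0"
     "pr 0 = m21 * yl 0 + m22 * pl 0"
    by (simp_all add: det_M_complex)
  show thesis
  proof (rule that[of "\<lambda>x. if x < 0 then yl x else yr x" "\<lambda>x. if x < 0 then pl x else pr x"])
    show "sol z (\<lambda>x. if x < 0 then yl x else yr x) (\<lambda>x. if x < 0 then pl x else pr x)"
      unfolding sl_solution_def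
      by (rule exI[of _ yl], rule exI[of _ pl], rule exI[of _ yr], rule exI[of _ pr])
        (intro conjI r(1) l(1) t, simp_all)
  qed (use S_pos r in auto)
qed

text \<open>Continuous dependence on end data and spectral parameter together, with a constant
  uniform over \<open>cmod \<zeta> \<le> R\<close>. Comparison with the zero solution gives
  uniqueness; equal data at \<open>S\<close> give Lipschitz dependence on the parameter.\<close>

lemma sol_diff_bound:
  obtains C where "0 \<le> C" and "\<And>\<zeta> z Y P y p B x. cmod \<zeta> \<le> R \<Longrightarrow> sol \<zeta> Y P \<Longrightarrow> sol z y p \<Longrightarrow>
    (\<And>x. x \<in> {-S..S} - {0} \<Longrightarrow> cmod (y x) \<le> B) \<Longrightarrow> x \<in> {-S..S} - {0} \<Longrightarrow>
    cmod (Y x - y x) + cmod (P x - p x) \<le> C * (cmod (Y S - y S) + cmod (P S - p S) + cmod (\<zeta> - z) * B)"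
proof -
  define \<kappa> where "\<kappa> t = \<bar>q t\<bar> + \<bar>R\<bar>" for t
  have ki: "\<kappa> absolutely_integrable_on {a..b}" if "q absolutely_integrable_on {a..b}" for a b
    unfolding \<kappa>_def using absolutely_integrable_norm[OF that]
    by (intro set_integral_add absolutely_integrable_on_const) (simp_all add: o_def lmeasurable_Icc)
  have kp: "0 \<le> \<kappa> t" for t by (simp add: \<kappa>_def)
  obtain Cr where Cr: "0 \<le> Cr" "\<And>y p r \<epsilon> x. is_primitive 0 S y p \<Longrightarrow> is_primitive 0 S p r \<Longrightarrow>
    (\<And>t. t \<in> {0..S} \<Longrightarrow> cmod (r t) \<le> \<kappa> t * cmod (y t) + \<epsilon>) \<Longrightarrow> 0 \<le> \<epsilon> \<Longrightarrow> x \<in> {0..S} \<Longrightarrow>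
    cmod (y x) + cmod (p x) \<le> Cr * (cmod (y S) + cmod (p S) + \<epsilon>)"
    using linear_system_bound[OF ki[OF q_int_right] kp] by blast
  obtain Cl where Cl: "0 \<le> Cl" "\<And>y p r \<epsilon> x. is_primitive (-S) 0 y p \<Longrightarrow> is_primitive (-S) 0 p r \<Longrightarrow>
    (\<And>t. t \<in> {-S..0} \<Longrightarrow> cmod (r t) \<le> \<kappa> t * cmod (y t) + \<epsilon>) \<Longrightarrow> 0 \<le> \<epsilon> \<Longrightarrow> x \<in> {-S..0} \<Longrightarrow>
    cmod (y x) + cmod (p x) \<le> Cl * (cmod (y 0) + cmod (p 0) + \<epsilon>)"
    using linear_system_bound[OF ki[OF q_int_left] kp] by blast
  define \<mu> where "\<mu> = n11 + n12 + n21 + n22"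
  have "\<mu> \<ge> 0" by (simp add: \<mu>_def)
  \<comment> \<open>The right half costs \<open>Cr\<close>, the inverse of \<open>M\<close> at most
    the sum \<open>\<mu>\<close> of the moduli of its entries, the left half \<open>Cl\<close>; the
    summand 1 carries the inhomogeneity of the left half.\<close>
  let ?C = "Cr + Cl * (\<mu> * Cr + 1)"
  show thesis
  proof (rule that[of ?C])
    show "0 \<le> ?C" using Cr(1) Cl(1) \<open>\<mu> \<ge> 0\<close> by simp
    fix \<zeta> z Y P y p B x
    assume \<zeta>: "cmod \<zeta> \<le> R" and Y: "sol \<zeta> Y P" and y: "sol z y p"
      and B: "\<And>x. x \<in> {-S..S} - {0} \<Longrightarrow> cmod (y x) \<le> B" and x: "x \<in> {-S..S} - {0}"
    have "0 \<le> B" using B[OF x] norm_ge_zero order_trans by blast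
    from y obtain yl pl yr pr where 1: "sl_pair (-S) 0 q z yl pl" "sl_pair 0 S q z yr pr"
       "yr 0 = m11 * yl 0 + m12 * pl 0"
       "pr 0 = m21 * yl 0 + m22 * pl 0"
       "\<forall>x\<in>{-S..<0}. y x = yl x \<and> p x = pl x" "\<forall>x\<in>{0<..S}. y x = yr x \<and> p x = pr x"
      unfolding sl_solution_def by blast
    from Y obtain Yl Pl Yr Pr where 2: "sl_pair (-S) 0 q \<zeta> Yl Pl" "sl_pair 0 S q \<zeta> Yr Pr"
       "Yr 0 = m11 * Yl 0 + m12 * Pl 0"
       "Pr 0 = m21 * Yl 0 + m22 * Pl 0"
       "\<forall>x\<in>{-S..<0}. Y x = Yl x \<and> P x = Pl x" "\<forall>x\<in>{0<..S}. Y x = Yr x \<and> P x = Pr x"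
      unfolding sl_solution_def by blast
    let ?\<epsilon> = "cmod (\<zeta> - z) * B"
    have e0: "0 \<le> ?\<epsilon>" using \<open>0 \<le> B\<close> by simp
    \<comment> \<open>The difference of the two solutions obeys the equation at
      \<open>\<zeta>\<close> with \<open>(z - \<zeta>) * f\<close> as inhomogeneity.\<close>
    have pw: "cmod ((complex_of_real (q t) - \<zeta>) * F - (complex_of_real (q t) - z) * f) \<le> \<kappa> t * cmod (F - f) + ?\<epsilon>"
      if "cmod f \<le> B" for t F f
    proof -
      have "(complex_of_real (q t) - \<zeta>) * F - (complex_of_real (q t) - z) * f =
         (complex_of_real (q t) - \<zeta>) * (F - f) + (z - \<zeta>) * f"
        by (simp add: algebra_simps)
      also have "cmod \<dots> \<le> cmod (complex_of_real (q t) - \<zeta>) * cmod (F - f) + cmod (z - \<zeta>) * cmod f"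
        by (metis norm_mult norm_triangle_ineq)
      also have "\<dots> \<le> \<kappa> t * cmod (F - f) + ?\<epsilon>"
      proof (intro add_mono mult_right_mono)
        have "cmod (complex_of_real (q t) - \<zeta>) \<le> \<bar>q t\<bar> + cmod \<zeta>"
          using norm_triangle_ineq4[of "complex_of_real (q t)" \<zeta>] by simp
        then show "cmod (complex_of_real (q t) - \<zeta>) \<le> \<kappa> t" using \<zeta> by (simp add: \<kappa>_def)
        show "cmod (z - \<zeta>) * cmod f \<le> ?\<epsilon>"
          unfolding norm_minus_commute[of z] using that by (intro mult_left_mono) auto
      qed auto
      finally show ?thesis .
    qed
    have cyl: "continuous_on {-S..0} yl" and cyr: "continuous_on {0..S} yr"
      using 1 unfolding sl_pair_def by (auto intro: is_primitive_continuous_on)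
    \<comment> \<open>The bound \<open>B\<close> is assumed off 0 only; continuity passes it on to
      the one-sided limits.\<close>
    have Bl: "cmod (yl t) \<le> B" if "t \<in> {-S..0}" for t
    proof (rule continuous_on_closure_norm_le[of "{-S..<0}"])
      show "\<forall>t\<in>{-S..<0}. cmod (yl t) \<le> B"
      proof
        fix t assume t: "t \<in> {-S..<0}"
        with B[of t] S_pos have "cmod (y t) \<le> B" by simp
        with t 1(5) show "cmod (yl t) \<le> B" by metis
      qed
    qed (use that cyl S_pos in auto)
    have Br: "cmod (yr t) \<le> B" if "t \<in> {0..S}" for t
    proof (rule continuous_on_closure_norm_le[of "{0<..S}"])
      show "\<forall>t\<in>{0<..S}. cmod (yr t) \<le> B"
      proof
        fix t assume t: "t \<in> {0<..S}"
        with B[of t] S_pos have "cmod (y t) \<le> B" by simp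
        with t 1(6) show "cmod (yr t) \<le> B" by metis
      qed
    qed (use that cyr S_pos in auto)
    note Pr = 2(2)[unfolded sl_pair_def, THEN conjunct1] 2(2)[unfolded sl_pair_def, THEN conjunct2]
      1(2)[unfolded sl_pair_def, THEN conjunct1] 1(2)[unfolded sl_pair_def, THEN conjunct2]
    note Pl = 2(1)[unfolded sl_pair_def, THEN conjunct1] 2(1)[unfolded sl_pair_def, THEN conjunct2]
      1(1)[unfolded sl_pair_def, THEN conjunct1] 1(1)[unfolded sl_pair_def, THEN conjunct2]
    let ?D = "cmod (Y S - y S) + cmod (P S - p S) + ?\<epsilon>"
    have r: "cmod (Yr t - yr t) + cmod (Pr t - pr t) \<le> Cr * ?D" if t: "t \<in> {0..S}" for t
    proof -
      have "cmod (Yr t - yr t) + cmod (Pr t - pr t) \<le> Cr * (cmod (Yr S - yr S) + cmod (Pr S - pr S) + ?\<epsilon>)"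
        by (rule Cr(2)[OF is_primitive_diff[OF Pr(1,3)] is_primitive_diff[OF Pr(2,4)] pw[OF Br] e0 t])
      then show ?thesis using 1(6) 2(6) S_pos by auto
    qed
    have inv: "m22 * (m11 * f + m12 * g) -
        m12 * (m21 * f + m22 * g) = f"
       "m11 * (m21 * f + m22 * g) -
        m21 * (m11 * f + m12 * g) = g" for f g
      using arg_cong[OF det_M_complex, of "\<lambda>t. t * f"] arg_cong[OF det_M_complex, of "\<lambda>t. t * g"]
      by (simp_all add: algebra_simps)
    note inv0 = inv[of "Yl 0" "Pl 0", folded 2(3,4)] inv[of "yl 0" "pl 0", folded 1(3,4)]
    have l0: "cmod (Yl 0 - yl 0) + cmod (Pl 0 - pl 0) \<le> \<mu> * (Cr * ?D)"
    proof -
      have "Yl 0 - yl 0 = m22 * (Yr 0 - yr 0) - m12 * (Pr 0 - pr 0)"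
        unfolding right_diff_distrib inv0(1,3)[symmetric] by simp
      then have a: "cmod (Yl 0 - yl 0) \<le> n22 * cmod (Yr 0 - yr 0) + n12 * cmod (Pr 0 - pr 0)"
        by (metis norm_mult norm_of_real norm_triangle_ineq4)
      have "Pl 0 - pl 0 = m11 * (Pr 0 - pr 0) - m21 * (Yr 0 - yr 0)"
        unfolding right_diff_distrib inv0(2,4)[symmetric] by simp
      then have b: "cmod (Pl 0 - pl 0) \<le> n11 * cmod (Pr 0 - pr 0) + n21 * cmod (Yr 0 - yr 0)"
        by (metis norm_mult norm_of_real norm_triangle_ineq4)
      have "cmod (Yl 0 - yl 0) + cmod (Pl 0 - pl 0) \<le> \<mu> * cmod (Yr 0 - yr 0) + \<mu> * cmod (Pr 0 - pr 0)"
      proof -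
        have eq: "\<mu> * u + \<mu> * v = (n22 * u + n12 * v) + (n11 * v + n21 * u) +
          ((n11 + n12) * u + (n21 + n22) * v)" for u v :: real
          by (simp add: \<mu>_def algebra_simps)
        have "0 \<le> (n11 + n12) * cmod (Yr 0 - yr 0) + (n21 + n22) * cmod (Pr 0 - pr 0)"
          by simp
        then show ?thesis using a b eq[of "cmod (Yr 0 - yr 0)" "cmod (Pr 0 - pr 0)"] by linarith
      qed
      also have "\<dots> \<le> \<mu> * (Cr * ?D)"
        using r[of 0] S_pos \<open>\<mu> \<ge> 0\<close> unfolding distrib_left[symmetric] by (intro mult_left_mono) auto
      finally show ?thesis .
    qed
    have l: "cmod (Yl t - yl t) + cmod (Pl t - pl t) \<le> Cl * (\<mu> * Cr + 1) * ?D" if t: "t \<in> {-S..0}" for t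
    proof -
      have "cmod (Yl t - yl t) + cmod (Pl t - pl t) \<le> Cl * (cmod (Yl 0 - yl 0) + cmod (Pl 0 - pl 0) + ?\<epsilon>)"
        by (rule Cl(2)[OF is_primitive_diff[OF Pl(1,3)] is_primitive_diff[OF Pl(2,4)] pw[OF Bl] e0 t])
      also have "\<dots> \<le> Cl * (\<mu> * (Cr * ?D) + ?D)"
        using l0 Cl(1) by (intro mult_left_mono add_mono) auto
      finally show ?thesis by (simp add: algebra_simps)
    qed
    have D0: "0 \<le> ?D" using e0 by simp
    have CC: "Cr * ?D \<le> ?C * ?D" "Cl * (\<mu> * Cr + 1) * ?D \<le> ?C * ?D"
      using D0 Cr(1) Cl(1) \<open>\<mu> \<ge> 0\<close> by (auto intro!: mult_right_mono)
    note yYl = 1(5) 2(5) and yYr = 1(6) 2(6)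
    from x consider "x \<in> {-S..<0}" | "x \<in> {0<..S}" by (cases "x < 0") auto
    then show "cmod (Y x - y x) + cmod (P x - p x) \<le> ?C * ?D"
    proof cases
      case 1
      then have eq: "y x = yl x" "p x = pl x" "Y x = Yl x" "P x = Pl x"
        using yYl by blast+
      from 1 have "x \<in> {-S..0}" by simp
      from order_trans[OF l[OF this] CC(2)] show ?thesis unfolding eq .
    next
      case 2
      then have eq: "y x = yr x" "p x = pr x" "Y x = Yr x" "P x = Pr x"
        using yYr by blast+
      from 2 have "x \<in> {0..S}" by simp
      from order_trans[OF r[OF this] CC(1)] show ?thesis unfolding eq .
    qed
  qed
qed

lemma ends: "-S \<in> {-S..S} - {0}" "S \<in> {-S..S} - {0}"
  using S_pos by auto

text \<open>Compare with the zero solution at the same parameter, taking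
  \<open>B = 0\<close>.\<close>

lemma sol_zero_right:
  assumes "sol z y p" "y S = 0" "p S = 0" "x \<in> {-S..S} - {0}"
  shows "y x = 0" "p x = 0"
proof -
  obtain C where "0 \<le> C" and C: "\<And>\<zeta> z' Y P y p B x. cmod \<zeta> \<le> cmod z \<Longrightarrow> sol \<zeta> Y P \<Longrightarrow> sol z' y p \<Longrightarrow>
    (\<And>x. x \<in> {-S..S} - {0} \<Longrightarrow> cmod (y x) \<le> B) \<Longrightarrow> x \<in> {-S..S} - {0} \<Longrightarrow>
    cmod (Y x - y x) + cmod (P x - p x) \<le> C * (cmod (Y S - y S) + cmod (P S - p S) + cmod (\<zeta> - z') * B)"
    by (rule sol_diff_bound[of "cmod z"]) blast
  have "cmod (y x - 0) + cmod (p x - 0) \<le> C * (cmod (y S - 0) + cmod (p S - 0) + cmod (z - z) * 0)"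
    by (rule C[OF order_refl assms(1) sl_solution_zero _ assms(4)]) simp
  then have "cmod (y x) + cmod (p x) \<le> 0" using assms by simp
  then show "y x = 0" "p x = 0"
    by (smt (verit) norm_ge_zero zero_less_norm_iff)+
qed

lemma fundamental_system:
  obtains y1 p1 y2 p2 where "sol z y1 p1" "sol z y2 p2" "y1 S = 1" "p1 S = 0" "y2 S = 0" "p2 S = 1"
    "y1 (-S) * p2 (-S) - p1 (-S) * y2 (-S) = 1"
proof -
  obtain y1 p1 where 1: "sol z y1 p1" "y1 S = 1" "p1 S = 0" by (rule sol_exists_right)
  obtain y2 p2 where 2: "sol z y2 p2" "y2 S = 0" "p2 S = 1" by (rule sol_exists_right)
  from sol_Lagrange[OF 1(1) 2(1)] obtain I where
    "(p1 S * y2 S - y1 S * p2 S) - (p1 (-S) * y2 (-S) - y1 (-S) * p2 (-S)) = (z - z) * I" .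
  with 1 2 have "y1 (-S) * p2 (-S) - p1 (-S) * y2 (-S) = 1"
    by (simp add: algebra_simps)
  with 1 2 that show thesis by blast
qed

text \<open>Cramer's rule: the Wronskian of the fundamental system is still 1 at \<open>-S\<close>,
  so any data there are matched without a second existence proof starting from the left.\<close>

lemma sol_exists_left:
  obtains y p where "sol z y p" "y (-S) = c" "p (-S) = d"
proof -
  obtain y1 p1 y2 p2 where f: "sol z y1 p1" "sol z y2 p2"
    "y1 (-S) * p2 (-S) - p1 (-S) * y2 (-S) = 1"
    by (rule fundamental_system)
  let ?a = "c * p2 (-S) - d * y2 (-S)" and ?b = "d * y1 (-S) - c * p1 (-S)"
  have "?a * y1 (-S) + ?b * y2 (-S) = c * (y1 (-S) * p2 (-S) - p1 (-S) * y2 (-S))"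
    "?a * p1 (-S) + ?b * p2 (-S) = d * (y1 (-S) * p2 (-S) - p1 (-S) * y2 (-S))"
    by algebra+
  then show thesis
    by (intro that[OF sl_solution_lincomb[OF f(1,2), of ?a ?b]]) (simp_all only: f(3) mult_1_right)
qed

text \<open>Wronskians with the fundamental system agree at both ends. They vanish at
  \<open>-S\<close>, and at \<open>S\<close> they are, up to sign, the data of
  \<open>y\<close>.\<close>

lemma sol_zero_left:
  assumes y: "sol z y p" and "y (-S) = 0" "p (-S) = 0" "x \<in> {-S..S} - {0}"
  shows "y x = 0" "p x = 0"
proof -
  obtain y1 p1 y2 p2 where f: "sol z y1 p1" "sol z y2 p2" "y1 S = 1" "p1 S = 0" "y2 S = 0" "p2 S = 1"
    by (rule fundamental_system)
  from sol_Lagrange[OF y f(1)] obtain I where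
    "(p S * y1 S - y S * p1 S) - (p (-S) * y1 (-S) - y (-S) * p1 (-S)) = (z - z) * I" .
  then have pS: "p S = 0" using assms f by simp
  from sol_Lagrange[OF y f(2)] obtain I where
    "(p S * y2 S - y S * p2 S) - (p (-S) * y2 (-S) - y (-S) * p2 (-S)) = (z - z) * I" .
  then have "y S = 0" using assms f by simp
  from sol_zero_right[OF y this pS assms(4)] show "y x = 0" "p x = 0" .
qed

lemma sol_unique_left:
  assumes "sol z y p" "sol z Y P" "y (-S) = c * Y (-S)" "p (-S) = c * P (-S)" "x \<in> {-S..S} - {0}"
  shows "y x = c * Y x"
  using sol_zero_left(1)[OF sl_solution_lincomb[OF assms(1,2), of 1 "-c"]] assms by simp

lemma sol_imp_is_solution:
  assumes "sol z y p"
  shows "is_solution S q M z y" "dX S y (-S) = p (-S)" "dX S y S = p S"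
  using sl_solution_imp_is_solution[OF S_pos q_int assms] ends by blast+

lemma is_solution_imp_sol: "is_solution S q M z y \<Longrightarrow> sol z y (dX S y)"
  by (rule is_solution_imp_sl_solution[OF S_pos q_int])

lemma v_sol:
  "sol z (v_sol S q M \<beta> z) (dX S (v_sol S q M \<beta> z))"
  "v_sol S q M \<beta> z S = complex_of_real (sin \<beta>)" "dX S (v_sol S q M \<beta> z) S = complex_of_real (cos \<beta>)"
proof -
  let ?P = "\<lambda>y. is_solution S q M z y \<and> y S = complex_of_real (sin \<beta>) \<and> dX S y S = complex_of_real (cos \<beta>)"
  obtain y p where "sol z y p" "y S = complex_of_real (sin \<beta>)" "p S = complex_of_real (cos \<beta>)"
    by (rule sol_exists_right)
  then have "?P y" by (simp add: sol_imp_is_solution)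
  then have "?P (v_sol S q M \<beta> z)" unfolding v_sol_def by (rule someI[of ?P])
  then show "sol z (v_sol S q M \<beta> z) (dX S (v_sol S q M \<beta> z))"
    "v_sol S q M \<beta> z S = complex_of_real (sin \<beta>)" "dX S (v_sol S q M \<beta> z) S = complex_of_real (cos \<beta>)"
    by (simp_all add: is_solution_imp_sol)
qed

lemma w_sol:
  "sol z (w_sol S q M \<alpha> z) (dX S (w_sol S q M \<alpha> z))"
  "w_sol S q M \<alpha> z (-S) = complex_of_real (sin \<alpha>)" "dX S (w_sol S q M \<alpha> z) (-S) = complex_of_real (cos \<alpha>)"
proof -
  let ?P = "\<lambda>y. is_solution S q M z y \<and> y (-S) = complex_of_real (sin \<alpha>) \<and> dX S y (-S) = complex_of_real (cos \<alpha>)"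
  obtain y p where "sol z y p" "y (-S) = complex_of_real (sin \<alpha>)" "p (-S) = complex_of_real (cos \<alpha>)"
    by (rule sol_exists_left)
  then have "?P y" by (simp add: sol_imp_is_solution)
  then have "?P (w_sol S q M \<alpha> z)" unfolding w_sol_def by (rule someI[of ?P])
  then show "sol z (w_sol S q M \<alpha> z) (dX S (w_sol S q M \<alpha> z))"
    "w_sol S q M \<alpha> z (-S) = complex_of_real (sin \<alpha>)" "dX S (w_sol S q M \<alpha> z) (-S) = complex_of_real (cos \<alpha>)"
    by (simp_all add: is_solution_imp_sol)
qed

section \<open>Holomorphic dependence on the spectral parameter\<close>

lemma v_sol_Lipschitz:
  obtains C where "0 \<le> C" "\<And>\<zeta> x. cmod (\<zeta> - z) \<le> 1 \<Longrightarrow> x \<in> {-S..S} - {0} \<Longrightarrow>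
    cmod (v_sol S q M \<beta> \<zeta> x - v_sol S q M \<beta> z x) \<le> C * cmod (\<zeta> - z)"
proof -
  obtain C where "0 \<le> C" and C: "\<And>\<zeta> z' Y P y p B x. cmod \<zeta> \<le> cmod z + 1 \<Longrightarrow> sol \<zeta> Y P \<Longrightarrow> sol z' y p \<Longrightarrow>
    (\<And>x. x \<in> {-S..S} - {0} \<Longrightarrow> cmod (y x) \<le> B) \<Longrightarrow> x \<in> {-S..S} - {0} \<Longrightarrow>
    cmod (Y x - y x) + cmod (P x - p x) \<le> C * (cmod (Y S - y S) + cmod (P S - p S) + cmod (\<zeta> - z') * B)"
    by (rule sol_diff_bound[of "cmod z + 1"]) blast
  obtain B where "0 \<le> B" and B: "\<And>x. x \<in> {-S..S} - {0} \<Longrightarrow> cmod (v_sol S q M \<beta> z x) \<le> B"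
    using sl_solution_bounded[OF v_sol(1)] by blast
  show thesis
  proof (rule that[of "C * B"])
    show "0 \<le> C * B" using \<open>0 \<le> C\<close> \<open>0 \<le> B\<close> by simp
    fix \<zeta> x assume \<zeta>: "cmod (\<zeta> - z) \<le> 1" and x: "x \<in> {-S..S} - {0}"
    have "cmod \<zeta> \<le> cmod z + 1" using \<zeta> norm_triangle_sub[of \<zeta> z] by simp
    from C[OF this v_sol(1) v_sol(1) B x, of \<beta>]
    have "cmod (v_sol S q M \<beta> \<zeta> x - v_sol S q M \<beta> z x) \<le> C * (cmod (\<zeta> - z) * B)"
      unfolding v_sol(2,3) using norm_ge_zero order_trans
      by (smt (verit) diff_self norm_zero)
    then show "cmod (v_sol S q M \<beta> \<zeta> x - v_sol S q M \<beta> z x) \<le> C * B * cmod (\<zeta> - z)"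
      by (simp add: mult_ac)
  qed
qed

text \<open>Only \<open>v_sol\<close> varies with \<open>\<zeta>\<close>, while
  \<open>\<phi>\<close> stays a solution at \<open>z\<close>. As the data of \<open>v_sol\<close> at
  \<open>S\<close> are independent of \<open>\<zeta>\<close>, Lagrange's identity writes the
  Wronskian at \<open>-S\<close> as a constant plus \<open>(\<zeta> - z)\<close> times the integral
  of \<open>v_sol\<close> against \<open>\<phi>\<close>. Continuity of that integral at
  \<open>z\<close> is all that complex differentiability demands. Suitable data for
  \<open>\<phi>\<close> turn the Wronskian into \<open>Delta\<close> or into the numerator of the
  m-function.\<close>

lemma Wronskian_v_sol_has_derivative:
  assumes \<phi>: "sol z \<phi> \<phi>'"
  obtains I where "((\<lambda>x. v_sol S q M \<beta> z x * \<phi> x) has_integral I) {-S..S}"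
    "((\<lambda>\<zeta>. dX S (v_sol S q M \<beta> \<zeta>) (-S) * \<phi> (-S) - v_sol S q M \<beta> \<zeta> (-S) * \<phi>' (-S))
       has_field_derivative I) (at z)"
proof -
  let ?v = "v_sol S q M \<beta>"
  let ?W = "\<lambda>\<zeta>. dX S (?v \<zeta>) (-S) * \<phi> (-S) - ?v \<zeta> (-S) * \<phi>' (-S)"
  define W0 where "W0 = complex_of_real (cos \<beta>) * \<phi> S - complex_of_real (sin \<beta>) * \<phi>' S"
  have "\<exists>I. ((\<lambda>x. ?v \<zeta> x * \<phi> x) has_integral I) {-S..S} \<and> ?W \<zeta> = W0 + (\<zeta> - z) * I" for \<zeta>
  proof -
    from sol_Lagrange[OF v_sol(1)[of \<zeta> \<beta>] \<phi>] obtain I where I: "((\<lambda>x. ?v \<zeta> x * \<phi> x) has_integral I) {-S..S}"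
      "(dX S (?v \<zeta>) S * \<phi> S - ?v \<zeta> S * \<phi>' S) - ?W \<zeta> = (z - \<zeta>) * I" .
    from I(2) have "?W \<zeta> = W0 + (\<zeta> - z) * I"
      unfolding v_sol(2,3) W0_def by (simp add: algebra_simps)
    with I(1) show ?thesis by blast
  qed
  then obtain I where I: "\<And>\<zeta>. ((\<lambda>x. ?v \<zeta> x * \<phi> x) has_integral I \<zeta>) {-S..S}" "\<And>\<zeta>. ?W \<zeta> = W0 + (\<zeta> - z) * I \<zeta>"
    by metis
  obtain C where "0 \<le> C" and C: "\<And>\<zeta> x. cmod (\<zeta> - z) \<le> 1 \<Longrightarrow> x \<in> {-S..S} - {0} \<Longrightarrow>
    cmod (?v \<zeta> x - ?v z x) \<le> C * cmod (\<zeta> - z)"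
    using v_sol_Lipschitz by blast
  obtain B where "0 \<le> B" and B: "\<And>x. x \<in> {-S..S} - {0} \<Longrightarrow> cmod (\<phi> x) \<le> B"
    using sl_solution_bounded[OF \<phi>] by blast
  have le: "cmod (I \<zeta> - I z) \<le> (C * B * (2 * S)) * cmod (\<zeta> - z)" if \<zeta>: "cmod (\<zeta> - z) \<le> 1" for \<zeta>
  proof -
    \<comment> \<open>The uniform bounds on \<open>v_sol\<close> and \<open>\<phi>\<close> say
      nothing at 0, so the integrand is redefined there.\<close>
    let ?f = "\<lambda>x. if x = 0 then 0 else ?v \<zeta> x * \<phi> x - ?v z x * \<phi> x"
    have "((\<lambda>x. ?v \<zeta> x * \<phi> x - ?v z x * \<phi> x) has_integral I \<zeta> - I z) {-S..S}"
      by (intro has_integral_diff I(1))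
    then have "(?f has_integral I \<zeta> - I z) (cbox (-S) S)"
      unfolding box_real by (rule has_integral_spike[OF negligible_sing[of 0], rotated]) auto
    then have "cmod (I \<zeta> - I z) \<le> (C * cmod (\<zeta> - z) * B) * measure lborel (cbox (-S) S)"
    proof (rule has_integral_bound[rotated])
      show "0 \<le> C * cmod (\<zeta> - z) * B" using \<open>0 \<le> C\<close> \<open>0 \<le> B\<close> by simp
      fix x assume x: "x \<in> cbox (-S) S"
      show "cmod (?f x) \<le> C * cmod (\<zeta> - z) * B"
      proof (cases "x = 0")
        case False
        with x have x: "x \<in> {-S..S} - {0}" by simp
        have "cmod (?f x) = cmod (?v \<zeta> x - ?v z x) * cmod (\<phi> x)"
          using False by (simp flip: left_diff_distrib norm_mult)
        also have "\<dots> \<le> C * cmod (\<zeta> - z) * B"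
          using \<open>0 \<le> C\<close> by (intro mult_mono C[OF \<zeta> x] B[OF x]) auto
        finally show ?thesis .
      qed (use \<open>0 \<le> C\<close> \<open>0 \<le> B\<close> in simp)
    qed
    then show ?thesis using S_pos by (simp add: mult_ac)
  qed
  have "(I \<longlongrightarrow> I z) (at z)"
  proof (rule Lim_null_comparison[of "\<lambda>\<zeta>. I \<zeta> - I z" "\<lambda>\<zeta>. (C * B * (2 * S)) * cmod (\<zeta> - z)", THEN LIM_zero_cancel])
    have "\<forall>\<^sub>F \<zeta> in at z. cmod (\<zeta> - z) < 1"
      using eventually_at_ball[of 1 z UNIV] by (simp add: dist_norm norm_minus_commute)
    then show "\<forall>\<^sub>F \<zeta> in at z. cmod (I \<zeta> - I z) \<le> (C * B * (2 * S)) * cmod (\<zeta> - z)"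
      by eventually_elim (rule le, simp)
    show "((\<lambda>\<zeta>. (C * B * (2 * S)) * cmod (\<zeta> - z)) \<longlongrightarrow> 0) (at z)"
      by (auto intro!: tendsto_eq_intros)
  qed
  then have "((\<lambda>\<zeta>. (?W \<zeta> - ?W z) / (\<zeta> - z)) \<longlongrightarrow> I z) (at z)"
  proof (rule Lim_transform_eventually)
    show "\<forall>\<^sub>F \<zeta> in at z. I \<zeta> = (?W \<zeta> - ?W z) / (\<zeta> - z)"
      unfolding I(2) by (auto simp: eventually_at_filter)
  qed
  then have "(?W has_field_derivative I z) (at z)"
    by (simp add: has_field_derivative_iff)
  with I(1) that show thesis by blast
qed

section \<open>The Titchmarsh-Weyl function\<close>

lemma Delta_holomorphic: "Delta S \<alpha> q M \<beta> holomorphic_on UNIV"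
  unfolding holomorphic_on_open[OF open_UNIV]
proof
  fix z :: complex
  show "\<exists>D. (Delta S \<alpha> q M \<beta> has_field_derivative D) (at z)"
    using Wronskian_v_sol_has_derivative[OF w_sol(1)[of z \<alpha>], of \<beta>]
    unfolding w_sol(2,3) Delta_def[symmetric] by blast
qed

definition m_numerator :: "real \<Rightarrow> real \<Rightarrow> complex \<Rightarrow> complex" where
  "m_numerator \<alpha> \<beta> z = v_sol S q M \<beta> z (-S) * complex_of_real (sin \<alpha>)
      + dX S (v_sol S q M \<beta> z) (-S) * complex_of_real (cos \<alpha>)"

lemma m_numerator_holomorphic: "m_numerator \<alpha> \<beta> holomorphic_on UNIV"
  unfolding holomorphic_on_open[OF open_UNIV]
proof
  fix z :: complex
  \<comment> \<open>Data orthogonal to those of \<open>w_sol\<close>; the Wronskian with them is the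
    numerator.\<close>
  obtain \<phi> \<phi>' where \<phi>: "sol z \<phi> \<phi>'" "\<phi> (-S) = complex_of_real (cos \<alpha>)" "\<phi>' (-S) = - complex_of_real (sin \<alpha>)"
    by (rule sol_exists_left)
  obtain I where "((\<lambda>\<zeta>. dX S (v_sol S q M \<beta> \<zeta>) (-S) * \<phi> (-S) - v_sol S q M \<beta> \<zeta> (-S) * \<phi>' (-S))
       has_field_derivative I) (at z)"
    by (rule Wronskian_v_sol_has_derivative[OF \<phi>(1), of \<beta>])
  moreover have "(\<lambda>\<zeta>. dX S (v_sol S q M \<beta> \<zeta>) (-S) * \<phi> (-S) - v_sol S q M \<beta> \<zeta> (-S) * \<phi>' (-S)) = m_numerator \<alpha> \<beta>"
    by (simp add: \<phi> m_numerator_def fun_eq_iff)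
  ultimately show "\<exists>D. (m_numerator \<alpha> \<beta> has_field_derivative D) (at z)" by auto
qed

lemma tw_m_eq: "tw_m S \<alpha> q M \<beta> z = m_numerator \<alpha> \<beta> z / Delta S \<alpha> q M \<beta> z"
  by (simp add: tw_m_def m_numerator_def)

lemma tw_m_meromorphic: "tw_m S \<alpha> q M \<beta> meromorphic_on UNIV"
proof -
  have "m_numerator \<alpha> \<beta> meromorphic_on UNIV" "Delta S \<alpha> q M \<beta> meromorphic_on UNIV"
    using m_numerator_holomorphic Delta_holomorphic
    by (auto intro!: analytic_on_imp_meromorphic_on simp: analytic_on_open)
  then have "(\<lambda>z. m_numerator \<alpha> \<beta> z / Delta S \<alpha> q M \<beta> z) meromorphic_on UNIV"
    by (rule meromorphic_on_divide)
  then show ?thesis by (simp add: tw_m_eq[abs_def])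
qed

lemma v_sol_left_nonzero: "v_sol S q M \<beta> z (-S) \<noteq> 0 \<or> dX S (v_sol S q M \<beta> z) (-S) \<noteq> 0"
proof (rule ccontr)
  assume "\<not> ?thesis"
  then have "v_sol S q M \<beta> z S = 0" "dX S (v_sol S q M \<beta> z) S = 0"
    using sol_zero_left[OF v_sol(1)[of z \<beta>] _ _ ends(2)] by auto
  then have "sin \<beta> = 0" "cos \<beta> = 0" unfolding v_sol(2,3) by simp_all
  then show False using sin_cos_squared_add[of \<beta>] by simp
qed

text \<open>A zero of \<open>Delta\<close> means that the data of \<open>v_sol\<close> at
  \<open>-S\<close> are parallel to the unit vector of sin \<alpha> and cos \<alpha>, the data of
  \<open>w_sol\<close>. The numerator is their scalar product with this vector, hence the
  factor.\<close>

lemma v_sol_eq_w_sol: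
  assumes "sin \<alpha> > 0" and D: "Delta S \<alpha> q M \<beta> z = 0"
  shows "m_numerator \<alpha> \<beta> z \<noteq> 0"
    and "x \<in> {-S..S} - {0} \<Longrightarrow> v_sol S q M \<beta> z x = m_numerator \<alpha> \<beta> z * w_sol S q M \<alpha> z x"
proof -
  let ?s = "complex_of_real (sin \<alpha>)" and ?c = "complex_of_real (cos \<alpha>)"
  let ?v = "v_sol S q M \<beta> z (-S)" and ?p = "dX S (v_sol S q M \<beta> z) (-S)"
  let ?k = "m_numerator \<alpha> \<beta> z"
  have sc: "?s * ?s + ?c * ?c = 1"
    using arg_cong[OF sin_cos_squared_add[of \<alpha>], of complex_of_real] by (simp add: power2_eq_square)
  have D0: "?p * ?s = ?v * ?c" using D by (simp add: Delta_def)
  have "?k * ?s = ?v * (?s * ?s) + (?p * ?s) * ?c" "?k * ?c = (?v * ?c) * ?s + ?p * (?c * ?c)"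
    by (simp_all add: m_numerator_def algebra_simps)
  then have "?k * ?s = ?v * (?s * ?s) + (?v * ?c) * ?c" "?k * ?c = (?p * ?s) * ?s + ?p * (?c * ?c)"
    unfolding D0 .
  then have "?k * ?s = ?v * (?s * ?s + ?c * ?c)" "?k * ?c = ?p * (?s * ?s + ?c * ?c)"
    by (simp_all only: distrib_left mult.assoc)
  then have k: "?v = ?k * ?s" "?p = ?k * ?c" by (simp_all add: sc)
  show "?k \<noteq> 0" using v_sol_left_nonzero[of \<beta> z] k by auto
  show "v_sol S q M \<beta> z x = ?k * w_sol S q M \<alpha> z x" if "x \<in> {-S..S} - {0}"
    by (rule sol_unique_left[OF v_sol(1) w_sol(1) _ _ that]) (simp_all only: w_sol k)
qed

text \<open>At a zero, \<open>v_sol\<close> itself is an eigenfunction. Conversely the data of an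
  eigenfunction at \<open>-S\<close> are a nonzero multiple of those of \<open>w_sol\<close>, and
  its Wronskian with \<open>v_sol\<close> vanishes at \<open>S\<close>, hence also at
  \<open>-S\<close>, where it is that multiple of \<open>Delta\<close>.\<close>

lemma Delta_eq_0_iff:
  assumes "sin \<alpha> > 0"
  shows "Delta S \<alpha> q M \<beta> z = 0 \<longleftrightarrow> z \<in> eigenvalues S \<alpha> q M \<beta>"
proof
  assume D: "Delta S \<alpha> q M \<beta> z = 0"
  note v = v_sol(1)[of z \<beta>] v_sol(2,3)
  have "\<exists>x\<in>{-S..S} - {0}. v_sol S q M \<beta> z x \<noteq> 0"
  proof (rule bexI[OF _ ends(1)])
    show "v_sol S q M \<beta> z (-S) \<noteq> 0"
    proof
      assume "v_sol S q M \<beta> z (-S) = 0"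
      with D assms have "dX S (v_sol S q M \<beta> z) (-S) = 0" by (simp add: Delta_def)
      with \<open>v_sol S q M \<beta> z (-S) = 0\<close> v_sol_left_nonzero show False by blast
    qed
  qed
  moreover have "is_solution S q M z (v_sol S q M \<beta> z)" by (rule sol_imp_is_solution(1)[OF v(1)])
  ultimately show "z \<in> eigenvalues S \<alpha> q M \<beta>"
    using D unfolding eigenvalues_def Delta_def by (auto simp: v(2,3) intro!: exI[of _ "v_sol S q M \<beta> z"])
next
  let ?s = "complex_of_real (sin \<alpha>)" and ?c = "complex_of_real (cos \<alpha>)"
  assume "z \<in> eigenvalues S \<alpha> q M \<beta>"
  then obtain y x where y: "is_solution S q M z y" "x \<in> {-S..S} - {0}" "y x \<noteq> 0"
     "y (-S) * ?c - dX S y (-S) * ?s = 0"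
     "y S * complex_of_real (cos \<beta>) - dX S y S * complex_of_real (sin \<beta>) = 0"
    unfolding eigenvalues_def by blast
  note ys = is_solution_imp_sol[OF y(1)]
  define k where "k = y (-S) / ?s"
  have k: "y (-S) = k * ?s" "dX S y (-S) = k * ?c"
    using y(4) assms by (auto simp: k_def field_simps)
  have "k \<noteq> 0"
    using sol_zero_left(1)[OF ys _ _ y(2)] y(3) k by auto
  let ?v = "v_sol S q M \<beta> z"
  obtain I where "(dX S ?v S * y S - ?v S * dX S y S) - (dX S ?v (-S) * y (-S) - ?v (-S) * dX S y (-S)) = (z - z) * I"
    using sol_Lagrange[OF v_sol(1) ys] by blast
  then have "dX S ?v (-S) * y (-S) - ?v (-S) * dX S y (-S) = 0"
    using y(5) by (simp add: v_sol(2,3) algebra_simps)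
  then have "k * Delta S \<alpha> q M \<beta> z = 0"
    unfolding k Delta_def by (simp add: algebra_simps)
  then show "Delta S \<alpha> q M \<beta> z = 0" using \<open>k \<noteq> 0\<close> by simp
qed

section \<open>Green's identity and norming constants\<close>

text \<open>Lagrange's identity for a solution and its conjugate, whose parameters differ by a
  multiple of \<open>Im z\<close>.\<close>

lemma sol_norm_has_integral:
  assumes "sol z y p"
  obtains I where "((\<lambda>x. (cmod (y x))\<^sup>2) has_integral I) {-S..S}" "0 \<le> I"
    "Im (p S * cnj (y S)) - Im (p (-S) * cnj (y (-S))) = - Im z * I"
proof -
  obtain J where J: "((\<lambda>x. y x * cnj (y x)) has_integral J) {-S..S}"
    "(p S * cnj (y S) - y S * cnj (p S)) - (p (-S) * cnj (y (-S)) - y (-S) * cnj (p (-S))) = (cnj z - z) * J"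
    using sol_Lagrange[OF assms sl_solution_cnj[OF assms]] by blast
  have J': "((\<lambda>x. complex_of_real ((cmod (y x))\<^sup>2)) has_integral J) {-S..S}"
    using J(1) by (simp only: complex_norm_square)
  then have I: "((\<lambda>x. (cmod (y x))\<^sup>2) has_integral Re J) {-S..S}"
     "((\<lambda>x. 0) has_integral Im J) {-S..S}"
    using has_integral_linear[OF J' bounded_linear_Re] has_integral_linear[OF J' bounded_linear_Im]
    by (simp_all add: o_def)
  have "Im J = 0" using has_integral_unique[OF I(2) has_integral_0] .
  moreover have "0 \<le> Re J" using has_integral_nonneg[OF I(1)] by simp
  moreover have "Im (p S * cnj (y S)) - Im (p (-S) * cnj (y (-S))) = - Im z * Re J"
  proof -
    have "(u - cnj u) - (v - cnj v) = (cnj z - z) * J \<Longrightarrow> Im u - Im v = - Im z * Re J" for u v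
      using \<open>Im J = 0\<close> by (simp add: complex_eq_iff)
    from this[of "p S * cnj (y S)" "p (-S) * cnj (y (-S))"] J(2) show ?thesis
      by (simp only: complex_cnj_mult complex_cnj_cnj mult.commute)
  qed
  ultimately show thesis using that I(1) by blast
qed

text \<open>\<open>norming_constant\<close> is a Lebesgue integral, whereas Lagrange's identity
  speaks of gauge integrals. The two agree because the squared modulus is integrable as
  well.\<close>

lemma norming_constant_has_integral:
  "((\<lambda>x. w_sol S q M \<alpha> (complex_of_real l) x * w_sol S q M \<alpha> (complex_of_real l) x)
     has_integral norming_constant S \<alpha> q M l) {-S..S}"
proof -
  let ?w = "w_sol S q M \<alpha> (complex_of_real l)"
  obtain I where I: "((\<lambda>x. ?w x * ?w x) has_integral I) {-S..S}"
    using sol_Lagrange[OF w_sol(1) w_sol(1)] by blast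
  obtain J where "((\<lambda>x. (cmod (?w x))\<^sup>2) has_integral J) {-S..S}"
    using sol_norm_has_integral[OF w_sol(1)] by blast
  then have "(\<lambda>x. cmod (?w x * ?w x)) integrable_on {-S..S}"
    by (auto simp: norm_mult power2_eq_square)
  with I have "(\<lambda>x. ?w x * ?w x) absolutely_integrable_on {-S..S}"
    by (auto simp: absolutely_integrable_on_def)
  from set_lebesgue_integral_eq_integral(2)[OF this]
  have "norming_constant S \<alpha> q M l = integral {-S..S} (\<lambda>x. ?w x * ?w x)"
    by (simp add: norming_constant_def power2_eq_square)
  with I show ?thesis by (simp add: integral_unique)
qed

text \<open>At a real parameter uniqueness makes \<open>w_sol\<close> real, so its square is its
  squared modulus. A vanishing integral would force \<open>w_sol\<close> to vanish on the left half,
  against its value sin \<alpha> at \<open>-S\<close>.\<close>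

lemma norming_constant_nonzero:
  assumes "sin \<alpha> > 0"
  shows "norming_constant S \<alpha> q M l \<noteq> 0"
proof
  assume 0: "norming_constant S \<alpha> q M l = 0"
  let ?w = "w_sol S q M \<alpha> (complex_of_real l)"
  note w = w_sol(1)[of "complex_of_real l" \<alpha>] w_sol(2,3)[of \<alpha> "complex_of_real l"]
  have real: "cnj (?w x) = ?w x" if x: "x \<in> {-S..S} - {0}" for x
    using sol_unique_left[OF sl_solution_cnj[OF w(1)] _ _ _ x, of ?w "dX S ?w" 1] w by simp
  have "((\<lambda>x. ?w x * ?w x) has_integral 0) {-S..S}"
    using norming_constant_has_integral[of \<alpha> l] 0 by simp
  then have "((\<lambda>x. complex_of_real ((cmod (?w x))\<^sup>2)) has_integral 0) {-S..S}"
  proof (rule has_integral_spike[OF negligible_sing[of 0], rotated])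
    fix x assume "x \<in> {-S..S} - {0}"
    from real[OF this] show "complex_of_real ((cmod (?w x))\<^sup>2) = ?w x * ?w x"
      unfolding complex_norm_square by simp
  qed
  from has_integral_linear[OF this bounded_linear_Re]
  have I: "((\<lambda>x. (cmod (?w x))\<^sup>2) has_integral 0) {-S..S}" by (simp add: o_def)
  from w(1) obtain yl pl where l: "sl_pair (-S) 0 q (complex_of_real l) yl pl" "\<forall>x\<in>{-S..<0}. ?w x = yl x"
    unfolding sl_solution_def by blast
  have c: "continuous_on {-S..0} (\<lambda>x. (cmod (yl x))\<^sup>2)"
    using l(1) unfolding sl_pair_def by (intro continuous_intros is_primitive_continuous_on) auto
  have i: "(\<lambda>x. (cmod (?w x))\<^sup>2) integrable_on {-S..0}"
    using I S_pos by (intro integrable_on_subinterval[OF has_integral_integrable[OF I]]) auto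
  have "integral {-S..0} (\<lambda>x. (cmod (?w x))\<^sup>2) \<le> integral {-S..S} (\<lambda>x. (cmod (?w x))\<^sup>2)"
    using S_pos I i by (intro integral_subset_le) auto
  moreover have "0 \<le> integral {-S..0} (\<lambda>x. (cmod (?w x))\<^sup>2)"
    using i by (intro integral_nonneg) auto
  ultimately have "integral {-S..0} (\<lambda>x. (cmod (?w x))\<^sup>2) = 0"
    using integral_unique[OF I] by linarith
  then have "((\<lambda>x. (cmod (?w x))\<^sup>2) has_integral 0) {-S..0}"
    using integrable_integral[OF i] by metis
  then have "((\<lambda>x. (cmod (yl x))\<^sup>2) has_integral 0) {-S..0}"
    by (rule has_integral_spike[OF negligible_sing[of 0], rotated]) (use l in auto)
  then have "(cmod (yl (-S)))\<^sup>2 = 0"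
    using has_integral_0_cbox_imp_0[of "-S" 0 "\<lambda>x. (cmod (yl x))\<^sup>2" "-S"] c S_pos by simp
  then have "?w (-S) = 0" using l(2) S_pos by simp
  with w(2) assms show False by simp
qed

lemma Delta_has_derivative_at_zero:
  assumes "sin \<alpha> > 0" and D: "Delta S \<alpha> q M \<beta> (complex_of_real l) = 0"
  shows "(Delta S \<alpha> q M \<beta> has_field_derivative
     m_numerator \<alpha> \<beta> (complex_of_real l) * norming_constant S \<alpha> q M l) (at (complex_of_real l))"
proof -
  let ?z = "complex_of_real l"
  let ?w = "w_sol S q M \<alpha> ?z" and ?v = "v_sol S q M \<beta> ?z" and ?k = "m_numerator \<alpha> \<beta> ?z"
  obtain I where I: "((\<lambda>x. ?v x * ?w x) has_integral I) {-S..S}"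
      "(Delta S \<alpha> q M \<beta> has_field_derivative I) (at ?z)"
    using Wronskian_v_sol_has_derivative[OF w_sol(1)[of ?z \<alpha>], of \<beta>]
    unfolding w_sol(2,3) Delta_def[symmetric] by blast
  have "((\<lambda>x. ?k * (?w x * ?w x)) has_integral ?k * norming_constant S \<alpha> q M l) {-S..S}"
    by (intro has_integral_mult_right norming_constant_has_integral)
  then have "((\<lambda>x. ?v x * ?w x) has_integral ?k * norming_constant S \<alpha> q M l) {-S..S}"
    by (rule has_integral_spike[OF negligible_sing[of 0], rotated])
      (simp add: v_sol_eq_w_sol(2)[OF assms])
  with I show ?thesis using has_integral_unique by metis
qed

section \<open>Growth of the m-function off the real axis\<close>

text \<open>
  The Green identity bounds \<open>\<bar>Im z\<bar>\<close> times the squared \<open>L\<^sup>2\<close> norm of \<open>v\<close> by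
  \<open>|v(-S)| |\<Delta>(z)| / sin \<alpha>\<close>. Testing the equation against \<open>\<theta>(x) = (x + S) (1 - (x + S) / d)\<^sup>2\<close>
  on \<open>[-S, -S + d]\<close> expresses \<open>v(-S)\<close> as an integral of \<open>v\<close>, and the two bounds combine.
\<close>

lemma v_sol_left_bound:
  assumes s: "sin \<alpha> > 0" and D: "Delta S \<alpha> q M \<beta> z \<noteq> 0" and d: "0 < d" "d \<le> S" and Im: "Im z \<noteq> 0"
  shows "cmod (v_sol S q M \<beta> z (-S)) * \<bar>Im z\<bar> * sin \<alpha> \<le>
    3 * (d\<^sup>2 * integral {-S..S} (\<lambda>x. (q x)\<^sup>2) + (cmod z)\<^sup>2 * d ^ 3 + 16 / d) * cmod (Delta S \<alpha> q M \<beta> z)"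
proof -
  let ?s = "complex_of_real (sin \<alpha>)" and ?c = "complex_of_real (cos \<alpha>)"
  let ?v = "v_sol S q M \<beta> z" let ?p = "dX S ?v" let ?D = "Delta S \<alpha> q M \<beta> z"
  let ?Q = "integral {-S..S} (\<lambda>x. (q x)\<^sup>2)"
  let ?B = "3 * (d\<^sup>2 * ?Q + (cmod z)\<^sup>2 * d ^ 3 + 16 / d)"
  define v0 where "v0 = ?v (-S)"
  obtain n where n: "((\<lambda>x. (cmod (?v x))\<^sup>2) has_integral n) {-S..S}" "0 \<le> n"
    "Im (?p S * cnj (?v S)) - Im (?p (-S) * cnj (?v (-S))) = - Im z * n"
    by (rule sol_norm_has_integral[OF v_sol(1)])
  have Im_eq: "a * complex_of_real s = b + complex_of_real r \<Longrightarrow> Im a * s = Im b" for a b s r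
    by (drule arg_cong[of _ _ Im]) simp
  \<comment> \<open>The boundary term at \<open>S\<close> has no imaginary part, the data there
    being real.\<close>
  have "Im (?p (-S) * cnj v0) = Im z * n"
    using n(3) by (simp add: v_sol(2,3) v0_def)
  moreover have "?p (-S) * ?s = ?D + v0 * ?c" by (simp add: Delta_def v0_def)
  then have "(?p (-S) * cnj v0) * ?s = ?D * cnj v0 + complex_of_real ((cmod v0)\<^sup>2 * cos \<alpha>)"
    unfolding of_real_mult complex_norm_square by (simp add: algebra_simps)
  then have "Im (?p (-S) * cnj v0) * sin \<alpha> = Im (?D * cnj v0)"
    by (rule Im_eq)
  ultimately have "Im z * n * sin \<alpha> = Im (?D * cnj v0)" by simp
  then have "\<bar>Im z\<bar> * n * sin \<alpha> = \<bar>Im (?D * cnj v0)\<bar>"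
    using s n(2) by (metis abs_mult abs_of_nonneg abs_of_pos)
  also have "\<dots> \<le> cmod ?D * cmod v0"
    using abs_Im_le_cmod[of "?D * cnj v0"] by (simp add: norm_mult)
  finally have n_le: "\<bar>Im z\<bar> * n * sin \<alpha> \<le> cmod ?D * cmod v0" .
  from v_sol(1)[of z \<beta>] obtain yl pl where l: "sl_pair (-S) 0 q z yl pl" "\<forall>x\<in>{-S..<0}. ?v x = yl x \<and> ?p x = pl x"
    unfolding sl_solution_def by blast
  have v0: "v0 = yl (-S)" using l(2) S_pos by (simp add: v0_def)
  let ?e = "-S + d"
  \<comment> \<open>\<open>\<theta>\<close> vanishes at \<open>-S\<close> with slope 1 and has a
    double zero at \<open>-S + d\<close>, so \<open>v0\<close> is the only boundary term left;
    \<open>\<theta>1\<close> and \<open>\<theta>2\<close> are its derivatives.\<close>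
  define \<theta> where "\<theta> x = (x + S) * (1 - (x + S) / d)\<^sup>2" for x
  define \<theta>1 where "\<theta>1 x = (1 - (x + S) / d) * (1 - 3 * (x + S) / d)" for x
  define \<theta>2 where "\<theta>2 x = (6 * (x + S) / d - 4) / d" for x
  have d\<theta>: "((\<lambda>x. complex_of_real (\<theta> x)) has_vector_derivative complex_of_real (\<theta>1 x)) (at x within A)"
    "((\<lambda>x. complex_of_real (\<theta>1 x)) has_vector_derivative complex_of_real (\<theta>2 x)) (at x within A)" for x A
  proof -
    have "(\<theta> has_real_derivative \<theta>1 x) (at x within A)"
      unfolding \<theta>_def \<theta>1_def using d by (auto intro!: derivative_eq_intros simp: field_simps power2_eq_square)
    then show "((\<lambda>x. complex_of_real (\<theta> x)) has_vector_derivative complex_of_real (\<theta>1 x)) (at x within A)"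
      by (simp add: has_real_derivative_iff_has_vector_derivative has_vector_derivative_of_real)
    have "(\<theta>1 has_real_derivative \<theta>2 x) (at x within A)"
      unfolding \<theta>2_def \<theta>1_def using d by (auto intro!: derivative_eq_intros simp: field_simps power2_eq_square)
    then show "((\<lambda>x. complex_of_real (\<theta>1 x)) has_vector_derivative complex_of_real (\<theta>2 x)) (at x within A)"
      by (simp add: has_real_derivative_iff_has_vector_derivative has_vector_derivative_of_real)
  qed
  have sub: "{-S..?e} \<subseteq> {-S..0}" "{-S..?e} \<subseteq> {-S..S}" using d by auto
  have y: "is_primitive (-S) ?e yl pl" "is_primitive (-S) ?e pl (\<lambda>x. (complex_of_real (q x) - z) * yl x)"
    using l(1) d unfolding sl_pair_def by (auto intro: is_primitive_subinterval)
  have qi: "q absolutely_integrable_on {-S..?e}"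
    by (rule absolutely_integrable_on_subinterval[OF q_int sub(2)])
  have cy: "continuous_on {-S..?e} yl" by (rule is_primitive_continuous_on[OF y(1)])
  let ?f = "\<lambda>x. (complex_of_real (q x) - z) * yl x * complex_of_real (\<theta> x) - yl x * complex_of_real (\<theta>2 x)"
  have "(?f has_integral
     (pl ?e * complex_of_real (\<theta> ?e) - yl ?e * complex_of_real (\<theta>1 ?e)) -
     (pl (-S) * complex_of_real (\<theta> (-S)) - yl (-S) * complex_of_real (\<theta>1 (-S)))) {-S..?e}"
  proof (rule Lagrange_identity[OF _ y])
    show "is_primitive (-S) ?e (\<lambda>x. complex_of_real (\<theta> x)) (\<lambda>x. complex_of_real (\<theta>1 x))"
      "is_primitive (-S) ?e (\<lambda>x. complex_of_real (\<theta>1 x)) (\<lambda>x. complex_of_real (\<theta>2 x))"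
      by (intro is_primitiveI_derivative d\<theta>)+
    show "(\<lambda>x. complex_of_real (\<theta>2 x)) absolutely_integrable_on {-S..?e}"
      unfolding \<theta>2_def using d by (intro absolutely_integrable_continuous_real continuous_intros) auto
    show "(\<lambda>x. (complex_of_real (q x) - z) * yl x) absolutely_integrable_on {-S..?e}"
      by (rule absolutely_integrable_potential_mult[OF qi cy])
  qed (use d in simp)
  then have f: "(?f has_integral v0) {-S..?e}"
    using d by (simp add: \<theta>_def \<theta>1_def v0)
  \<comment> \<open>The weight for which Green's identity reads
    \<open>t * n \<le> cmod v0\<close>.\<close>
  define t where "t = \<bar>Im z\<bar> * sin \<alpha> / cmod ?D"
  have t: "t > 0" using s D Im by (simp add: t_def)
  \<comment> \<open>Young's inequality with weight \<open>t\<close> separates \<open>yl\<close> from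
    its coefficient. That coefficient has three parts, from \<open>q\<close>, from \<open>z\<close>
    and from \<open>\<theta>2\<close>; squaring them separately costs the factor 3, and 16 is the
    square of the 4 in the bound \<open>4 / d\<close> for \<open>\<theta>2\<close>.\<close>
  define g where "g x = t / 2 * (cmod (yl x))\<^sup>2 + (3 * (d\<^sup>2 * (q x)\<^sup>2 + (cmod z)\<^sup>2 * d\<^sup>2 + 16 / d\<^sup>2)) / (2 * t)" for x
  have fg: "cmod (?f x) \<le> g x" if x: "x \<in> {-S..?e}" for x
  proof -
    define r where "r = (x + S) / d"
    have r: "0 \<le> r" "r \<le> 1" using x d by (auto simp: r_def)
    have xr: "x + S = d * r" using d by (simp add: r_def)
    have "\<theta> x = d * (r * (1 - r)\<^sup>2)" using d by (simp add: \<theta>_def xr)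
    moreover have "r * (1 - r)\<^sup>2 \<le> 1"
      using r by (intro mult_le_one power_le_one) auto
    ultimately have \<theta>: "0 \<le> \<theta> x" "\<theta> x \<le> d"
      using r d mult_left_le[of "r * (1 - r)\<^sup>2" d] by auto
    have "\<theta>2 x = (6 * r - 4) / d" using d by (simp add: \<theta>2_def r_def)
    then have \<theta>2: "\<bar>\<theta>2 x\<bar> \<le> 4 / d"
      using r d by (auto simp: abs_le_iff intro!: divide_right_mono simp flip: minus_divide_left)
    have "cmod (?f x) \<le> cmod ((complex_of_real (q x) - z) * yl x * complex_of_real (\<theta> x)) + cmod (yl x * complex_of_real (\<theta>2 x))"
      by (rule norm_triangle_ineq4)
    also have "\<dots> = cmod (yl x) * (cmod (complex_of_real (q x) - z) * \<theta> x + \<bar>\<theta>2 x\<bar>)"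
      using \<theta>(1) by (simp only: norm_mult norm_of_real abs_of_nonneg distrib_left mult_ac)
    also have "\<dots> \<le> cmod (yl x) * ((\<bar>q x\<bar> + cmod z) * d + 4 / d)"
      using \<theta> \<theta>2 norm_triangle_ineq4[of "complex_of_real (q x)" z]
      by (intro mult_left_mono add_mono mult_mono) auto
    also have "\<dots> \<le> g x"
    proof -
      define A where "A = (\<bar>q x\<bar> + cmod z) * d + 4 / d"
      have "0 \<le> (t * cmod (yl x) - A)\<^sup>2" by simp
      then have "2 * t * (cmod (yl x) * A) \<le> t\<^sup>2 * (cmod (yl x))\<^sup>2 + A\<^sup>2"
        by (simp add: power2_diff power_mult_distrib mult_ac)
      then have 1: "cmod (yl x) * A \<le> t / 2 * (cmod (yl x))\<^sup>2 + A\<^sup>2 / (2 * t)"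
        using t by (simp add: field_simps power2_eq_square)
      have "(a + b + c)\<^sup>2 \<le> 3 * (a\<^sup>2 + b\<^sup>2 + c\<^sup>2)" for a b c :: real
        using zero_le_power2[of "a - b"] zero_le_power2[of "a - c"] zero_le_power2[of "b - c"]
        by (simp add: power2_eq_square algebra_simps)
      from this[of "\<bar>q x\<bar> * d" "cmod z * d" "4 / d"]
      have "A\<^sup>2 \<le> 3 * (d\<^sup>2 * (q x)\<^sup>2 + (cmod z)\<^sup>2 * d\<^sup>2 + 16 / d\<^sup>2)"
        by (simp add: A_def algebra_simps power_mult_distrib power_divide)
      then have "A\<^sup>2 / (2 * t) \<le> (3 * (d\<^sup>2 * (q x)\<^sup>2 + (cmod z)\<^sup>2 * d\<^sup>2 + 16 / d\<^sup>2)) / (2 * t)"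
        using t by (intro divide_right_mono) auto
      with 1 show ?thesis unfolding g_def A_def by linarith
    qed
    finally show ?thesis .
  qed
  define n1 where "n1 = integral {-S..?e} (\<lambda>x. (cmod (?v x))\<^sup>2)"
  have vi: "(\<lambda>x. (cmod (?v x))\<^sup>2) integrable_on {-S..?e}"
    using n(1) sub(2) by (auto intro: integrable_on_subinterval)
  have "n1 \<le> n"
    unfolding n1_def integral_unique[OF n(1), symmetric]
    using n(1) by (intro integral_subset_le sub vi) auto
  have "((\<lambda>x. (cmod (?v x))\<^sup>2) has_integral n1) {-S..?e}"
    unfolding n1_def by (rule integrable_integral[OF vi])
  then have n1: "((\<lambda>x. (cmod (yl x))\<^sup>2) has_integral n1) {-S..?e}"
    by (rule has_integral_spike[OF negligible_sing[of 0], rotated]) (use l(2) d in auto)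
  have q2: "(\<lambda>x. (q x)\<^sup>2) integrable_on {-S..S}"
    by (rule square_integrable_on_imp_integrable(1)[OF q_sq])
  define Q1 where "Q1 = integral {-S..?e} (\<lambda>x. (q x)\<^sup>2)"
  have q2': "(\<lambda>x. (q x)\<^sup>2) integrable_on {-S..?e}"
    using q2 sub(2) by (rule integrable_on_subinterval)
  have "Q1 \<le> ?Q" unfolding Q1_def using sub(2) q2 q2' by (intro integral_subset_le) auto
  have Q1: "((\<lambda>x. (q x)\<^sup>2) has_integral Q1) {-S..?e}" unfolding Q1_def by (rule integrable_integral[OF q2'])
  have const: "((\<lambda>x. C) has_integral d * C) {-S..?e}" for C :: real
    using has_integral_const_real[of C "-S" ?e] d by simp
  have "(g has_integral t / 2 * n1 + (3 * (d\<^sup>2 * Q1 + d * ((cmod z)\<^sup>2 * d\<^sup>2) + d * (16 / d\<^sup>2))) / (2 * t)) {-S..?e}"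
    unfolding g_def by (intro has_integral_add has_integral_mult_right has_integral_divide n1 Q1 const)
  then have "norm (integral {-S..?e} ?f) \<le> t / 2 * n1 + (3 * (d\<^sup>2 * Q1 + d * ((cmod z)\<^sup>2 * d\<^sup>2) + d * (16 / d\<^sup>2))) / (2 * t)"
    using integral_norm_bound_integral[of ?f "{-S..?e}" g] f fg by (auto simp: integral_unique)
  then have "cmod v0 \<le> t / 2 * n1 + (3 * (d\<^sup>2 * Q1 + d * ((cmod z)\<^sup>2 * d\<^sup>2) + d * (16 / d\<^sup>2))) / (2 * t)"
    using f by (simp add: integral_unique)
  also have "\<dots> \<le> t / 2 * n + ?B / (2 * t)"
  proof (rule add_mono)
    show "t / 2 * n1 \<le> t / 2 * n" using t \<open>n1 \<le> n\<close> by simp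
    have 1: "d\<^sup>2 * Q1 \<le> d\<^sup>2 * ?Q" using \<open>Q1 \<le> ?Q\<close> by (intro mult_left_mono) auto
    have 2: "d * ((cmod z)\<^sup>2 * d\<^sup>2) = (cmod z)\<^sup>2 * d ^ 3" by (simp add: power2_eq_square power3_eq_cube)
    have 3: "d * (16 / d\<^sup>2) = 16 / d" using d by (simp add: power2_eq_square)
    have "3 * (d\<^sup>2 * Q1 + d * ((cmod z)\<^sup>2 * d\<^sup>2) + d * (16 / d\<^sup>2)) \<le> ?B"
      unfolding 2 3 by (rule mult_left_mono[OF add_right_mono[OF add_right_mono[OF 1]]]) simp
    then show "3 * (d\<^sup>2 * Q1 + d * ((cmod z)\<^sup>2 * d\<^sup>2) + d * (16 / d\<^sup>2)) / (2 * t) \<le> ?B / (2 * t)"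
      using t by (intro divide_right_mono) auto
  qed
  finally have 1: "cmod v0 \<le> t / 2 * n + ?B / (2 * t)" .
  have "t * n \<le> cmod v0"
    using n_le D by (simp add: t_def field_simps)
  \<comment> \<open>Since \<open>t * n \<le> v\<close>, the first term is at most half of
    \<open>v\<close> and moves to the left-hand side.\<close>
  have absorb: "v * t \<le> B" if "v \<le> t / 2 * n + B / (2 * t)" "t * n \<le> v" for v B
  proof -
    have "v \<le> v / 2 + B / (2 * t)" using that by simp
    then have "v * (2 * t) \<le> (v / 2 + B / (2 * t)) * (2 * t)"
      using t by (intro mult_right_mono) auto
    also have "\<dots> = v * t + B" using t by (simp add: distrib_right)
    finally show ?thesis by (simp add: mult_ac)
  qed
  have "cmod v0 * t \<le> ?B" by (rule absorb[OF 1 \<open>t * n \<le> cmod v0\<close>])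
  then have "cmod v0 * (t * cmod ?D) \<le> ?B * cmod ?D"
    unfolding mult.assoc[symmetric] by (rule mult_right_mono) simp
  moreover have "t * cmod ?D = \<bar>Im z\<bar> * sin \<alpha>" using D by (simp add: t_def)
  ultimately show ?thesis by (simp add: v0_def mult.assoc)
qed

end

section \<open>A vanishing criterion for entire functions\<close>

lemma norm_diff_squares_on_sphere:
  assumes "cmod z = R"
  shows "cmod (z\<^sup>2 - (complex_of_real R)\<^sup>2) = 2 * R * \<bar>Im z\<bar>"
proof -
  have "(complex_of_real R)\<^sup>2 = z * cnj z"
    using complex_norm_square[of z] assms by simp
  then have "z\<^sup>2 - (complex_of_real R)\<^sup>2 = z * (z - cnj z)"
    by (simp add: power2_eq_square right_diff_distrib)
  also have "z - cnj z = 2 * \<i> * complex_of_real (Im z)"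
    by (simp add: complex_eq_iff)
  finally show ?thesis using assms by (simp add: norm_mult)
qed

text \<open>
  Multiplying by \<open>z\<^sup>2 - R\<^sup>2\<close>, whose modulus on the circle \<open>|z| = R\<close> is \<open>2 R \<bar>Im z\<bar>\<close>,
  turns a bound that degenerates at the real axis into a uniform one.
\<close>

lemma entire_eq_0_if_bounded_off_real_axis:
  assumes F: "F holomorphic_on UNIV"
    and bound: "\<And>z. R0 \<le> cmod z \<Longrightarrow> Im z \<noteq> 0 \<Longrightarrow> cmod (F z) * \<bar>Im z\<bar> \<le> C * sqrt (cmod z)"
  shows "F \<xi> = 0"
proof -
  \<comment> \<open>On the circle the product is at most
    \<open>2 * R * (\<bar>C\<bar> * sqrt R)\<close>, and \<open>R \<ge> 2 * cmod \<xi>\<close> keeps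
    the multiplier at \<open>\<xi>\<close> above \<open>R\<^sup>2 / 2\<close> in modulus; the
    quotient is the stated bound.\<close>
  have ev: "cmod (F \<xi>) \<le> 4 * \<bar>C\<bar> / sqrt R" if R: "R \<ge> R0" "R \<ge> 1" "R \<ge> 2 * cmod \<xi>" for R
  proof -
    let ?G = "\<lambda>z. F z * (z\<^sup>2 - (complex_of_real R)\<^sup>2)"
    have "R > 0" using R by simp
    have G: "?G holomorphic_on A" for A
      by (intro holomorphic_intros holomorphic_on_subset[OF F]) auto
    have sphere: "cmod (?G z) \<le> 2 * R * (\<bar>C\<bar> * sqrt R)" if z: "cmod z = R" for z
    proof -
      have "cmod (F z) * \<bar>Im z\<bar> \<le> \<bar>C\<bar> * sqrt R"
      \<comment> \<open>At the two real points of the circle \<open>bound\<close> is silent, but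
        there the left-hand side is 0.\<close>
      proof (cases "Im z = 0")
        case False
        with bound[of z] z R have "cmod (F z) * \<bar>Im z\<bar> \<le> C * sqrt R" by simp
        also have "\<dots> \<le> \<bar>C\<bar> * sqrt R" using \<open>R > 0\<close> by (intro mult_right_mono) auto
        finally show ?thesis .
      qed (use \<open>R > 0\<close> in simp)
      then have "2 * R * (cmod (F z) * \<bar>Im z\<bar>) \<le> 2 * R * (\<bar>C\<bar> * sqrt R)"
        using \<open>R > 0\<close> by (intro mult_left_mono) auto
      then show ?thesis
        by (simp add: norm_mult norm_diff_squares_on_sphere[OF z] mult_ac)
    qed
    have "cmod (?G \<xi>) \<le> 2 * R * (\<bar>C\<bar> * sqrt R)"
    proof (rule maximum_modulus_frontier[of ?G "cball 0 R"])
      show "?G holomorphic_on interior (cball 0 R)" by (rule G)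
      show "continuous_on (closure (cball 0 R)) ?G" by (rule holomorphic_on_imp_continuous_on[OF G])
      have "cmod \<xi> \<le> R" using R(3) norm_ge_zero[of \<xi>] by linarith
      then show "\<xi> \<in> cball 0 R" by simp
      show "cmod (?G z) \<le> 2 * R * (\<bar>C\<bar> * sqrt R)" if "z \<in> frontier (cball 0 R)" for z
        using that by (intro sphere) auto
    qed auto
    moreover have "R\<^sup>2 / 2 \<le> cmod (\<xi>\<^sup>2 - (complex_of_real R)\<^sup>2)"
    proof -
      have "(cmod \<xi>)\<^sup>2 \<le> (R / 2)\<^sup>2" using R(3) by (intro power_mono) auto
      then have "(cmod \<xi>)\<^sup>2 \<le> R\<^sup>2 / 4" by (simp add: power_divide)
      then have "R\<^sup>2 / 2 \<le> R\<^sup>2 - (cmod \<xi>)\<^sup>2"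
        using zero_le_power2[of R] by linarith
      also have "\<dots> \<le> cmod ((complex_of_real R)\<^sup>2 - \<xi>\<^sup>2)"
        using norm_triangle_ineq2[of "(complex_of_real R)\<^sup>2" "\<xi>\<^sup>2"] by (simp add: norm_power)
      finally show ?thesis by (simp add: norm_minus_commute)
    qed
    ultimately have "cmod (F \<xi>) * (R\<^sup>2 / 2) \<le> 2 * R * (\<bar>C\<bar> * sqrt R)"
      unfolding norm_mult by (meson mult_left_mono norm_ge_zero order_trans)
    moreover have "(R * sqrt R) * (cmod (F \<xi>) * sqrt R) = 2 * (cmod (F \<xi>) * (R\<^sup>2 / 2))"
    proof -
      have "(R * sqrt R) * (cmod (F \<xi>) * sqrt R) = cmod (F \<xi>) * (R * (sqrt R * sqrt R))"
        by (simp only: mult_ac)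
      also have "R * (sqrt R * sqrt R) = R\<^sup>2" using \<open>R > 0\<close> by (simp add: power2_eq_square)
      finally show ?thesis by simp
    qed
    moreover have "(R * sqrt R) * (4 * \<bar>C\<bar>) = 2 * (2 * R * (\<bar>C\<bar> * sqrt R))" by simp
    ultimately have "(R * sqrt R) * (cmod (F \<xi>) * sqrt R) \<le> (R * sqrt R) * (4 * \<bar>C\<bar>)"
      by linarith
    then have "cmod (F \<xi>) * sqrt R \<le> 4 * \<bar>C\<bar>"
      using \<open>R > 0\<close> by (subst (asm) mult_le_cancel_left_pos) auto
    then show ?thesis using \<open>R > 0\<close> by (simp add: le_divide_eq)
  qed
  have "((\<lambda>R. 4 * \<bar>C\<bar> / sqrt R) \<longlongrightarrow> 0) at_top"
    by (intro tendsto_divide_0[OF tendsto_const] filterlim_at_top_imp_at_infinity sqrt_at_top)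
  then have "cmod (F \<xi>) \<le> 0"
  proof (rule tendsto_lowerbound)
    show "\<forall>\<^sub>F R in at_top. cmod (F \<xi>) \<le> 4 * \<bar>C\<bar> / sqrt R"
      using eventually_ge_at_top[of R0] eventually_ge_at_top[of 1] eventually_ge_at_top[of "2 * cmod \<xi>"]
      by eventually_elim (rule ev)
  qed simp
  then show ?thesis by simp
qed

lemma has_field_derivative_zero_quotient:
  assumes "(f has_field_derivative D) (at z)" "f z = 0"
  shows "((\<lambda>w. f w / (w - z)) \<longlongrightarrow> D) (at z)"
  using assms by (simp add: has_field_derivative_iff)

context sl_problem
begin

text \<open>Subtracting cot \<alpha> eliminates the derivative of \<open>v_sol\<close> at
  \<open>-S\<close> and leaves the quotient controlled by \<open>v_sol_left_bound\<close>.\<close>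

lemma tw_m_minus_cot:
  assumes "sin \<alpha> > 0" and D: "Delta S \<alpha> q M \<beta> z \<noteq> 0"
  shows "tw_m S \<alpha> q M \<beta> z - complex_of_real (cos \<alpha> / sin \<alpha>) =
    v_sol S q M \<beta> z (-S) / (complex_of_real (sin \<alpha>) * Delta S \<alpha> q M \<beta> z)"
proof -
  let ?s = "complex_of_real (sin \<alpha>)" and ?c = "complex_of_real (cos \<alpha>)"
  have sc: "?s * ?s + ?c * ?c = 1"
    using arg_cong[OF sin_cos_squared_add[of \<alpha>], of complex_of_real] by (simp add: power2_eq_square)
  have s0: "?s \<noteq> 0" using assms by simp
  have "m_numerator \<alpha> \<beta> z * ?s - ?c * Delta S \<alpha> q M \<beta> z = v_sol S q M \<beta> z (-S) * (?s * ?s + ?c * ?c)"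
    by (simp add: m_numerator_def Delta_def algebra_simps)
  then have "m_numerator \<alpha> \<beta> z * ?s - ?c * Delta S \<alpha> q M \<beta> z = v_sol S q M \<beta> z (-S)"
    by (simp add: sc)
  moreover have "tw_m S \<alpha> q M \<beta> z - complex_of_real (cos \<alpha> / sin \<alpha>) =
     (m_numerator \<alpha> \<beta> z * ?s - ?c * Delta S \<alpha> q M \<beta> z) / (?s * Delta S \<alpha> q M \<beta> z)"
    using s0 D by (simp add: tw_m_eq diff_divide_distrib)
  ultimately show ?thesis by simp
qed

text \<open>The length \<open>d = 1 / sqrt (cmod z)\<close> balances the terms with
  \<open>d ^ 3\<close> and \<open>1 / d\<close>: both become multiples of
  \<open>sqrt (cmod z)\<close>, and 17 is 1 + 16. The second condition on \<open>z\<close> says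
  \<open>d \<le> S\<close>. One factor sin \<alpha> in the denominator comes from Green's identity,
  the other from \<open>tw_m_minus_cot\<close>.\<close>

lemma tw_m_growth:
  assumes s: "sin \<alpha> > 0" and D: "Delta S \<alpha> q M \<beta> z \<noteq> 0" and Im: "Im z \<noteq> 0"
    and z: "1 \<le> cmod z" "1 / S\<^sup>2 \<le> cmod z"
  shows "cmod (tw_m S \<alpha> q M \<beta> z - complex_of_real (cos \<alpha> / sin \<alpha>)) * \<bar>Im z\<bar> \<le>
    3 * (integral {-S..S} (\<lambda>x. (q x)\<^sup>2) + 17) / (sin \<alpha>)\<^sup>2 * sqrt (cmod z)"
proof -
  let ?v = "v_sol S q M \<beta> z (-S)" and ?D = "Delta S \<alpha> q M \<beta> z"
  let ?Q = "integral {-S..S} (\<lambda>x. (q x)\<^sup>2)"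
  define r where "r = sqrt (cmod z)"
  have r1: "r \<ge> 1" using z(1) by (simp add: r_def)
  have zr: "cmod z = r\<^sup>2" by (simp add: r_def)
  have "(1 / S)\<^sup>2 \<le> r\<^sup>2" using z(2) unfolding zr by (simp add: power_divide)
  then have "1 / S \<le> r" by (rule power2_le_imp_le) (use r1 in simp)
  then have d: "0 < 1 / r" "1 / r \<le> S" using r1 S_pos by (auto simp: field_simps)
  have Q: "0 \<le> ?Q"
    by (intro integral_nonneg square_integrable_on_imp_integrable(1)[OF q_sq]) auto
  have "cmod ?v * \<bar>Im z\<bar> * sin \<alpha> \<le> 3 * ((1/r)\<^sup>2 * ?Q + (cmod z)\<^sup>2 * (1/r) ^ 3 + 16 / (1/r)) * cmod ?D"
    by (rule v_sol_left_bound[OF s D d Im])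
  also have "\<dots> \<le> 3 * (r * ?Q + r + 16 * r) * cmod ?D"
  proof (intro mult_right_mono mult_left_mono add_mono)
    show "(1/r)\<^sup>2 \<le> r"
      using r1 power_le_one[of "1/r" 2] by simp
    show "(cmod z)\<^sup>2 * (1/r) ^ 3 \<le> r"
      unfolding zr using r1 by (simp add: power_divide eval_nat_numeral)
  qed (use Q r1 in auto)
  finally have "cmod ?v * \<bar>Im z\<bar> * sin \<alpha> \<le> (3 * (?Q + 17) * r) * cmod ?D"
    by (simp add: algebra_simps)
  then have "cmod ?v * \<bar>Im z\<bar> * sin \<alpha> / (cmod ?D * (sin \<alpha>)\<^sup>2) \<le> (3 * (?Q + 17) * r) * cmod ?D / (cmod ?D * (sin \<alpha>)\<^sup>2)"
    by (rule divide_right_mono) simp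
  moreover have "cmod (tw_m S \<alpha> q M \<beta> z - complex_of_real (cos \<alpha> / sin \<alpha>)) * \<bar>Im z\<bar> =
      cmod ?v * \<bar>Im z\<bar> * sin \<alpha> / (cmod ?D * (sin \<alpha>)\<^sup>2)"
    unfolding tw_m_minus_cot[OF s D] using s by (simp add: norm_divide norm_mult power2_eq_square field_simps)
  moreover have "(3 * (?Q + 17) * r) * cmod ?D / (cmod ?D * (sin \<alpha>)\<^sup>2) = 3 * (?Q + 17) / (sin \<alpha>)\<^sup>2 * r"
    using D by simp
  ultimately show ?thesis by (simp add: r_def)
qed

end

section \<open>Comparison of the two m-functions\<close>

theorem theorem3p2:
  fixes S \<alpha> \<beta> \<beta>' :: real and q q' :: "real \<Rightarrow> real" and M M' :: "real^2^2"
    and lam lam' :: "nat \<Rightarrow> real"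
  assumes "S > 0" and "0 < \<alpha>" "\<alpha> < pi"
    and "square_integrable_on q {-S..S}" and "det M = 1" and "0 < \<beta>" "\<beta> \<le> pi"
    and "square_integrable_on q' {-S..S}" and "det M' = 1" and "0 < \<beta>'" "\<beta>' \<le> pi"
    and "eigenvalue_sequence S \<alpha> q M \<beta> lam"
    and "eigenvalue_sequence S \<alpha> q' M' \<beta>' lam'"
    and "\<And>n. lam n = lam' n"
    and "\<And>n. norming_constant S \<alpha> q M (lam n) = norming_constant S \<alpha> q' M' (lam' n)"
  shows "tw_m S \<alpha> q M \<beta> meromorphic_on UNIV \<and> tw_m S \<alpha> q' M' \<beta>' meromorphic_on UNIV \<and>
         tw_m S \<alpha> q M \<beta> = tw_m S \<alpha> q' M' \<beta>'"
proof -
  interpret P: sl_problem S q M by unfold_locales (use assms in auto)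
  interpret P': sl_problem S q' M' by unfold_locales (use assms in auto)
  have s: "sin \<alpha> > 0" using assms by (intro sin_gt_zero) auto
  let ?D = "Delta S \<alpha> q M \<beta>" and ?D' = "Delta S \<alpha> q' M' \<beta>'"
  let ?N = "P.m_numerator \<alpha> \<beta>" and ?N' = "P'.m_numerator \<alpha> \<beta>'"
  let ?m = "tw_m S \<alpha> q M \<beta>" and ?m' = "tw_m S \<alpha> q' M' \<beta>'"
  have zeros: "?D z = 0 \<longleftrightarrow> (\<exists>n. z = complex_of_real (lam n))" "?D' z = 0 \<longleftrightarrow> ?D z = 0" for z
  proof -
    have "range (\<lambda>n. complex_of_real (lam n)) = eigenvalues S \<alpha> q M \<beta>"
      "range (\<lambda>n. complex_of_real (lam n)) = eigenvalues S \<alpha> q' M' \<beta>'"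
      using assms by (simp_all add: eigenvalue_sequence_def)
    then show "?D z = 0 \<longleftrightarrow> (\<exists>n. z = complex_of_real (lam n))" "?D' z = 0 \<longleftrightarrow> ?D z = 0"
      unfolding P.Delta_eq_0_iff[OF s] P'.Delta_eq_0_iff[OF s] by blast+
  qed
  have nonreal: "?D z \<noteq> 0" if "Im z \<noteq> 0" for z
    using that by (auto simp: zeros(1))
  have mer: "?m meromorphic_on UNIV" "?m' meromorphic_on UNIV"
    by (rule P.tw_m_meromorphic P'.tw_m_meromorphic)+
  define f where "f z = ?m z - ?m' z" for z
  have fmer: "f meromorphic_on UNIV"
    unfolding f_def by (intro meromorphic_intros mer)
  have analytic: "f analytic_on {z}" if "?D z \<noteq> 0" for z
  proof -
    have "?N analytic_on {z}" "?N' analytic_on {z}" "?D analytic_on {z}" "?D' analytic_on {z}"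
      using P.m_numerator_holomorphic P'.m_numerator_holomorphic P.Delta_holomorphic P'.Delta_holomorphic
      by (auto simp: analytic_on_open intro: analytic_on_subset[of _ UNIV])
    then show ?thesis
      unfolding f_def P.tw_m_eq P'.tw_m_eq
      using that zeros(2)[of z] by (intro analytic_intros) auto
  qed
  \<comment> \<open>A finite limit at every point makes all singularities of \<open>f\<close>
    removable.\<close>
  have lim: "\<exists>c. f \<midarrow>z\<rightarrow> c" for z
  proof (cases "?D z = 0")
    case False
    then show ?thesis using analytic analytic_at_imp_isCont isContD by blast
  next
    case True
    then obtain n where n: "z = complex_of_real (lam n)" using zeros(1) by blast
    let ?a = "norming_constant S \<alpha> q M (lam n)"
    have a': "norming_constant S \<alpha> q' M' (lam n) = ?a"
      using assms(14)[of n] assms(15)[of n] by simp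
    have a0: "?a \<noteq> 0" by (rule P.norming_constant_nonzero[OF s])
    note D0 = True True[folded zeros(2)]
    have dD: "(?D has_field_derivative ?N z * ?a) (at z)" "(?D' has_field_derivative ?N' z * ?a) (at z)"
      using P.Delta_has_derivative_at_zero[OF s, of \<beta> "lam n"] P'.Delta_has_derivative_at_zero[OF s, of \<beta>' "lam n"] D0
      by (simp_all add: n a')
    have k0: "?N z \<noteq> 0" "?N' z \<noteq> 0"
      using P.v_sol_eq_w_sol(1)[OF s] P'.v_sol_eq_w_sol(1)[OF s] D0 by auto
    obtain dN dN' where dN: "(?N has_field_derivative dN) (at z)" "(?N' has_field_derivative dN') (at z)"
      using P.m_numerator_holomorphic P'.m_numerator_holomorphic by (meson UNIV_I holomorphic_on_open open_UNIV)
    \<comment> \<open>The numerator of \<open>f\<close> over the common denominator. Its derivative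
      at \<open>z\<close> is the difference of two equal products because the norming constants
      agree, so it vanishes to second order, while each of the two \<open>Delta\<close> functions
      has a simple zero.\<close>
    let ?h = "\<lambda>w. ?N w * ?D' w - ?N' w * ?D w"
    have "(?h has_field_derivative 0) (at z)"
      by (rule derivative_eq_intros dN dD refl)+ (simp add: D0)
    then have "((\<lambda>w. (?h w / (w - z)) / ((?D w / (w - z)) * (?D' w / (w - z)))) \<longlongrightarrow>
        0 / ((?N z * ?a) * (?N' z * ?a))) (at z)"
      using D0 k0 a0 by (intro tendsto_divide tendsto_mult has_field_derivative_zero_quotient dD) auto
    moreover have "\<forall>\<^sub>F w in at z. (?h w / (w - z)) / ((?D w / (w - z)) * (?D' w / (w - z))) = (w - z) * f w"
    proof -
      have "(?h w / (w - z)) / ((?D w / (w - z)) * (?D' w / (w - z))) = (w - z) * f w" if "w \<noteq> z" for w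
      proof (cases "?D w = 0")
        \<comment> \<open>Both m-functions are 0 here by the convention for division by zero, and so
          is the left-hand side.\<close>
        case True
        then show ?thesis using zeros(2)[of w] by (simp add: f_def P.tw_m_eq P'.tw_m_eq)
      next
        case False
        then have "?D' w \<noteq> 0" by (simp add: zeros(2))
        with False that show ?thesis by (simp add: f_def P.tw_m_eq P'.tw_m_eq field_simps)
      qed
      then show ?thesis by (simp add: eventually_at_filter)
    qed
    ultimately have lim0: "((\<lambda>w. (w - z) * f w) \<longlongrightarrow> 0) (at z)"
      using Lim_transform_eventually by fastforce
    obtain r where r: "r > 0" "f holomorphic_on ball z r - {z}"
    proof -
      have "isolated_singularity_at f z"
        using fmer by (simp add: meromorphic_on_altdef)
      then show thesis
        using that by (auto simp: isolated_singularity_at_def dest: analytic_imp_holomorphic)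
    qed
    obtain g where g: "g holomorphic_on ball z r" "\<And>w. w \<in> ball z r - {z} \<Longrightarrow> g w = f w"
      using holomorphic_on_extend_lim[OF r(2), of] r(1) lim0 by auto
    have "isCont g z"
      using g(1) r(1) by (meson centre_in_ball continuous_on_eq_continuous_at holomorphic_on_imp_continuous_on open_ball)
    then have "g \<midarrow>z\<rightarrow> g z" by (rule isContD)
    moreover have "\<forall>\<^sub>F w in at z. g w = f w"
      using eventually_at_ball[OF r(1), of z UNIV] by (auto simp: eventually_at_filter g(2) elim: eventually_mono)
    ultimately show ?thesis using Lim_transform_eventually by blast
  qed
  \<comment> \<open>At the eigenvalues \<open>f\<close> carries the conventional value 0, which may
    differ from its limit there; \<open>F\<close> takes the limits instead.\<close>
  define F where "F = remove_sings f"
  have "F analytic_on {z}" for z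
    unfolding F_def using lim[of z] fmer remove_sings_analytic_at
    by (auto simp: meromorphic_on_altdef)
  then have "F analytic_on UNIV" by (simp add: analytic_on_analytic_at[of F UNIV])
  then have F: "F holomorphic_on UNIV" by (rule analytic_imp_holomorphic)
  have Ff: "F z = f z" if "?D z \<noteq> 0" for z
    unfolding F_def using analytic[OF that] by simp
  define C where "C = 3 * (integral {-S..S} (\<lambda>x. (q x)\<^sup>2) + 17) / (sin \<alpha>)\<^sup>2"
  define C' where "C' = 3 * (integral {-S..S} (\<lambda>x. (q' x)\<^sup>2) + 17) / (sin \<alpha>)\<^sup>2"
  have F0: "F z = 0" for z
  proof (rule entire_eq_0_if_bounded_off_real_axis[OF F, of "max 1 (1 / S\<^sup>2)" "C + C'"])
    fix z assume z: "max 1 (1 / S\<^sup>2) \<le> cmod z" "Im z \<noteq> 0"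
    have z1: "1 \<le> cmod z" "1 / S\<^sup>2 \<le> cmod z" using z(1) by auto
    let ?c = "complex_of_real (cos \<alpha> / sin \<alpha>)"
    have D: "?D z \<noteq> 0" "?D' z \<noteq> 0" using nonreal[OF z(2)] zeros(2) by auto
    have "cmod (F z) \<le> cmod (?m z - ?c) + cmod (?m' z - ?c)"
      unfolding Ff[OF D(1)] f_def using norm_triangle_ineq4[of "?m z - ?c" "?m' z - ?c"] by simp
    then have "cmod (F z) * \<bar>Im z\<bar> \<le> cmod (?m z - ?c) * \<bar>Im z\<bar> + cmod (?m' z - ?c) * \<bar>Im z\<bar>"
      unfolding distrib_right[symmetric] by (rule mult_right_mono) simp
    also have "\<dots> \<le> C * sqrt (cmod z) + C' * sqrt (cmod z)"
      unfolding C_def C'_def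
      by (rule add_mono[OF P.tw_m_growth[OF s D(1) z(2) z1] P'.tw_m_growth[OF s D(2) z(2) z1]])
    finally show "cmod (F z) * \<bar>Im z\<bar> \<le> (C + C') * sqrt (cmod z)"
      by (simp add: distrib_right)
  qed
  \<comment> \<open>The vanishing of \<open>F\<close> settles all points off the eigenvalues; at the
    eigenvalues both sides have the conventional value 0.\<close>
  have "?m z = ?m' z" for z
  proof (cases "?D z = 0")
    case True
    then show ?thesis using zeros(2)[of z] by (simp add: P.tw_m_eq P'.tw_m_eq)
  next
    case False
    then show ?thesis using Ff F0 by (simp add: f_def)
  qed
  with mer show ?thesis by blast
qed

end
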